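(* Every (finite simple) graph with at most $7$ vertices has an outside-obstacle representation.
   Context: An obstacle is a topologically open, non-self-intersecting polygonal region in the plane (possibly unbounded). Given an obstacle $C$ and a finite set $P$ of points in general position in the complement of $C$, the visibility graph $G_C(P)$ has vertex set $P$ and an edge $pq$ exactly when $\overline{pq}\cap C=\emptyset$; its straight-line drawing is the visibility drawing. An outside-obstacle representation of a graph $G$ is a pair $(P,C)$ with $G\cong G_C(P)$ such that $C$ lies in the unbounded connected component of the complement of the visibility drawing. *)

theory Defs
  imports "HOL-Analysis.Analysis"
begin

type_synonym point = "real^2"

definition poly_edge :: "point list \<Rightarrow> nat \<Rightarrow> point set" where
  "poly_edge ps i = closed_segment (ps ! i) (ps ! ((i + 1) mod length ps))"

definition simple_closed_polygon :: "point list \<Rightarrow> bool" where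
  "simple_closed_polygon ps \<longleftrightarrow>
     length ps \<ge> 3 \<and> distinct ps \<and>
     (\<forall>i < length ps. \<forall>j < length ps. i \<noteq> j \<longrightarrow>
        (if j = (i + 1) mod length ps then poly_edge ps i \<inter> poly_edge ps j = {ps ! j}
         else if i = (j + 1) mod length ps then poly_edge ps i \<inter> poly_edge ps j = {ps ! i}
         else poly_edge ps i \<inter> poly_edge ps j = {}))"

definition closed_polygon_image :: "point list \<Rightarrow> point set" where
  "closed_polygon_image ps = (\<Union>i < length ps. poly_edge ps i)"

definition chain_edge :: "point list \<Rightarrow> nat \<Rightarrow> point set" where
  "chain_edge ps i = closed_segment (ps ! i) (ps ! (i + 1))"

definition chain_image :: "point list \<Rightarrow> point set" where
  "chain_image ps = set ps \<union> (\<Union>i < length ps - 1. chain_edge ps i)"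

definition ray :: "point \<Rightarrow> point \<Rightarrow> point set" where
  "ray p d = {p + t *\<^sub>R d | t. t \<ge> 0}"

definition simple_infinite_chain :: "point list \<Rightarrow> point \<Rightarrow> point \<Rightarrow> bool" where
  "simple_infinite_chain ps d1 d2 \<longleftrightarrow>
     ps \<noteq> [] \<and> distinct ps \<and> d1 \<noteq> 0 \<and> d2 \<noteq> 0 \<and>
     (\<forall>i < length ps - 1. \<forall>j < length ps - 1. i < j \<longrightarrow>
        (if j = i + 1 then chain_edge ps i \<inter> chain_edge ps j = {ps ! j}
         else chain_edge ps i \<inter> chain_edge ps j = {})) \<and>
     ray (hd ps) d1 \<inter> chain_image ps = {hd ps} \<and>
     ray (last ps) d2 \<inter> chain_image ps = {last ps} \<and>
     ray (hd ps) d1 \<inter> ray (last ps) d2 \<subseteq> {hd ps} \<inter> {last ps}"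

definition infinite_chain_image :: "point list \<Rightarrow> point \<Rightarrow> point \<Rightarrow> point set" where
  "infinite_chain_image ps d1 d2 = ray (hd ps) d1 \<union> chain_image ps \<union> ray (last ps) d2"

text \<open>An obstacle: an open, non-self-intersecting polygonal region (possibly unbounded),
  i.e. a connected component of the complement of a simple closed polygon or of a
  simple bi-infinite polygonal chain.\<close>

definition obstacle :: "point set \<Rightarrow> bool" where
  "obstacle C \<longleftrightarrow>
     (\<exists>B. ((\<exists>ps. simple_closed_polygon ps \<and> B = closed_polygon_image ps) \<or>
           (\<exists>ps d1 d2. simple_infinite_chain ps d1 d2 \<and> B = infinite_chain_image ps d1 d2)) \<and>
          C \<in> components (- B))"

definition general_position :: "point set \<Rightarrow> bool" where
  "general_position P \<longleftrightarrow> (\<forall>p\<in>P. \<forall>q\<in>P. \<forall>r\<in>P.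
      p \<noteq> q \<and> q \<noteq> r \<and> p \<noteq> r \<longrightarrow> \<not> collinear {p, q, r})"

definition visible :: "point set \<Rightarrow> point set \<Rightarrow> point \<Rightarrow> point \<Rightarrow> bool" where
  "visible C P p q \<longleftrightarrow> p \<in> P \<and> q \<in> P \<and> p \<noteq> q \<and> closed_segment p q \<inter> C = {}"

definition visibility_drawing :: "point set \<Rightarrow> point set \<Rightarrow> point set" where
  "visibility_drawing C P = P \<union> \<Union>{closed_segment p q | p q. visible C P p q}"

definition outside_obstacle_rep ::
    "'a set \<Rightarrow> ('a \<Rightarrow> 'a \<Rightarrow> bool) \<Rightarrow> point set \<Rightarrow> point set \<Rightarrow> bool" where
  "outside_obstacle_rep V E P C \<longleftrightarrow>
     obstacle C \<and> finite P \<and> general_position P \<and> P \<inter> C = {} \<and>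
     (\<exists>f. bij_betw f V P \<and> (\<forall>u\<in>V. \<forall>v\<in>V. E u v \<longleftrightarrow> visible C P (f u) (f v))) \<and>
     (\<exists>K \<in> components (- visibility_drawing C P). \<not> bounded K \<and> C \<subseteq> K)"

end

theory Submission
  imports Defs
begin

text \<open>
  A single configuration of seven points serves all graphs. The obstacle is the complement of a strip
  \<open>{(x, y). 0 \<le> x \<and> - g x \<le> y \<and> y \<le> f x}\<close> containing all points: it consists of everything to the
  left, above and below, with narrow spikes hanging down from above and standing up from below.
  A spike on the vertical line \<open>x = i\<close> may be driven in until it touches the outermost edge of the
  drawing there, so it destroys exactly the non-edges lying further out. Hence a labelled graph is
  represented as soon as every non-edge is, on some vertical line, separated from the top or from
  the bottom by non-edges only. Whether this happens is a monotone condition on the set of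
  non-edges, and a decision tree over the 21 pairs shows that every graph on seven vertices
  satisfies it after a suitable relabelling.
\<close>

subsection \<open>The complement of a strip\<close>


text \<open>The points never move; only the spikes depend on the graph. Segments are closed and the
  obstacle is open, so the tip of a spike may rest on the outermost edge without blocking it, while
  every segment strictly beyond the tip is cut. Whether a non-edge can be cut is therefore a
  question about the vertical order of the segments on one line, and since all coordinates are
  integers it reduces to integer inequalities that can be evaluated.

  The position of the obstacle outside the drawing comes almost for free: it is connected, unbounded
  and disjoint from the drawing, so it lies in a single unbounded component of the complement.

  The 2^21 labelled graphs are not treated one by one. The case analysis climbs through the
  isomorphism types on three, four and five vertices, and only below each of the 34 types on five
  vertices does it branch on the eleven pairs that involve the last two vertices. Smaller graphs are
  padded with isolated vertices, whose points are left out again at the end.\<close>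

definition ramp :: "real \<Rightarrow> real" where
  "ramp t = max 0 (min 1 t)"

text \<open>The piecewise linear function through the points \<open>(i, F i)\<close> with
  \<open>i\<close> at most \<open>L\<close>, provided \<open>F 0 = 0\<close>, and constant on either
  side of \<open>[0, L]\<close>. As a sum of ramps it is continuous term by term, without gluing
  pieces.\<close>

definition interp :: "nat \<Rightarrow> (nat \<Rightarrow> real) \<Rightarrow> real \<Rightarrow> real" where
  "interp L F x = (\<Sum>i<L. (F (Suc i) - F i) * ramp (x - real i))"

lemma continuous_on_interp: "continuous_on S (interp L F)"
  unfolding interp_def ramp_def by (intro continuous_intros)

lemma interp_nonpos: "x \<le> 0 \<Longrightarrow> interp L F x = 0"
  by (auto simp: interp_def ramp_def intro!: sum.neutral)

text \<open>At \<open>k + t\<close> the ramps before index \<open>k\<close> are saturated at 1, so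
  their increments telescope to \<open>F k\<close>; ramp \<open>k\<close> has the value
  \<open>t\<close>, and all later ones are still 0.\<close>

lemma interp_segment:
  assumes "k < L" "F 0 = 0" "0 \<le> t" "t \<le> 1"
  shows "interp L F (real k + t) = (1 - t) * F k + t * F (Suc k)"
proof -
  have "interp L F (real k + t) = (\<Sum>i<Suc k. (F (Suc i) - F i) * ramp (real k + t - real i))"
    unfolding interp_def
  proof (rule sum.mono_neutral_right)
    show "\<forall>i\<in>{..<L} - {..<Suc k}. (F (Suc i) - F i) * ramp (real k + t - real i) = 0"
    proof
      fix i assume "i \<in> {..<L} - {..<Suc k}"
      then have "real k + t - real i \<le> 0" using assms by auto
      then show "(F (Suc i) - F i) * ramp (real k + t - real i) = 0" by (simp add: ramp_def)
    qed
  qed (use assms in auto)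
  also have "\<dots> = (\<Sum>i<k. F (Suc i) - F i) + (F (Suc k) - F k) * t"
  proof -
    have "ramp (real k + t - real i) = 1" if "i < k" for i
    proof -
      have "real i + 1 \<le> real k" using that by linarith
      then show ?thesis using assms by (simp add: ramp_def)
    qed
    then show ?thesis using assms by (simp add: ramp_def)
  qed
  finally show ?thesis
    using assms by (simp add: sum_lessThan_telescope algebra_simps)
qed

lemma interp_ge:
  assumes "real L \<le> x" "F 0 = 0"
  shows "interp L F x = F L"
proof -
  have "ramp (x - real i) = 1" if "i < L" for i
  proof -
    have "real i + 1 \<le> real L" using that by linarith
    then show ?thesis using assms by (simp add: ramp_def)
  qed
  then show ?thesis
    using assms by (simp add: interp_def sum_lessThan_telescope)
qed

lemma interp_at:
  assumes "i \<le> L" "F 0 = 0"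
  shows "interp L F (real i) = F i"
proof (cases "i = L")
  case True
  then show ?thesis using assms by (simp add: interp_ge)
next
  case False
  then show ?thesis using interp_segment[of i L F 0] assms by simp
qed

text \<open>Not simply the floor: at the right end \<open>x = L\<close> the last piece is taken with
  \<open>t = 1\<close>, so that \<open>k < L\<close> holds throughout.\<close>

lemma segment_coord:
  assumes "0 < x" "x \<le> real L"
  obtains k t where "k < L" "0 \<le> t" "t \<le> 1" "x = real k + t"
proof (cases "x = real L")
  case True
  with assms have "L > 0" by auto
  with True show ?thesis by (intro that[of "L - 1" 1]) auto
next
  case False
  with assms show ?thesis
    by (intro that[of "nat \<lfloor>x\<rfloor>" "x - of_int \<lfloor>x\<rfloor>"]) linarith+
qed

text \<open>A convex combination of \<open>F k\<close>, which is nonnegative, and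
  \<open>F (Suc k)\<close>, which is positive. The weight of the latter vanishes only at an integer,
  and that integer is then positive.\<close>

lemma interp_pos:
  assumes "0 < x" "F 0 = 0" "\<And>i. 0 < i \<Longrightarrow> 0 < F i" "0 < L"
  shows "0 < interp L F x"
proof (cases "x \<le> real L")
  case True
  with assms(1) obtain k t where k: "k < L" "0 \<le> t" "t \<le> 1" "x = real k + t"
    by (rule segment_coord)
  have F: "0 < F (Suc k)" "0 \<le> F k" using assms(2) assms(3)[of "Suc k"] assms(3)[of k] by (cases k; simp)+
  show ?thesis
  proof (cases "t = 1")
    case True
    then show ?thesis using F k assms by (simp add: interp_segment)
  next
    case False
    show ?thesis
    proof (cases "t = 0")
      case True
      then have "0 < k" using k assms by auto
      then show ?thesis using True k assms by (simp add: interp_segment[where t = 0, simplified])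
    next
      case False
      then have "0 < t * F (Suc k)" using k F by simp
      moreover have "0 \<le> (1 - t) * F k" using k F by simp
      moreover have "interp L F x = (1 - t) * F k + t * F (Suc k)"
        using k assms by (simp add: interp_segment)
      ultimately show ?thesis by linarith
    qed
  qed
next
  case False
  then show ?thesis using assms by (simp add: interp_ge)
qed

section \<open>Coordinates in the plane and graphs of interpolants as segments\<close>

definition pt :: "real \<Rightarrow> real \<Rightarrow> point" where
  "pt x y = vector [x, y]"

lemma pt_nth [simp]: "pt x y $ 1 = x" "pt x y $ 2 = y"
  by (simp_all add: pt_def)

lemma pt_eq_iff: "p = pt x y \<longleftrightarrow> p $ 1 = x \<and> p $ 2 = y"
  by (simp add: vec_eq_iff forall_2)

lemma point_eq_iff: "(p :: point) = q \<longleftrightarrow> p $ 1 = q $ 1 \<and> p $ 2 = q $ 2"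
  by (simp add: vec_eq_iff forall_2)

text \<open>The factor \<open>c\<close> allows one proof for both boundary curves: it is 1 for the
  upper one and -1 for the lower one.\<close>

lemma segment_interp:
  assumes "k < L" "F 0 = 0"
  shows "closed_segment (pt (real k) (c * F k)) (pt (real (Suc k)) (c * F (Suc k))) =
    {p. real k \<le> p $ 1 \<and> p $ 1 \<le> real (Suc k) \<and> p $ 2 = c * interp L F (p $ 1)}" (is "?S = ?G")
proof (intro equalityI subsetI)
  fix p assume "p \<in> ?S"
  then obtain t where t: "0 \<le> t" "t \<le> 1"
      "p = (1 - t) *\<^sub>R pt (real k) (c * F k) + t *\<^sub>R pt (real (Suc k)) (c * F (Suc k))"
    by (auto simp: in_segment)
  then have "p $ 1 = real k + t" "p $ 2 = c * ((1 - t) * F k + t * F (Suc k))"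
    unfolding t(3) by (simp_all add: algebra_simps)
  then show "p \<in> ?G" using t assms by (simp add: interp_segment)
next
  fix p assume p: "p \<in> ?G"
  define t where "t = p $ 1 - real k"
  have t: "0 \<le> t" "t \<le> 1" "p $ 1 = real k + t" using p by (auto simp: t_def)
  have "p $ 2 = c * ((1 - t) * F k + t * F (Suc k))"
    using p t assms by (simp add: interp_segment)
  then have "p = (1 - t) *\<^sub>R pt (real k) (c * F k) + t *\<^sub>R pt (real (Suc k)) (c * F (Suc k))"
    using t by (simp add: point_eq_iff algebra_simps)
  then show "p \<in> ?S" using t by (auto simp: in_segment)
qed

section \<open>The boundary of the strip as a simple infinite chain\<close>

locale strip =
  fixes L :: nat and F G :: "nat \<Rightarrow> real"
  assumes L: "0 < L"
    and F0: "F 0 = 0" and G0: "G 0 = 0"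
    and F_pos: "\<And>i. 0 < i \<Longrightarrow> 0 < F i" and G_pos: "\<And>i. 0 < i \<Longrightarrow> 0 < G i"
begin

abbreviation "f \<equiv> interp L F"
abbreviation "g \<equiv> interp L G"

lemmas f_nonpos = interp_nonpos[of _ L F]
lemmas g_nonpos = interp_nonpos[of _ L G]

lemma f_pos: "0 < x \<Longrightarrow> 0 < f x" and g_pos: "0 < x \<Longrightarrow> 0 < g x"
  by (auto intro!: interp_pos simp: L F0 G0 F_pos G_pos)

lemma f_nonneg: "0 \<le> f x" and g_nonneg: "0 \<le> g x"
  using f_pos[of x] f_nonpos[of x] g_pos[of x] g_nonpos[of x] by (cases "0 < x"; simp)+

text \<open>The chain is traversed from the right end of the lower curve leftwards to the origin,
  which has index \<open>L\<close>, and then rightwards along the upper curve. Indices up to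
  \<open>L\<close> thus run against the abscissa.\<close>

definition vertex :: "nat \<Rightarrow> point" where
  "vertex k = (if k \<le> L then pt (real (L - k)) (- G (L - k)) else pt (real (k - L)) (F (k - L)))"

definition chain :: "point list" where
  "chain = map vertex [0..<2 * L + 1]"

lemma length_chain: "length chain = 2 * L + 1"
  by (simp add: chain_def)

lemma chain_nth: "k \<le> 2 * L \<Longrightarrow> chain ! k = vertex k"
  by (simp add: chain_def del: upt_Suc)

lemma hd_chain: "hd chain = pt (real L) (- G L)"
proof -
  have "chain \<noteq> []" using length_chain by auto
  then show ?thesis
    using chain_nth[of 0] by (simp add: hd_conv_nth vertex_def)
qed

lemma last_chain: "last chain = pt (real L) (F L)"
proof -
  have "chain \<noteq> []" using length_chain by auto
  then have "last chain = vertex (2 * L)"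
    using chain_nth[of "2 * L"] by (simp add: last_conv_nth length_chain)
  then show ?thesis using L by (simp add: vertex_def)
qed

lemma chain_edge_lower:
  assumes "k < L"
  shows "chain_edge chain k =
    {p. real (L - Suc k) \<le> p $ 1 \<and> p $ 1 \<le> real (L - k) \<and> p $ 2 = - g (p $ 1)}"
proof -
  have "Suc (L - Suc k) = L - k" using assms by simp
  then show ?thesis
    using segment_interp[of "L - Suc k" L G "- 1"] assms
    by (simp add: chain_edge_def chain_nth vertex_def G0 closed_segment_commute)
qed

lemma chain_edge_upper:
  assumes "L \<le> k" "k < 2 * L"
  shows "chain_edge chain k =
    {p. real (k - L) \<le> p $ 1 \<and> p $ 1 \<le> real (Suc (k - L)) \<and> p $ 2 = f (p $ 1)}"
proof -
  have "vertex k = pt (real (k - L)) (F (k - L))"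
    using assms by (auto simp: vertex_def F0 G0)
  moreover have "vertex (Suc k) = pt (real (Suc (k - L))) (F (Suc (k - L)))"
    using assms by (simp add: vertex_def Suc_diff_le)
  ultimately show ?thesis
    using segment_interp[of "k - L" L F 1] assms
    by (simp add: chain_edge_def chain_nth F0)
qed

lemma vertex_lower: "k \<le> L \<Longrightarrow> vertex k = pt (real (L - k)) (- g (real (L - k)))"
  and vertex_upper: "L \<le> k \<Longrightarrow> k \<le> 2 * L \<Longrightarrow> vertex k = pt (real (k - L)) (f (real (k - L)))"
proof -
  show "k \<le> L \<Longrightarrow> vertex k = pt (real (L - k)) (- g (real (L - k)))"
    by (simp add: vertex_def interp_at G0 del: of_nat_diff)
  show "L \<le> k \<Longrightarrow> k \<le> 2 * L \<Longrightarrow> vertex k = pt (real (k - L)) (f (real (k - L)))"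
    using interp_at[of 0 L F] by (auto simp: vertex_def interp_at F0 G0 simp del: of_nat_diff)
qed

lemma chain_image_eq:
  "chain_image chain = {p. 0 \<le> p $ 1 \<and> p $ 1 \<le> real L \<and> (p $ 2 = f (p $ 1) \<or> p $ 2 = - g (p $ 1))}"
    (is "_ = ?R")
proof (intro equalityI subsetI)
  fix p assume "p \<in> chain_image chain"
  then consider k where "k \<le> 2 * L" "p = vertex k" | k where "k < 2 * L" "p \<in> chain_edge chain k"
    by (force simp: chain_image_def length_chain in_set_conv_nth chain_nth less_Suc_eq_le)
  then show "p \<in> ?R"
  proof cases
    case 1
    then show ?thesis by (cases "k \<le> L") (auto simp: vertex_lower vertex_upper)
  next
    case 2
    then show ?thesis by (cases "k < L") (auto simp: chain_edge_lower chain_edge_upper)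
  qed
next
  fix p assume p: "p \<in> ?R"
  obtain i where i: "i < L" "real i \<le> p $ 1" "p $ 1 \<le> real (Suc i)"
  proof (cases "p $ 1 = 0")
    case True then show ?thesis using that[of 0] L by simp
  next
    case False
    then have "0 < p $ 1" "p $ 1 \<le> real L" using p by auto
    from segment_coord[OF this] show ?thesis using that by (metis add.commute add_left_mono le_add_same_cancel1 of_nat_Suc)
  qed
  have "p \<in> chain_edge chain (L + i)" if "p $ 2 = f (p $ 1)"
    using i that by (subst chain_edge_upper) auto
  moreover have "p \<in> chain_edge chain (L - Suc i)" if "p $ 2 = - g (p $ 1)"
    using i that by (subst chain_edge_lower) (auto simp: Suc_diff_Suc)
  moreover have "L + i < 2 * L" "L - Suc i < 2 * L" using i by auto
  ultimately show "p \<in> chain_image chain"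
    using p unfolding chain_image_def length_chain by auto
qed

text \<open>For negative abscissas both curves are at height 0, so the first disjunct contributes
  exactly the negative x axis. This is what joins the part above the strip to the part below
  it.\<close>

definition outer :: "point set" where
  "outer = {p. p $ 1 < 0 \<or> f (p $ 1) < p $ 2 \<or> p $ 2 < - g (p $ 1)}"

definition inner :: "point set" where
  "inner = {p. 0 < p $ 1 \<and> p $ 2 < f (p $ 1) \<and> - g (p $ 1) < p $ 2}"

definition boundary :: "point set" where
  "boundary = {p. 0 \<le> p $ 1 \<and> (p $ 2 = f (p $ 1) \<or> p $ 2 = - g (p $ 1))}"

text \<open>Beyond \<open>L\<close> the interpolants are constant, so two horizontal rays continue
  the graphs without a change of formula.\<close>

lemma ray_lower: "ray (hd chain) (pt 1 0) = {p. real L \<le> p $ 1 \<and> p $ 2 = - g (p $ 1)}"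
  and ray_upper: "ray (last chain) (pt 1 0) = {p. real L \<le> p $ 1 \<and> p $ 2 = f (p $ 1)}"
proof -
  have *: "ray (pt (real L) c) (pt 1 0) = {p. real L \<le> p $ 1 \<and> p $ 2 = c}" for c
  proof (intro equalityI subsetI)
    fix p :: point assume "p \<in> {p. real L \<le> p $ 1 \<and> p $ 2 = c}"
    then show "p \<in> ray (pt (real L) c) (pt 1 0)"
      unfolding ray_def by (intro CollectI exI[of _ "p $ 1 - real L"]) (auto simp: point_eq_iff)
  qed (auto simp: ray_def)
  show "ray (hd chain) (pt 1 0) = {p. real L \<le> p $ 1 \<and> p $ 2 = - g (p $ 1)}"
    unfolding hd_chain * by (auto simp: interp_ge G0)
  show "ray (last chain) (pt 1 0) = {p. real L \<le> p $ 1 \<and> p $ 2 = f (p $ 1)}"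
    unfolding last_chain * by (auto simp: interp_ge F0)
qed

text \<open>Both functions are positive to the right of 0, so over nonnegative abscissas the two
  curves share only the origin. Every disjointness claim between an upper and a lower piece of the
  chain rests on this.\<close>

lemma upper_lower_disjoint: "f x = - g x \<longleftrightarrow> x \<le> 0"
  using f_pos[of x] g_pos[of x] f_nonpos[of x] g_nonpos[of x] by (cases "0 < x") auto

lemma infinite_chain_image_eq: "infinite_chain_image chain (pt 1 0) (pt 1 0) = boundary"
  using L unfolding infinite_chain_image_def chain_image_eq ray_lower ray_upper boundary_def
  by (auto intro: order_trans[of 0 "real L"])

text \<open>Each edge and each ray is the part of one of the two graphs over an interval of
  abscissas. Pieces of the same graph meet only where their intervals do; pieces of different graphs
  meet only at the origin.\<close>

lemma simple_chain: "simple_infinite_chain chain (pt 1 0) (pt 1 0)"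
  unfolding simple_infinite_chain_def
proof (intro conjI allI impI)
  show "chain \<noteq> []" using length_chain by auto
  show "distinct chain"
    unfolding chain_def distinct_map
  proof (intro conjI inj_onI)
    fix i j assume ij: "i \<in> set [0..<2 * L + 1]" "j \<in> set [0..<2 * L + 1]" "vertex i = vertex j"
    consider "i \<le> L" "j \<le> L" | "L < i" "L < j" | "i \<le> L" "L < j" | "j \<le> L" "L < i" by linarith
    then show "i = j"
    proof cases
      case 3
      then have "real (L - i) = real (j - L)" "- G (L - i) = F (j - L)"
        using ij(3) by (auto simp: vertex_def pt_eq_iff)
      then show ?thesis using 3 F_pos[of "j - L"] G_pos[of "L - i"] by simp
    next
      case 4
      then have "real (L - j) = real (i - L)" "- G (L - j) = F (i - L)"
        using ij(3) by (auto simp: vertex_def pt_eq_iff)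
      then show ?thesis using 4 F_pos[of "i - L"] G_pos[of "L - j"] by simp
    qed (use ij in \<open>auto simp: vertex_def pt_eq_iff\<close>)
  qed simp
  show "pt 1 0 \<noteq> 0" "pt 1 0 \<noteq> 0" by (auto simp: point_eq_iff)
  fix i j assume "i < length chain - 1" "j < length chain - 1" "i < j"
  then have ij: "i < 2 * L" "j < 2 * L" "i < j" by (auto simp: length_chain)
  consider "j < L" | "i < L" "L \<le> j" | "L \<le> i" using ij by linarith
  then show "if j = i + 1 then chain_edge chain i \<inter> chain_edge chain j = {chain ! j}
         else chain_edge chain i \<inter> chain_edge chain j = {}"
  proof cases
    case 1
    have "chain_edge chain i \<inter> chain_edge chain j = {}" if "j \<noteq> i + 1"
    proof -
      have "L - j < L - Suc i" using that ij 1 by auto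
      then have "real (L - j) < real (L - Suc i)" by linarith
      then show ?thesis using 1 ij by (auto simp: chain_edge_lower)
    qed
    moreover have "chain_edge chain i \<inter> chain_edge chain j = {chain ! j}" if "j = i + 1"
    proof -
      have L: "i < L" "j \<le> L" "j \<le> 2 * L" "L - Suc i = L - j" using 1 ij that by auto
      show ?thesis
        unfolding chain_edge_lower[OF L(1)] chain_edge_lower[OF 1]
          chain_nth[OF L(3)] vertex_lower[OF L(2)] L(4)
        using 1 ij by (auto simp: pt_eq_iff simp del: of_nat_diff)
    qed
    ultimately show ?thesis by (cases "j = i + 1") simp_all
  next
    case 2
    \<comment> \<open>A common point lies on both curves, hence has abscissa 0. The only lower edge
      that reaches abscissa 0 has index \<open>L - 1\<close>, the only upper one has index
      \<open>L\<close>.\<close>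
    have x: "p = pt 0 0 \<and> i = L - 1 \<and> j = L"
      if "p \<in> chain_edge chain i" "p \<in> chain_edge chain j" for p
    proof -
      have lower: "real (L - Suc i) \<le> p $ 1" "p $ 2 = - g (p $ 1)"
        using that(1) unfolding chain_edge_lower[OF 2(1)] by auto
      have upper: "real (j - L) \<le> p $ 1" "p $ 2 = f (p $ 1)"
        using that(2) unfolding chain_edge_upper[OF 2(2) ij(2)] by auto
      have "p $ 1 \<le> 0" using lower upper by (simp flip: upper_lower_disjoint)
      moreover have "0 \<le> p $ 1" using lower(1) of_nat_0_le_iff order_trans by blast
      ultimately have "p $ 1 = 0" by simp
      then show ?thesis using lower upper 2 by (simp add: f_nonpos pt_eq_iff del: of_nat_diff)
    qed
    have "pt 0 0 \<in> chain_edge chain (L - 1)" "pt 0 0 \<in> chain_edge chain L" "chain ! L = pt 0 0"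
      using L by (auto simp: chain_edge_lower chain_edge_upper f_nonpos g_nonpos chain_nth vertex_lower)
    then have "chain_edge chain i \<inter> chain_edge chain j = {chain ! j}" if "j = i + 1"
    proof -
      have ij': "i = L - 1" "j = L" using that 2 by auto
      show ?thesis
      proof (intro equalityI subsetI)
        fix p assume "p \<in> chain_edge chain i \<inter> chain_edge chain j"
        then show "p \<in> {chain ! j}" using x \<open>chain ! L = pt 0 0\<close> ij' by simp
      qed (use ij' \<open>pt 0 0 \<in> chain_edge chain (L - 1)\<close> \<open>pt 0 0 \<in> chain_edge chain L\<close>
        \<open>chain ! L = pt 0 0\<close> in simp)
    qed
    moreover have "chain_edge chain i \<inter> chain_edge chain j = {}" if "j \<noteq> i + 1"
    proof (rule equals0I)
      fix p assume "p \<in> chain_edge chain i \<inter> chain_edge chain j"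
      then have "i = L - 1" "j = L" using x by auto
      then show False using that L by simp
    qed
    ultimately show ?thesis by (cases "j = i + 1") simp_all
  next
    case 3
    have "chain_edge chain i \<inter> chain_edge chain j = {}" if "j \<noteq> i + 1"
    proof -
      have "Suc (i - L) < j - L" using that ij 3 by auto
      then have "real (Suc (i - L)) < real (j - L)" by linarith
      then show ?thesis using 3 ij by (auto simp: chain_edge_upper)
    qed
    moreover have "chain_edge chain i \<inter> chain_edge chain j = {chain ! j}" if "j = i + 1"
    proof -
      have L: "L \<le> j" "j \<le> 2 * L" "Suc (i - L) = j - L" using 3 ij that by auto
      show ?thesis
        unfolding chain_edge_upper[OF 3 ij(1)] chain_edge_upper[OF L(1) ij(2)]
          chain_nth[OF L(2)] vertex_upper[OF L(1,2)] L(3)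
        using L by (auto simp: pt_eq_iff simp del: of_nat_diff)
    qed
    ultimately show ?thesis by (cases "j = i + 1") simp_all
  qed
next
  have at: "f (real L) = F L" "g (real L) = G L" by (simp_all add: interp_ge F0 G0)
  have ne: "f x \<noteq> - g x" if "real L \<le> x" for x
    using that L upper_lower_disjoint[of x] by simp
  show "ray (hd chain) (pt 1 0) \<inter> chain_image chain = {hd chain}"
  proof (rule set_eqI)
    fix p
    have "p \<in> ray (hd chain) (pt 1 0) \<inter> chain_image chain \<longleftrightarrow> p $ 1 = real L \<and> p $ 2 = - g (p $ 1)"
      using L ne[of "p $ 1"] unfolding ray_lower chain_image_eq by auto
    also have "\<dots> \<longleftrightarrow> p \<in> {hd chain}"
      unfolding hd_chain singleton_iff pt_eq_iff using at by auto
    finally show "p \<in> ray (hd chain) (pt 1 0) \<inter> chain_image chain \<longleftrightarrow> p \<in> {hd chain}" .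
  qed
  show "ray (last chain) (pt 1 0) \<inter> chain_image chain = {last chain}"
  proof (rule set_eqI)
    fix p
    have "p \<in> ray (last chain) (pt 1 0) \<inter> chain_image chain \<longleftrightarrow> p $ 1 = real L \<and> p $ 2 = f (p $ 1)"
      using L ne[of "p $ 1"] unfolding ray_upper chain_image_eq by auto
    also have "\<dots> \<longleftrightarrow> p \<in> {last chain}"
      unfolding last_chain singleton_iff pt_eq_iff using at by auto
    finally show "p \<in> ray (last chain) (pt 1 0) \<inter> chain_image chain \<longleftrightarrow> p \<in> {last chain}" .
  qed
  show "ray (hd chain) (pt 1 0) \<inter> ray (last chain) (pt 1 0) \<subseteq> {hd chain} \<inter> {last chain}"
    unfolding ray_lower ray_upper using ne by force
qed

section \<open>The region outside the strip is an unbounded obstacle\<close>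

lemma open_outer: "open outer" and open_inner: "open inner"
proof -
  have c: "continuous_on UNIV (\<lambda>p :: point. f (p $ 1))" "continuous_on UNIV (\<lambda>p :: point. - g (p $ 1))"
    by (intro continuous_intros continuous_on_compose2[OF continuous_on_interp[of UNIV]]; simp)+
  have o: "open {p :: point. p $ 1 < 0}" "open {p :: point. 0 < p $ 1}"
    "open {p :: point. f (p $ 1) < p $ 2}" "open {p :: point. p $ 2 < f (p $ 1)}"
    "open {p :: point. p $ 2 < - g (p $ 1)}" "open {p :: point. - g (p $ 1) < p $ 2}"
    by (intro open_Collect_less c continuous_intros)+
  have "outer = {p. p $ 1 < 0} \<union> {p. f (p $ 1) < p $ 2} \<union> {p. p $ 2 < - g (p $ 1)}"
    "inner = {p. 0 < p $ 1} \<inter> {p. p $ 2 < f (p $ 1)} \<inter> {p. - g (p $ 1) < p $ 2}"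
    by (auto simp: outer_def inner_def)
  then show "open outer" "open inner" using o by (auto intro: open_Un open_Int)
qed

text \<open>A union of three connected sets: the left half plane, the region above one graph and the
  region below the other. Each of the last two overlaps the half plane, since both curves have
  height 0 there.\<close>

lemma connected_outer: "connected outer"
proof -
  \<comment> \<open>One side of the graph of \<open>h\<close> is the image of an open half plane
    under the shear \<open>(x, y)\<close> to \<open>(x, h x + c * y)\<close>; the sign
    \<open>c\<close> selects the side.\<close>
  have *: "connected {p :: point. c * h (p $ 1) < c * p $ 2}"
    if h: "continuous_on UNIV h" and c: "c = 1 \<or> c = -1" for c and h :: "real \<Rightarrow> real"
  proof -
    let ?\<phi> = "\<lambda>q. pt (fst q) (h (fst q) + c * snd q)"
    have pt: "pt x y = x *\<^sub>R axis 1 1 + y *\<^sub>R axis 2 1" for x y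
      by (simp add: point_eq_iff axis_def)
    have "continuous_on (UNIV \<times> {0<..}) ?\<phi>"
      unfolding pt by (intro continuous_intros continuous_on_compose2[OF h]) auto
    moreover have "connected ((UNIV :: real set) \<times> {0 :: real<..})"
      by (intro connected_Times) auto
    ultimately have "connected (?\<phi> ` (UNIV \<times> {0<..}))"
      by (rule connected_continuous_image)
    moreover have "?\<phi> ` (UNIV \<times> {0<..}) = {p. c * h (p $ 1) < c * p $ 2}"
    proof (intro equalityI subsetI)
      fix p assume "p \<in> {p :: point. c * h (p $ 1) < c * p $ 2}"
      then show "p \<in> ?\<phi> ` (UNIV \<times> {0<..})"
        using c by (intro image_eqI[of _ _ "(p $ 1, c * (p $ 2 - h (p $ 1)))"]) (auto simp: point_eq_iff)
    qed (use c in auto)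
    ultimately show ?thesis by simp
  qed
  have left: "connected {p :: point. p $ 1 < 0}"
    using convex_halfspace_lt[of "axis 1 1 :: point" 0] by (simp add: inner_axis' convex_connected)
  have up: "connected {p :: point. f (p $ 1) < p $ 2}"
    using *[of f 1] continuous_on_interp by auto
  have down: "connected {p :: point. p $ 2 < - g (p $ 1)}"
  proof -
    have "{p :: point. p $ 2 < - g (p $ 1)} = {p. -1 * - g (p $ 1) < -1 * p $ 2}" by auto
    then show ?thesis
      using *[of "\<lambda>x. - g x" "-1"] continuous_on_minus[OF continuous_on_interp[of UNIV L G]]
      by simp
  qed
  have "connected ({p. p $ 1 < 0} \<union> {p :: point. f (p $ 1) < p $ 2})"
    using left up by (rule connected_Un) (auto simp: set_eq_iff f_nonpos intro!: exI[of _ "pt (-1) 1"])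
  then have "connected (({p. p $ 1 < 0} \<union> {p :: point. f (p $ 1) < p $ 2}) \<union> {p. p $ 2 < - g (p $ 1)})"
    using down by (rule connected_Un) (auto simp: set_eq_iff g_nonpos intro!: exI[of _ "pt (-1) (-1)"])
  then show ?thesis
    by (simp add: outer_def Collect_disj_eq Un_assoc)
qed

lemma obstacle_outer: "obstacle outer"
proof -
  \<comment> \<open>On the line of abscissa 0 both curves pass through the origin, so every other
    point of that line already belongs to \<open>outer\<close>.\<close>
  have split: "- boundary = outer \<union> inner" "outer \<inter> inner = {}"
    using f_nonneg g_nonneg f_nonpos g_nonpos upper_lower_disjoint
    by (auto simp: outer_def inner_def boundary_def) (smt (verit))+
  have ne: "pt (-1) 0 \<in> outer" by (simp add: outer_def)
  have "outer \<in> components (- boundary)"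
    unfolding in_components_maximal
  proof (intro conjI allI impI)
    show "outer \<noteq> {}" "outer \<subseteq> - boundary" using ne split by auto
    show "connected outer" by (rule connected_outer)
    fix T assume T: "T \<noteq> {} \<and> outer \<subseteq> T \<and> T \<subseteq> - boundary \<and> connected T"
    \<comment> \<open>\<open>outer\<close> and \<open>inner\<close> are disjoint open sets that
      cover \<open>T\<close>, so a connected \<open>T\<close> containing \<open>outer\<close> cannot
      also reach \<open>inner\<close>.\<close>
    have "T \<inter> inner = {}"
      using connectedD[of T outer inner] T open_outer open_inner split ne by blast
    then show "T = outer" using T split by blast
  qed
  then show ?thesis
    unfolding obstacle_def using simple_chain infinite_chain_image_eq by metis
qed

lemma unbounded_outer: "\<not> bounded outer"
proof
  assume "bounded outer"
  then obtain B where B: "\<And>p. p \<in> outer \<Longrightarrow> norm p \<le> B" by (auto simp: bounded_iff)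
  have "- \<bar>B\<bar> - 1 < 0" by linarith
  then have "pt (- \<bar>B\<bar> - 1) 0 \<in> outer" unfolding outer_def mem_Collect_eq pt_nth by blast
  from B[OF this] component_le_norm_cart[of "pt (- \<bar>B\<bar> - 1) 0" 1] show False by simp
qed

end

subsection \<open>Partially known graphs on seven vertices\<close>

datatype vert = v0 | v1 | v2 | v3 | v4 | v5 | v6

definition verts :: "vert list" where
  "verts = [v0, v1, v2, v3, v4, v5, v6]"

lemma set_verts [simp]: "set verts = UNIV"
  using vert.exhaust by (auto simp: verts_def)

text \<open>A function on the seven vertices stored as a constructor term, so that lookup and update
  evaluate by pattern matching. Rows of statuses form the adjacency matrices; rows of vertices
  encode relabellings.\<close>

datatype 'a row = Row 'a 'a 'a 'a 'a 'a 'a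

fun entry :: "'a row \<Rightarrow> vert \<Rightarrow> 'a" where
  "entry (Row a b c d e f g) v0 = a"
| "entry (Row a b c d e f g) v1 = b"
| "entry (Row a b c d e f g) v2 = c"
| "entry (Row a b c d e f g) v3 = d"
| "entry (Row a b c d e f g) v4 = e"
| "entry (Row a b c d e f g) v5 = f"
| "entry (Row a b c d e f g) v6 = g"

fun update :: "vert \<Rightarrow> ('a \<Rightarrow> 'a) \<Rightarrow> 'a row \<Rightarrow> 'a row" where
  "update v0 h (Row a b c d e f g) = Row (h a) b c d e f g"
| "update v1 h (Row a b c d e f g) = Row a (h b) c d e f g"
| "update v2 h (Row a b c d e f g) = Row a b (h c) d e f g"
| "update v3 h (Row a b c d e f g) = Row a b c (h d) e f g"
| "update v4 h (Row a b c d e f g) = Row a b c d (h e) f g"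
| "update v5 h (Row a b c d e f g) = Row a b c d e (h f) g"
| "update v6 h (Row a b c d e f g) = Row a b c d e f (h g)"

lemma entry_update: "entry (update u h r) v = (if v = u then h (entry r v) else entry r v)"
  by (cases r; cases u; cases v; simp)

lemma entry_map_row: "entry (map_row h r) v = h (entry r v)"
  by (cases r; cases v; simp)

lemma inj_entry:
  assumes "distinct (map (entry r) verts)"
  shows "inj (entry r)"
  using assms by (simp add: distinct_map)

section \<open>Three-valued adjacency, refinement and relabelling\<close>

datatype status = Unknown | Present | Absent

fun present :: "status \<Rightarrow> bool" where
  "present Unknown = False" | "present Present = True" | "present Absent = False"

fun absent :: "status \<Rightarrow> bool" where
  "absent Unknown = False" | "absent Present = False" | "absent Absent = True"

lemma present_iff: "present s \<longleftrightarrow> s = Present" and absent_iff: "absent s \<longleftrightarrow> s = Absent"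
  by (cases s; simp)+

text \<open>The information order: \<open>Unknown\<close> lies below the two definite values, which
  are incomparable.\<close>

fun weaker :: "status \<Rightarrow> status \<Rightarrow> bool" where
  "weaker Unknown s = True" | "weaker Present s = present s" | "weaker Absent s = absent s"

type_synonym partial_graph = "status row row"

definition status :: "partial_graph \<Rightarrow> vert \<Rightarrow> vert \<Rightarrow> status" where
  "status A u v = entry (entry A u) v"

definition assign :: "vert \<Rightarrow> vert \<Rightarrow> status \<Rightarrow> partial_graph \<Rightarrow> partial_graph" where
  "assign u v s A = update u (update v (\<lambda>_. s)) (update v (update u (\<lambda>_. s)) A)"

text \<open>This is the pullback along \<open>p\<close>: the new vertex \<open>u\<close> plays the
  part of the old vertex \<open>entry p u\<close>.\<close>

definition relabel :: "vert row \<Rightarrow> partial_graph \<Rightarrow> partial_graph" where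
  "relabel p A = map_row (\<lambda>u. map_row (entry (entry A u)) p) p"

lemma status_assign:
  "status (assign u v s A) u' v' = (if u' = u \<and> v' = v \<or> u' = v \<and> v' = u then s else status A u' v')"
  by (simp add: status_def assign_def entry_update)

lemma status_relabel: "status (relabel p A) u v = status A (entry p u) (entry p v)"
  by (simp add: status_def relabel_def entry_map_row)

definition sharpens :: "partial_graph \<Rightarrow> partial_graph \<Rightarrow> bool" where
  "sharpens A B \<longleftrightarrow> list_all (\<lambda>u. list_all (\<lambda>v. weaker (status B u v) (status A u v)) verts) verts"

text \<open>In all that follows a graph is given by its relation \<open>N\<close> of \<^emph>\<open>non\<close>-adjacency.\<close>

definition consistent :: "(vert \<Rightarrow> vert \<Rightarrow> bool) \<Rightarrow> partial_graph \<Rightarrow> bool" where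
  "consistent N A \<longleftrightarrow>
    (\<forall>u v. (status A u v = Present \<longrightarrow> \<not> N u v) \<and> (status A u v = Absent \<longrightarrow> N u v))"

lemma consistent_sharpens:
  assumes "consistent N A" "sharpens A B"
  shows "consistent N B"
  unfolding consistent_def
proof (intro allI)
  fix u v
  have "weaker (status B u v) (status A u v)"
    using assms(2) by (simp add: sharpens_def list_all_iff)
  then show "(status B u v = Present \<longrightarrow> \<not> N u v) \<and> (status B u v = Absent \<longrightarrow> N u v)"
    using assms(1) by (cases "status B u v") (auto simp: consistent_def present_iff absent_iff)
qed

lemma consistent_relabel:
  "consistent N A \<Longrightarrow> consistent (\<lambda>u v. N (entry p u) (entry p v)) (relabel p A)"
  by (simp add: consistent_def status_relabel)

text \<open>An entry \<open>(i, s, m)\<close> for the pair \<open>(u, v)\<close> says: on the vertical line \<open>x = i\<close> the segment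
  \<open>uv\<close> can be reached from above (\<open>s = 1\<close>) or from below (\<open>s = -1\<close>) by crossing only
  segments of \<open>m\<close>.\<close>

definition blockers :: "((vert \<times> vert) \<times> (int \<times> int \<times> (vert \<times> vert) list) list) list" where
  "blockers = [
   ((v0, v1), [(21, 1, [])]),
   ((v0, v2), [(141, - 1, [])]),
   ((v0, v3), [(141, - 1, [(v0, v2)]),
     (21, 1, [(v0, v1), (v0, v4), (v0, v5), (v0, v6)]),
     (41, 1, [(v0, v4), (v0, v5), (v0, v6), (v1, v2), (v1, v3), (v1, v4), (v1, v5), (v1, v6)]),
     (199, - 1, [(v2, v3)])]),
   ((v0, v4), [(97, - 1, [(v0, v2), (v0, v3)]),
     (21, 1, [(v0, v1), (v0, v5), (v0, v6)]),
     (41, 1, [(v0, v5), (v0, v6), (v1, v2), (v1, v3), (v1, v4), (v1, v5), (v1, v6)]),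
     (199, - 1, [(v0, v3), (v1, v3), (v2, v3), (v2, v4), (v2, v5)]),
     (219, - 1, [(v2, v4), (v3, v4), (v3, v5)])]),
   ((v0, v5), [(97, - 1, [(v0, v2), (v0, v3), (v0, v4)]),
     (21, 1, [(v0, v1), (v0, v6)]),
     (41, 1, [(v0, v6), (v1, v2), (v1, v3), (v1, v4), (v1, v5), (v1, v6)]),
     (181, - 1, [(v0, v3), (v0, v4), (v1, v3), (v1, v4), (v2, v3), (v2, v4), (v2, v5), (v2, v6)]),
     (201, - 1, [(v0, v4), (v1, v4), (v2, v4), (v2, v5), (v2, v6), (v3, v4), (v3, v5), (v3, v6)]),
     (245, - 1, [(v2, v5), (v3, v5), (v4, v5)])]),
   ((v0, v6), [(21, 1, [(v0, v1)]),
     (331, 1, [(v1, v6)])]),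
   ((v1, v2), [(177, - 1, [(v0, v2)]),
     (41, 1, [(v1, v3), (v1, v4), (v1, v5), (v1, v6)])]),
   ((v1, v3), [(141, - 1, [(v0, v2), (v0, v3), (v1, v2)]),
     (41, 1, [(v1, v4), (v1, v5), (v1, v6)]),
     (199, - 1, [(v0, v3), (v2, v3)])]),
   ((v1, v4), [(141, - 1, [(v0, v2), (v0, v3), (v0, v4), (v1, v2), (v1, v3)]),
     (41, 1, [(v1, v5), (v1, v6)]),
     (181, - 1, [(v0, v3), (v0, v4), (v1, v3), (v2, v3), (v2, v4), (v2, v5), (v2, v6)]),
     (219, - 1, [(v0, v4), (v2, v4), (v3, v4), (v3, v5)])]),
   ((v1, v5), [(141, - 1, [(v0, v2), (v0, v3), (v0, v4), (v0, v5), (v1, v2), (v1, v3), (v1, v4)]),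
     (41, 1, [(v1, v6)]),
     (181, - 1, [(v0, v3), (v0, v4), (v0, v5), (v1, v3), (v1, v4), (v2, v3), (v2, v4), (v2, v5), (v2, v6)]),
     (201, - 1, [(v0, v4), (v0, v5), (v1, v4), (v2, v4), (v2, v5), (v2, v6), (v3, v4), (v3, v5), (v3, v6)]),
     (245, - 1, [(v0, v5), (v2, v5), (v3, v5), (v4, v5)])]),
   ((v1, v6), [(41, 1, [])]),
   ((v2, v3), [(181, - 1, [])]),
   ((v2, v4), [(181, - 1, [(v2, v3)]),
     (219, - 1, [(v3, v4), (v3, v5)])]),
   ((v2, v5), [(181, - 1, [(v2, v3), (v2, v4)]),
     (201, - 1, [(v2, v4), (v3, v4), (v3, v5), (v3, v6)]),
     (245, - 1, [(v3, v5), (v4, v5)])]),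
   ((v2, v6), [(331, 1, [(v0, v6), (v1, v6)]),
     (181, - 1, [(v2, v3), (v2, v4), (v2, v5)]),
     (201, - 1, [(v0, v4), (v2, v4), (v2, v5), (v3, v4), (v3, v5), (v3, v6)]),
     (221, - 1, [(v2, v5), (v3, v5), (v3, v6), (v4, v5), (v4, v6)]),
     (261, - 1, [(v3, v6), (v4, v6), (v5, v6)])]),
   ((v3, v4), [(201, - 1, [(v3, v5)])]),
   ((v3, v5), [(201, - 1, [])]),
   ((v3, v6), [(331, 1, [(v0, v6), (v1, v6), (v2, v6)]),
     (201, - 1, [(v3, v4), (v3, v5)]),
     (221, - 1, [(v3, v5), (v4, v5), (v4, v6)]),
     (261, - 1, [(v4, v6), (v5, v6)])]),
   ((v4, v5), [(221, - 1, [(v3, v5)])]),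
   ((v4, v6), [(331, 1, [(v0, v6), (v1, v6), (v2, v6), (v3, v6)]),
     (221, - 1, [(v3, v5), (v4, v5)]),
     (261, - 1, [(v5, v6)])]),
   ((v5, v6), [(261, - 1, [])])]"

text \<open>The combinatorial remnant of the geometry. For a fixed pair, the existence of a usable
  entry is monotone in \<open>N\<close>; the premise \<open>N u v\<close> asks for such an entry
  only where a segment really has to be blocked.\<close>

definition admissible :: "(vert \<Rightarrow> vert \<Rightarrow> bool) \<Rightarrow> bool" where
  "admissible N \<longleftrightarrow> (\<forall>((u, v), ws) \<in> set blockers. N u v \<longrightarrow>
     (\<exists>(i, s, m) \<in> set ws. \<forall>(u', v') \<in> set m. N u' v'))"

text \<open>Evaluation with partial information: an unknown pair counts neither as an edge nor as a
  non-edge, so a positive answer is valid for every completion. Branches can therefore end before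
  all pairs are decided.\<close>

definition surely_admissible :: "partial_graph \<Rightarrow> bool" where
  "surely_admissible A \<longleftrightarrow> list_all (\<lambda>((u, v), ws). present (status A u v) \<or>
      list_ex (\<lambda>(i, s, m). list_all (\<lambda>(u', v'). absent (status A u' v')) m) ws) blockers"

lemma admissible_if_surely_admissible:
  assumes "surely_admissible A" "consistent N A"
  shows "admissible N"
  unfolding admissible_def
proof (clarify, rule ccontr)
  fix u v ws
  assume *: "((u, v), ws) \<in> set blockers" "N u v"
    "\<not> (\<exists>(i, s, m) \<in> set ws. \<forall>(u', v') \<in> set m. N u' v')"
  then have "present (status A u v) \<or>
      list_ex (\<lambda>(i, s, m). list_all (\<lambda>(u', v'). absent (status A u' v')) m) ws"
    using assms(1) unfolding surely_admissible_def list_all_iff by fast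
  moreover have "\<not> present (status A u v)"
    using * assms(2) by (auto simp: consistent_def present_iff)
  ultimately obtain i s m where "(i, s, m) \<in> set ws"
      "list_all (\<lambda>(u', v'). absent (status A u' v')) m"
    unfolding list_ex_iff by blast
  then have "\<forall>(u', v') \<in> set m. N u' v'"
    using assms(2) by (auto simp: list_all_iff absent_iff consistent_def)
  with * \<open>(i, s, m) \<in> set ws\<close> show False by blast
qed

text \<open>The relabelling may depend on the completion \<open>N\<close>; this is what lets
  different branches of the case analysis use different placements. On a finite type an injective
  \<open>p\<close> is a permutation.\<close>

definition settled :: "partial_graph \<Rightarrow> bool" where
  "settled A \<longleftrightarrow> (\<forall>N. symp N \<longrightarrow> consistent N A \<longrightarrow>
     (\<exists>p. inj p \<and> admissible (\<lambda>u v. N (p u) (p v))))"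

text \<open>A case analysis on the adjacency of single pairs; a branch ends as soon as some relabelling
  makes the graph admissible, or turns it into one of the partial graphs already settled.\<close>

datatype tree = Split vert vert tree tree | Leaf "vert row" | Ref "vert row"

fun check :: "partial_graph list \<Rightarrow> partial_graph \<Rightarrow> tree \<Rightarrow> bool" where
  "check K A (Split u v s t) \<longleftrightarrow> check K (assign u v Present A) s \<and> check K (assign u v Absent A) t"
| "check K A (Leaf p) \<longleftrightarrow> distinct (map (entry p) verts) \<and> surely_admissible (relabel p A)"
| "check K A (Ref p) \<longleftrightarrow> distinct (map (entry p) verts) \<and> list_ex (sharpens (relabel p A)) K"

text \<open>Soundness of the certificates: however a tree was found, its acceptance alone settles
  the partial graph.\<close>

lemma settled_if_check:
  assumes "\<And>B. B \<in> set K \<Longrightarrow> settled B"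
  shows "check K A t \<Longrightarrow> settled A"
proof (induction t arbitrary: A)
  case (Split u v s t)
  have *: "settled (assign u v Present A)" "settled (assign u v Absent A)"
    using Split by simp_all
  show ?case
    unfolding settled_def
  proof (intro allI impI)
    fix N assume N: "symp N" "consistent N A"
    \<comment> \<open>The graph itself chooses the branch. \<open>assign\<close> writes both
      orientations of the pair, which agrees with \<open>N\<close> because \<open>N\<close> is
      symmetric.\<close>
    then have "consistent N (assign u v (if N u v then Absent else Present) A)"
      by (auto simp: consistent_def status_assign dest: sympD)
    then show "\<exists>p. inj p \<and> admissible (\<lambda>u v. N (p u) (p v))"
      using * N(1) unfolding settled_def by (cases "N u v") auto
  qed
next
  case (Leaf p)
  then have "inj (entry p)" "surely_admissible (relabel p A)"
    using inj_entry by auto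
  then show ?case
    unfolding settled_def using admissible_if_surely_admissible consistent_relabel by blast
next
  case (Ref p)
  then obtain B where "B \<in> set K" "sharpens (relabel p A) B"
    by (auto simp: list_ex_iff)
  moreover have "inj (entry p)" using Ref.prems by (intro inj_entry) simp
  ultimately have B: "settled B" "sharpens (relabel p A) B" "inj (entry p)"
    using assms by auto
  show ?case
    unfolding settled_def
  proof (intro allI impI)
    fix N assume N: "symp N" "consistent N A"
    let ?N = "\<lambda>u v. N (entry p u) (entry p v)"
    have "symp ?N" using N(1) by (simp add: symp_def)
    moreover have "consistent ?N B"
      using N(2) B(2) consistent_sharpens consistent_relabel by blast
    ultimately obtain q where "inj q" "admissible (\<lambda>u v. ?N (q u) (q v))"
      using B(1) unfolding settled_def by blast
    \<comment> \<open>The settled graph supplies a relabelling \<open>q\<close> of the already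
      relabelled graph, so the two are composed.\<close>
    then show "\<exists>p. inj p \<and> admissible (\<lambda>u v. N (p u) (p v))"
      using B(3) by (intro exI[of _ "entry p \<circ> q"]) (simp add: inj_compose)
  qed
qed

text \<open>Ordered by the larger vertex, so that the first 3, 6 and 10 pairs are exactly those
  inside the first three, four and five vertices. A graph on these vertices is thus a status list of
  that length.\<close>

definition pairs :: "(vert \<times> vert) list" where
  "pairs = [(v0, v1), (v0, v2), (v1, v2), (v0, v3), (v1, v3), (v2, v3), (v0, v4), (v1, v4), (v2, v4), (v3, v4), (v0, v5), (v1, v5), (v2, v5), (v3, v5), (v4, v5), (v0, v6), (v1, v6), (v2, v6), (v3, v6), (v4, v6), (v5, v6)]"

text \<open>Pairs beyond the end of the status list stay \<open>Unknown\<close>; in particular the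
  empty list describes the graph about which nothing is known.\<close>

fun partial_graph :: "(vert \<times> vert) list \<Rightarrow> status list \<Rightarrow> partial_graph" where
  "partial_graph ((u, v) # ps) (s # ss) = assign u v s (partial_graph ps ss)"
| "partial_graph _ _ = (let r = Row Unknown Unknown Unknown Unknown Unknown Unknown Unknown
     in Row r r r r r r r)"

lemma entry_constant: "entry (Row a a a a a a a) v = a"
  by (cases v) simp_all

lemma consistent_empty: "consistent N (partial_graph ps [])"
proof -
  have "status (partial_graph ps []) u v = Unknown" for u v
    by (simp add: status_def Let_def entry_constant)
  then show ?thesis by (simp add: consistent_def)
qed

definition settled_all :: "status list list \<Rightarrow> bool" where
  "settled_all sss \<longleftrightarrow> (\<forall>ss \<in> set sss. settled (partial_graph pairs ss))"

text \<open>One level of the case analysis: each partial graph in \<open>sss\<close> has its own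
  tree, and all trees may refer to the graphs in \<open>K\<close>.\<close>

lemma settled_all_if_check:
  assumes "settled_all K" "list_all2 (check (map (partial_graph pairs) K)) (map (partial_graph pairs) sss) ts"
  shows "settled_all sss"
  unfolding settled_all_def
proof
  fix ss assume "ss \<in> set sss"
  then obtain t where "check (map (partial_graph pairs) K) (partial_graph pairs ss) t"
    using assms(2) by (auto simp: list_all2_conv_all_nth in_set_conv_nth)
  then show "settled (partial_graph pairs ss)"
    by (rule settled_if_check[rotated]) (use assms(1) in \<open>auto simp: settled_all_def\<close>)
qed

lemma settled_all_Nil: "settled_all []"
  by (simp add: settled_all_def)

subsection \<open>The case analysis\<close>

text \<open>Representatives of the graphs on three, four and five vertices up to isomorphism.\<close>

definition graphs3 :: "status list list" where
  "graphs3 = [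
    [Present, Present, Present], [Absent, Present, Present], [Absent, Absent, Present],
    [Absent, Absent, Absent]]"

definition graphs4 :: "status list list" where
  "graphs4 = [
    [Present, Present, Present, Present, Present, Present],
    [Absent, Present, Present, Present, Present, Present],
    [Absent, Absent, Present, Present, Present, Present],
    [Absent, Absent, Present, Absent, Present, Present],
    [Absent, Absent, Absent, Present, Present, Present],
    [Present, Present, Absent, Absent, Present, Present],
    [Absent, Present, Absent, Absent, Present, Present],
    [Absent, Absent, Absent, Absent, Present, Present],
    [Present, Absent, Absent, Absent, Absent, Present],
    [Absent, Absent, Absent, Absent, Absent, Present],
    [Absent, Absent, Absent, Absent, Absent, Absent]]"

definition graphs5 :: "status list list" where
  "graphs5 = [
    [Present, Present, Present, Present, Present, Present, Present, Present, Present, Present],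
    [Absent, Present, Present, Present, Present, Present, Present, Present, Present, Present],
    [Absent, Absent, Present, Present, Present, Present, Present, Present, Present, Present],
    [Absent, Absent, Present, Absent, Present, Present, Present, Present, Present, Present],
    [Absent, Absent, Present, Absent, Present, Present, Absent, Present, Present, Present],
    [Absent, Absent, Absent, Present, Present, Present, Present, Present, Present, Present],
    [Present, Present, Absent, Absent, Present, Present, Present, Present, Present, Present],
    [Absent, Present, Absent, Absent, Present, Present, Present, Present, Present, Present],
    [Absent, Absent, Absent, Absent, Present, Present, Present, Present, Present, Present],
    [Present, Present, Absent, Absent, Present, Present, Absent, Present, Present, Present],
    [Absent, Present, Absent, Absent, Present, Present, Absent, Present, Present, Present],
    [Absent, Absent, Absent, Absent, Present, Present, Absent, Present, Present, Present],
    [Present, Absent, Absent, Absent, Absent, Present, Present, Present, Present, Present],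
    [Absent, Absent, Absent, Absent, Absent, Present, Present, Present, Present, Present],
    [Present, Absent, Absent, Present, Absent, Present, Absent, Present, Present, Present],
    [Absent, Absent, Absent, Present, Absent, Present, Absent, Present, Present, Present],
    [Present, Absent, Absent, Absent, Absent, Present, Absent, Present, Present, Present],
    [Absent, Absent, Absent, Absent, Absent, Present, Absent, Present, Present, Present],
    [Present, Absent, Absent, Absent, Absent, Present, Absent, Absent, Present, Present],
    [Absent, Absent, Absent, Absent, Absent, Present, Absent, Absent, Present, Present],
    [Absent, Absent, Absent, Absent, Absent, Absent, Present, Present, Present, Present],
    [Present, Present, Absent, Present, Absent, Absent, Absent, Present, Present, Present],
    [Absent, Present, Absent, Present, Absent, Absent, Absent, Present, Present, Present],
    [Absent, Absent, Absent, Present, Absent, Absent, Absent, Present, Present, Present],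
    [Absent, Absent, Absent, Absent, Absent, Absent, Absent, Present, Present, Present],
    [Absent, Absent, Present, Absent, Present, Absent, Absent, Absent, Present, Present],
    [Present, Present, Absent, Absent, Present, Absent, Absent, Absent, Present, Present],
    [Absent, Present, Absent, Absent, Present, Absent, Absent, Absent, Present, Present],
    [Absent, Absent, Absent, Absent, Present, Absent, Absent, Absent, Present, Present],
    [Present, Absent, Absent, Absent, Absent, Absent, Absent, Absent, Present, Present],
    [Absent, Absent, Absent, Absent, Absent, Absent, Absent, Absent, Present, Present],
    [Absent, Absent, Present, Absent, Absent, Absent, Absent, Absent, Absent, Present],
    [Absent, Absent, Absent, Absent, Absent, Absent, Absent, Absent, Absent, Present],
    [Absent, Absent, Absent, Absent, Absent, Absent, Absent, Absent, Absent, Absent]]"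

text \<open>The only level at which placements are exhibited. With nothing settled beforehand, each
  tree splits on pairs that meet \<open>v5\<close> or \<open>v6\<close> and ends in explicit
  relabellings. The evaluation re-checks every leaf by rewriting.\<close>

lemma settled_graphs5: "settled_all graphs5"
  by (rule settled_all_if_check[OF settled_all_Nil, of _ "[
    Split v0 v6 (Split v1 v6 (Split v3 v5 (Split v4 v5 (Split v0 v5 (Split v3 v6 (Split v5 v6
    (Leaf (Row v0 v1 v4 v6 v3 v2 v5)) (Leaf (Row v0 v3 v1 v5 v2 v6 v4))) (Split v5 v6
    (Leaf (Row v1 v5 v0 v3 v4 v6 v2)) (Leaf (Row v4 v0 v3 v6 v2 v5 v1)))) (Split v3 v6 (Split v5 v6
    (Leaf (Row v0 v1 v5 v2 v3 v6 v4)) (Leaf (Row v1 v3 v0 v5 v2 v6 v4))) (Split v1 v5 (Split v2 v6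
    (Leaf (Row v0 v6 v5 v2 v1 v4 v3)) (Leaf (Row v0 v1 v5 v2 v3 v6 v4))) (Split v2 v6
    (Leaf (Row v0 v1 v2 v3 v4 v6 v5)) (Leaf (Row v0 v1 v5 v2 v3 v6 v4)))))) (Split v0 v5
    (Split v2 v6 (Split v1 v5 (Leaf (Row v2 v4 v0 v3 v1 v6 v5)) (Leaf (Row v0 v3 v2 v1 v4 v5 v6)))
    (Leaf (Row v5 v6 v4 v1 v0 v3 v2))) (Split v2 v6 (Split v1 v5 (Leaf (Row v0 v4 v2 v3 v1 v6 v5))
    (Leaf (Row v0 v2 v5 v4 v1 v6 v3))) (Leaf (Row v3 v2 v1 v0 v4 v5 v6))))) (Split v4 v6
    (Split v0 v5 (Split v1 v5 (Split v2 v5 (Leaf (Row v4 v3 v0 v2 v1 v6 v5))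
    (Leaf (Row v4 v0 v2 v5 v6 v3 v1))) (Split v2 v5 (Leaf (Row v0 v2 v4 v1 v3 v5 v6))
    (Leaf (Row v1 v4 v2 v5 v6 v3 v0)))) (Split v1 v5 (Split v2 v5 (Leaf (Row v0 v3 v4 v2 v1 v6 v5))
    (Leaf (Row v0 v4 v2 v5 v6 v3 v1))) (Split v2 v5 (Leaf (Row v0 v4 v5 v3 v1 v6 v2))
    (Leaf (Row v0 v1 v2 v6 v4 v3 v5))))) (Split v0 v5 (Split v2 v5 (Leaf (Row v5 v6 v3 v1 v0 v2 v4))
    (Split v2 v6 (Leaf (Row v0 v4 v1 v2 v3 v5 v6)) (Leaf (Row v0 v4 v1 v3 v2 v5 v6)))) (Split v2 v5
    (Leaf (Row v2 v4 v1 v0 v3 v5 v6)) (Split v2 v6 (Leaf (Row v5 v0 v4 v6 v1 v3 v2))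
    (Leaf (Row v0 v1 v3 v5 v6 v2 v4))))))) (Split v3 v5 (Split v4 v5 (Split v3 v6 (Split v0 v5
    (Split v2 v6 (Leaf (Row v4 v1 v0 v2 v3 v5 v6)) (Leaf (Row v4 v0 v1 v6 v5 v2 v3))) (Split v4 v6
    (Split v2 v5 (Leaf (Row v5 v0 v1 v6 v3 v2 v4)) (Leaf (Row v3 v1 v4 v0 v2 v5 v6)))
    (Leaf (Row v1 v5 v4 v6 v3 v2 v0)))) (Split v0 v5 (Split v2 v6 (Leaf (Row v0 v2 v4 v3 v1 v6 v5))
    (Leaf (Row v3 v4 v1 v6 v5 v2 v0))) (Split v2 v6 (Leaf (Row v3 v1 v4 v0 v2 v5 v6))
    (Leaf (Row v2 v5 v3 v6 v4 v1 v0))))) (Split v2 v5 (Split v2 v6 (Leaf (Row v5 v6 v4 v0 v2 v3 v1))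
    (Leaf (Row v0 v4 v3 v2 v1 v6 v5))) (Split v2 v6 (Leaf (Row v3 v1 v0 v2 v4 v5 v6))
    (Leaf (Row v0 v4 v3 v1 v2 v6 v5))))) (Split v2 v6 (Split v0 v5 (Split v1 v5 (Split v2 v5
    (Split v4 v6 (Leaf (Row v4 v3 v0 v1 v2 v6 v5)) (Leaf (Row v0 v3 v2 v1 v4 v6 v5)))
    (Leaf (Row v3 v6 v2 v5 v0 v4 v1))) (Split v2 v5 (Split v4 v6 (Leaf (Row v0 v2 v6 v1 v3 v5 v4))
    (Leaf (Row v0 v4 v2 v3 v1 v5 v6))) (Leaf (Row v3 v2 v1 v6 v0 v4 v5)))) (Split v4 v5
    (Leaf (Row v4 v1 v2 v0 v3 v5 v6)) (Split v1 v5 (Leaf (Row v3 v6 v0 v5 v2 v4 v1))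
    (Leaf (Row v3 v0 v1 v6 v2 v4 v5))))) (Split v1 v5 (Split v4 v5 (Leaf (Row v0 v3 v4 v1 v2 v6 v5))
    (Split v3 v6 (Leaf (Row v1 v2 v0 v3 v4 v5 v6)) (Leaf (Row v0 v4 v1 v2 v3 v6 v5)))) (Split v4 v5
    (Leaf (Row v0 v3 v4 v2 v1 v6 v5)) (Split v3 v6 (Leaf (Row v0 v2 v3 v4 v1 v5 v6))
    (Leaf (Row v0 v2 v4 v1 v3 v5 v6)))))))) (Split v2 v5 (Split v3 v5 (Split v4 v5 (Split v2 v6
    (Split v3 v6 (Split v1 v6 (Leaf (Row v0 v4 v6 v5 v2 v1 v3)) (Leaf (Row v4 v2 v0 v6 v5 v1 v3)))
    (Split v1 v6 (Leaf (Row v0 v3 v5 v1 v2 v4 v6)) (Leaf (Row v3 v4 v0 v6 v5 v1 v2)))) (Split v3 v6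
    (Split v1 v6 (Leaf (Row v0 v2 v5 v1 v3 v4 v6)) (Leaf (Row v2 v4 v0 v6 v5 v1 v3))) (Split v1 v6
    (Leaf (Row v0 v2 v5 v1 v4 v3 v6)) (Leaf (Row v3 v0 v2 v1 v4 v5 v6))))) (Split v2 v6 (Split v1 v6
    (Leaf (Row v6 v5 v0 v3 v2 v1 v4)) (Split v0 v5 (Leaf (Row v6 v5 v1 v0 v3 v2 v4))
    (Leaf (Row v6 v5 v0 v1 v3 v2 v4)))) (Split v1 v6 (Leaf (Row v6 v5 v0 v2 v3 v1 v4)) (Split v0 v5
    (Leaf (Row v6 v0 v4 v5 v3 v1 v2)) (Leaf (Row v0 v4 v5 v6 v1 v2 v3)))))) (Split v1 v5
    (Split v1 v6 (Split v3 v6 (Split v2 v6 (Split v4 v5 (Leaf (Row v0 v5 v6 v4 v1 v2 v3))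
    (Leaf (Row v0 v1 v6 v5 v4 v3 v2))) (Leaf (Row v0 v5 v2 v6 v1 v4 v3))) (Split v2 v6 (Split v4 v5
    (Leaf (Row v3 v0 v5 v1 v2 v4 v6)) (Leaf (Row v1 v0 v2 v4 v3 v5 v6)))
    (Leaf (Row v0 v2 v3 v5 v1 v4 v6)))) (Split v4 v6 (Leaf (Row v6 v5 v0 v1 v2 v4 v3)) (Split v0 v5
    (Leaf (Row v6 v0 v3 v5 v2 v4 v1)) (Leaf (Row v0 v3 v5 v6 v4 v1 v2))))) (Split v1 v6 (Split v4 v6
    (Leaf (Row v0 v2 v6 v5 v3 v1 v4)) (Split v0 v5 (Leaf (Row v0 v4 v2 v1 v3 v5 v6))
    (Leaf (Row v3 v1 v0 v6 v2 v4 v5)))) (Split v4 v6 (Leaf (Row v2 v0 v4 v3 v1 v5 v6)) (Split v0 v5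
    (Leaf (Row v0 v4 v2 v3 v1 v5 v6)) (Leaf (Row v0 v3 v1 v6 v2 v4 v5))))))) (Split v1 v5
    (Split v3 v5 (Split v1 v6 (Split v2 v6 (Split v3 v6 (Split v4 v5
    (Leaf (Row v0 v4 v6 v5 v1 v2 v3)) (Leaf (Row v6 v5 v0 v1 v3 v2 v4)))
    (Leaf (Row v0 v5 v3 v6 v1 v4 v2))) (Split v3 v6 (Split v4 v5 (Leaf (Row v2 v0 v5 v1 v3 v4 v6))
    (Leaf (Row v1 v0 v3 v4 v2 v5 v6))) (Leaf (Row v0 v3 v2 v5 v1 v4 v6)))) (Split v4 v6
    (Leaf (Row v6 v5 v0 v1 v3 v4 v2)) (Split v0 v5 (Leaf (Row v6 v0 v2 v5 v3 v4 v1))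
    (Leaf (Row v0 v2 v5 v6 v4 v1 v3))))) (Split v2 v6 (Split v4 v6 (Leaf (Row v0 v1 v6 v5 v3 v2 v4))
    (Split v0 v5 (Leaf (Row v0 v4 v1 v2 v3 v5 v6)) (Leaf (Row v3 v2 v0 v6 v1 v4 v5)))) (Split v4 v6
    (Leaf (Row v1 v0 v4 v3 v2 v5 v6)) (Split v0 v5 (Leaf (Row v0 v4 v1 v3 v2 v5 v6))
    (Leaf (Row v0 v3 v2 v6 v1 v4 v5)))))) (Split v3 v6 (Split v1 v6 (Split v4 v5
    (Leaf (Row v0 v4 v6 v5 v2 v1 v3)) (Split v0 v5 (Leaf (Row v4 v6 v1 v5 v3 v2 v0))
    (Leaf (Row v2 v1 v0 v6 v3 v4 v5)))) (Split v4 v5 (Leaf (Row v4 v0 v3 v2 v1 v5 v6)) (Split v2 v6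
    (Leaf (Row v6 v5 v1 v0 v3 v2 v4)) (Leaf (Row v1 v0 v2 v5 v3 v4 v6))))) (Split v0 v5 (Split v1 v6
    (Leaf (Row v0 v3 v4 v1 v2 v5 v6)) (Leaf (Row v0 v3 v4 v2 v1 v5 v6))) (Split v1 v6
    (Leaf (Row v5 v6 v0 v2 v1 v4 v3)) (Leaf (Row v6 v5 v0 v1 v3 v4 v2))))))),
    Split v4 v5 (Split v2 v5 (Split v2 v6 (Split v5 v6 (Split v3 v6
    (Leaf (Row v0 v6 v1 v5 v2 v3 v4)) (Split v3 v5 (Leaf (Row v0 v6 v1 v5 v2 v4 v3)) (Split v4 v6
    (Split v0 v5 (Split v1 v5 (Leaf (Row v6 v0 v3 v5 v2 v4 v1)) (Leaf (Row v2 v4 v0 v1 v6 v5 v3)))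
    (Split v1 v5 (Leaf (Row v2 v4 v0 v1 v5 v6 v3)) (Leaf (Row v0 v2 v1 v5 v6 v3 v4))))
    (Leaf (Row v0 v6 v1 v5 v2 v3 v4))))) (Split v0 v5 (Split v3 v6 (Split v0 v6
    (Leaf (Row v1 v0 v5 v6 v3 v4 v2)) (Leaf (Row v6 v1 v0 v5 v4 v3 v2)))
    (Leaf (Row v0 v2 v1 v6 v5 v3 v4))) (Split v3 v6 (Leaf (Row v5 v1 v0 v6 v3 v4 v2))
    (Leaf (Row v0 v6 v1 v2 v4 v3 v5))))) (Split v3 v6 (Split v0 v5 (Split v0 v6 (Split v1 v5
    (Split v1 v6 (Leaf (Row v0 v3 v1 v2 v4 v6 v5)) (Leaf (Row v5 v2 v3 v0 v4 v1 v6)))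
    (Leaf (Row v6 v2 v1 v5 v0 v3 v4))) (Split v5 v6 (Leaf (Row v0 v1 v6 v2 v4 v3 v5))
    (Leaf (Row v2 v4 v0 v6 v1 v5 v3)))) (Split v0 v6 (Split v1 v5 (Split v1 v6
    (Leaf (Row v6 v2 v0 v5 v1 v3 v4)) (Leaf (Row v0 v3 v5 v1 v2 v6 v4)))
    (Leaf (Row v0 v1 v3 v2 v4 v6 v5))) (Split v5 v6 (Leaf (Row v0 v1 v6 v2 v4 v3 v5))
    (Leaf (Row v2 v4 v0 v6 v1 v5 v3))))) (Split v5 v6 (Leaf (Row v0 v6 v1 v5 v4 v3 v2)) (Split v0 v5
    (Leaf (Row v4 v0 v2 v3 v5 v6 v1)) (Leaf (Row v0 v6 v1 v4 v2 v3 v5)))))) (Split v3 v6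
    (Split v5 v6 (Split v4 v6 (Split v2 v6 (Leaf (Row v0 v6 v1 v5 v3 v2 v4)) (Split v3 v5
    (Split v0 v5 (Split v1 v5 (Leaf (Row v6 v5 v0 v1 v3 v4 v2)) (Leaf (Row v4 v3 v0 v1 v6 v5 v2)))
    (Split v1 v5 (Leaf (Row v4 v3 v0 v1 v5 v6 v2)) (Leaf (Row v0 v3 v1 v5 v6 v2 v4))))
    (Leaf (Row v0 v5 v1 v6 v4 v2 v3)))) (Leaf (Row v0 v6 v1 v5 v3 v2 v4))) (Split v0 v6 (Split v1 v6
    (Leaf (Row v0 v5 v1 v4 v3 v6 v2)) (Split v0 v5 (Leaf (Row v5 v2 v3 v0 v4 v1 v6))
    (Leaf (Row v4 v3 v1 v6 v0 v2 v5)))) (Split v4 v6 (Leaf (Row v0 v5 v1 v4 v3 v2 v6)) (Split v1 v5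
    (Leaf (Row v5 v2 v0 v6 v1 v4 v3)) (Leaf (Row v1 v6 v0 v5 v3 v2 v4)))))) (Split v5 v6
    (Split v2 v6 (Leaf (Row v0 v5 v1 v6 v4 v3 v2)) (Split v3 v5 (Leaf (Row v0 v6 v1 v5 v4 v2 v3))
    (Split v0 v6 (Split v1 v6 (Leaf (Row v0 v1 v4 v6 v3 v2 v5)) (Leaf (Row v6 v5 v2 v1 v4 v0 v3)))
    (Split v1 v6 (Leaf (Row v6 v5 v2 v0 v4 v1 v3)) (Leaf (Row v1 v0 v4 v3 v2 v5 v6))))))
    (Split v0 v6 (Split v1 v6 (Leaf (Row v4 v0 v3 v6 v2 v5 v1)) (Split v0 v5
    (Leaf (Row v3 v4 v5 v6 v2 v1 v0)) (Leaf (Row v5 v2 v3 v6 v4 v1 v0)))) (Split v4 v6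
    (Leaf (Row v6 v1 v0 v5 v3 v2 v4)) (Leaf (Row v1 v5 v0 v4 v3 v6 v2))))))) (Split v2 v6
    (Split v5 v6 (Split v3 v5 (Split v3 v6 (Split v2 v5 (Split v4 v6
    (Leaf (Row v0 v6 v1 v5 v2 v4 v3)) (Split v0 v5 (Split v1 v5 (Leaf (Row v1 v0 v2 v5 v3 v4 v6))
    (Leaf (Row v2 v3 v0 v1 v6 v5 v4))) (Split v1 v5 (Leaf (Row v2 v3 v0 v1 v5 v6 v4))
    (Leaf (Row v0 v2 v1 v5 v6 v4 v3))))) (Leaf (Row v0 v5 v1 v6 v3 v4 v2)))
    (Leaf (Row v0 v6 v1 v5 v2 v4 v3))) (Split v3 v6 (Leaf (Row v0 v5 v1 v6 v2 v4 v3)) (Split v4 v6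
    (Leaf (Row v0 v5 v1 v6 v2 v3 v4)) (Split v0 v5 (Split v1 v5 (Leaf (Row v1 v0 v2 v5 v3 v4 v6))
    (Leaf (Row v5 v6 v3 v1 v2 v0 v4))) (Split v1 v5 (Leaf (Row v5 v6 v3 v0 v2 v1 v4))
    (Leaf (Row v0 v2 v1 v5 v6 v4 v3))))))) (Split v3 v6 (Split v2 v5 (Split v0 v5
    (Leaf (Row v0 v2 v1 v6 v4 v5 v3)) (Leaf (Row v0 v2 v1 v5 v6 v4 v3))) (Split v0 v5
    (Leaf (Row v0 v3 v1 v6 v2 v4 v5)) (Leaf (Row v0 v6 v1 v3 v2 v4 v5)))) (Split v0 v5 (Split v1 v5
    (Leaf (Row v2 v0 v4 v5 v3 v6 v1)) (Split v0 v6 (Leaf (Row v4 v2 v6 v5 v3 v1 v0))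
    (Leaf (Row v6 v3 v4 v5 v2 v1 v0)))) (Split v2 v5 (Leaf (Row v5 v1 v0 v6 v4 v3 v2))
    (Leaf (Row v1 v6 v0 v2 v4 v5 v3)))))) (Split v4 v6 (Split v3 v5 (Split v0 v5 (Split v5 v6
    (Leaf (Row v0 v5 v1 v6 v3 v2 v4)) (Split v0 v6 (Leaf (Row v2 v3 v5 v6 v4 v1 v0)) (Split v1 v5
    (Leaf (Row v6 v0 v2 v5 v3 v4 v1)) (Leaf (Row v0 v5 v1 v6 v3 v2 v4))))) (Split v1 v6 (Split v2 v5
    (Leaf (Row v6 v2 v0 v5 v1 v4 v3)) (Leaf (Row v5 v6 v2 v0 v4 v1 v3)))
    (Leaf (Row v1 v5 v0 v6 v3 v2 v4)))) (Split v5 v6 (Leaf (Row v0 v6 v1 v5 v4 v3 v2)) (Split v0 v5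
    (Leaf (Row v6 v0 v2 v5 v3 v4 v1)) (Leaf (Row v1 v6 v0 v4 v3 v5 v2))))) (Split v3 v5 (Split v3 v6
    (Split v0 v5 (Split v1 v5 (Leaf (Row v0 v3 v1 v6 v2 v4 v5)) (Leaf (Row v5 v6 v4 v1 v3 v0 v2)))
    (Split v1 v5 (Leaf (Row v5 v6 v4 v0 v3 v1 v2)) (Leaf (Row v0 v1 v3 v2 v4 v6 v5))))
    (Leaf (Row v0 v6 v1 v5 v2 v4 v3))) (Split v5 v6 (Leaf (Row v0 v5 v1 v6 v2 v4 v3)) (Split v0 v5
    (Leaf (Row v0 v6 v1 v3 v4 v5 v2)) (Leaf (Row v0 v1 v3 v5 v2 v4 v6))))))),
    Split v4 v5 (Split v2 v5 (Split v3 v6 (Split v5 v6 (Split v1 v6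
    (Leaf (Row v3 v4 v5 v0 v1 v2 v6)) (Leaf (Row v5 v3 v0 v1 v2 v6 v4))) (Split v0 v5 (Split v1 v6
    (Split v3 v5 (Leaf (Row v4 v3 v5 v6 v1 v2 v0)) (Leaf (Row v1 v0 v3 v5 v4 v6 v2)))
    (Leaf (Row v0 v6 v2 v3 v4 v5 v1))) (Split v1 v6 (Split v1 v5 (Leaf (Row v2 v1 v5 v6 v3 v4 v0))
    (Leaf (Row v1 v3 v0 v5 v2 v6 v4))) (Leaf (Row v0 v6 v1 v5 v2 v3 v4))))) (Split v5 v6
    (Split v2 v6 (Split v1 v6 (Leaf (Row v0 v1 v2 v6 v4 v3 v5)) (Split v1 v5
    (Leaf (Row v0 v1 v2 v5 v4 v3 v6)) (Split v3 v5 (Leaf (Row v6 v3 v0 v1 v2 v5 v4)) (Split v0 v6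
    (Leaf (Row v0 v2 v1 v5 v6 v3 v4)) (Leaf (Row v1 v3 v0 v6 v2 v4 v5))))))
    (Leaf (Row v0 v6 v1 v5 v4 v3 v2))) (Split v1 v6 (Split v0 v5 (Leaf (Row v0 v6 v2 v1 v4 v5 v3))
    (Leaf (Row v4 v3 v0 v1 v2 v5 v6))) (Leaf (Row v1 v2 v0 v6 v5 v3 v4))))) (Split v1 v6
    (Split v4 v6 (Split v3 v5 (Split v5 v6 (Leaf (Row v6 v3 v0 v2 v1 v5 v4))
    (Leaf (Row v5 v0 v2 v6 v4 v3 v1))) (Split v0 v5 (Split v2 v6 (Leaf (Row v2 v3 v1 v0 v4 v6 v5))
    (Leaf (Row v6 v5 v2 v0 v4 v1 v3))) (Leaf (Row v0 v1 v2 v5 v6 v3 v4)))) (Split v5 v6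
    (Leaf (Row v6 v4 v0 v2 v1 v5 v3)) (Leaf (Row v5 v0 v2 v6 v3 v4 v1)))) (Split v3 v6 (Split v0 v5
    (Split v5 v6 (Leaf (Row v0 v5 v6 v1 v4 v3 v2)) (Split v1 v5 (Split v4 v6
    (Leaf (Row v3 v4 v5 v6 v2 v1 v0)) (Leaf (Row v0 v6 v1 v2 v3 v5 v4)))
    (Leaf (Row v1 v2 v6 v5 v4 v3 v0)))) (Leaf (Row v0 v6 v5 v2 v3 v4 v1))) (Split v1 v5 (Split v0 v6
    (Leaf (Row v5 v6 v2 v0 v4 v1 v3)) (Leaf (Row v6 v1 v2 v5 v4 v3 v0))) (Split v5 v6
    (Leaf (Row v1 v2 v0 v6 v4 v3 v5)) (Leaf (Row v3 v4 v5 v6 v2 v1 v0))))))) (Split v2 v6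
    (Split v4 v6 (Split v2 v5 (Split v5 v6 (Leaf (Row v5 v4 v0 v1 v2 v6 v3)) (Split v0 v5
    (Leaf (Row v1 v2 v6 v5 v3 v4 v0)) (Leaf (Row v1 v2 v5 v6 v4 v3 v0)))) (Split v1 v5 (Split v5 v6
    (Leaf (Row v1 v6 v0 v2 v4 v5 v3)) (Leaf (Row v2 v0 v4 v5 v3 v6 v1))) (Split v5 v6
    (Leaf (Row v0 v6 v1 v2 v4 v5 v3)) (Leaf (Row v5 v0 v1 v6 v4 v3 v2))))) (Split v1 v5 (Split v0 v5
    (Split v5 v6 (Leaf (Row v0 v1 v2 v5 v3 v4 v6)) (Leaf (Row v5 v3 v4 v6 v2 v1 v0))) (Split v5 v6
    (Leaf (Row v0 v1 v2 v5 v3 v4 v6)) (Leaf (Row v4 v3 v6 v5 v1 v2 v0)))) (Split v5 v6 (Split v2 v5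
    (Split v3 v6 (Split v0 v5 (Leaf (Row v3 v0 v4 v5 v6 v1 v2)) (Leaf (Row v5 v6 v1 v0 v3 v2 v4)))
    (Leaf (Row v0 v2 v5 v1 v4 v3 v6))) (Leaf (Row v0 v5 v1 v6 v3 v4 v2)))
    (Leaf (Row v1 v2 v0 v5 v6 v4 v3))))) (Split v4 v6 (Split v1 v5 (Split v5 v6
    (Leaf (Row v5 v4 v0 v2 v1 v6 v3)) (Leaf (Row v6 v0 v2 v5 v3 v4 v1))) (Split v0 v5 (Split v0 v6
    (Split v3 v6 (Leaf (Row v4 v3 v1 v5 v0 v6 v2)) (Leaf (Row v0 v6 v2 v1 v4 v5 v3)))
    (Leaf (Row v0 v5 v6 v2 v3 v4 v1))) (Leaf (Row v0 v6 v5 v1 v4 v3 v2)))) (Split v1 v5 (Split v5 v6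
    (Split v1 v6 (Split v3 v5 (Split v0 v6 (Leaf (Row v3 v0 v4 v6 v5 v2 v1))
    (Leaf (Row v6 v5 v2 v0 v3 v1 v4))) (Leaf (Row v0 v1 v6 v2 v4 v3 v5)))
    (Leaf (Row v0 v6 v2 v5 v3 v4 v1))) (Leaf (Row v2 v1 v0 v6 v5 v4 v3))) (Split v1 v6 (Split v0 v5
    (Split v3 v6 (Leaf (Row v6 v5 v2 v0 v3 v1 v4)) (Leaf (Row v2 v1 v0 v6 v3 v4 v5)))
    (Leaf (Row v5 v1 v2 v6 v3 v4 v0))) (Split v5 v6 (Leaf (Row v1 v2 v0 v5 v3 v4 v6))
    (Leaf (Row v6 v0 v5 v1 v4 v3 v2))))))),
    Split v3 v6 (Split v2 v6 (Split v1 v5 (Split v2 v5 (Split v5 v6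
    (Leaf (Row v5 v3 v4 v6 v2 v1 v0)) (Leaf (Row v0 v2 v1 v6 v4 v5 v3))) (Split v5 v6
    (Leaf (Row v0 v6 v1 v2 v3 v5 v4)) (Leaf (Row v3 v1 v2 v5 v4 v6 v0)))) (Split v3 v5 (Split v1 v6
    (Split v5 v6 (Leaf (Row v6 v3 v4 v5 v2 v1 v0)) (Leaf (Row v0 v5 v1 v2 v3 v4 v6))) (Split v5 v6
    (Leaf (Row v0 v3 v6 v1 v4 v5 v2)) (Leaf (Row v5 v0 v6 v1 v4 v3 v2)))) (Split v5 v6
    (Leaf (Row v0 v5 v3 v1 v2 v6 v4)) (Leaf (Row v4 v2 v6 v1 v3 v5 v0))))) (Split v1 v5 (Split v3 v5
    (Split v2 v5 (Split v5 v6 (Leaf (Row v0 v6 v2 v1 v3 v5 v4)) (Leaf (Row v0 v6 v2 v1 v3 v4 v5)))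
    (Split v5 v6 (Leaf (Row v0 v3 v5 v2 v4 v6 v1)) (Leaf (Row v6 v0 v5 v2 v4 v3 v1)))) (Split v5 v6
    (Leaf (Row v0 v5 v3 v2 v1 v6 v4)) (Leaf (Row v6 v0 v2 v5 v4 v3 v1)))) (Split v2 v5 (Split v5 v6
    (Leaf (Row v0 v6 v2 v1 v3 v5 v4)) (Leaf (Row v5 v0 v1 v6 v4 v2 v3))) (Split v5 v6 (Split v3 v5
    (Split v0 v6 (Split v0 v5 (Split v1 v6 (Leaf (Row v0 v5 v1 v2 v3 v6 v4)) (Split v4 v5
    (Leaf (Row v5 v0 v6 v1 v4 v3 v2)) (Leaf (Row v3 v0 v4 v5 v6 v1 v2))))
    (Leaf (Row v1 v2 v0 v5 v3 v4 v6))) (Leaf (Row v2 v1 v0 v6 v3 v4 v5)))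
    (Leaf (Row v0 v6 v2 v1 v3 v5 v4))) (Leaf (Row v1 v3 v0 v5 v6 v2 v4)))))) (Split v1 v5
    (Split v3 v5 (Split v2 v6 (Split v5 v6 (Leaf (Row v5 v0 v4 v6 v1 v3 v2))
    (Leaf (Row v1 v2 v3 v6 v4 v5 v0))) (Split v5 v6 (Leaf (Row v0 v6 v3 v2 v1 v5 v4))
    (Leaf (Row v4 v1 v5 v2 v3 v6 v0)))) (Split v1 v6 (Split v2 v5 (Split v5 v6
    (Leaf (Row v0 v1 v5 v3 v4 v6 v2)) (Leaf (Row v6 v0 v5 v3 v4 v1 v2))) (Split v5 v6 (Split v0 v6
    (Split v0 v5 (Split v2 v6 (Leaf (Row v0 v1 v6 v3 v4 v5 v2)) (Split v4 v5
    (Leaf (Row v5 v6 v0 v2 v1 v4 v3)) (Leaf (Row v0 v4 v1 v2 v3 v6 v5))))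
    (Leaf (Row v2 v3 v0 v5 v1 v4 v6))) (Leaf (Row v3 v2 v0 v6 v1 v4 v5)))
    (Leaf (Row v0 v1 v2 v3 v6 v5 v4)))) (Split v5 v6 (Leaf (Row v0 v6 v1 v3 v2 v5 v4)) (Split v2 v6
    (Leaf (Row v5 v0 v3 v6 v4 v1 v2)) (Leaf (Row v2 v1 v0 v6 v5 v3 v4)))))) (Split v3 v5
    (Split v1 v6 (Split v4 v5 (Split v5 v6 (Leaf (Row v1 v4 v5 v0 v2 v3 v6)) (Split v2 v5
    (Leaf (Row v6 v0 v3 v5 v4 v1 v2)) (Leaf (Row v5 v0 v2 v6 v4 v3 v1))))
    (Leaf (Row v4 v1 v6 v3 v2 v0 v5))) (Split v5 v6 (Leaf (Row v0 v6 v3 v1 v2 v5 v4)) (Split v2 v6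
    (Leaf (Row v5 v0 v1 v6 v4 v3 v2)) (Leaf (Row v2 v3 v0 v6 v5 v1 v4))))) (Split v2 v6 (Split v5 v6
    (Split v2 v5 (Split v0 v6 (Split v0 v5 (Split v1 v6 (Leaf (Row v0 v5 v1 v3 v2 v6 v4))
    (Split v4 v5 (Leaf (Row v4 v2 v6 v1 v3 v5 v0)) (Leaf (Row v1 v2 v0 v6 v5 v3 v4))))
    (Leaf (Row v1 v3 v0 v5 v2 v4 v6))) (Leaf (Row v3 v1 v0 v6 v2 v4 v5)))
    (Leaf (Row v0 v6 v3 v1 v2 v5 v4))) (Leaf (Row v1 v2 v0 v5 v6 v3 v4))) (Split v4 v5 (Split v4 v6
    (Split v0 v5 (Split v1 v6 (Leaf (Row v3 v2 v6 v5 v4 v1 v0)) (Leaf (Row v1 v2 v0 v6 v5 v3 v4)))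
    (Leaf (Row v3 v1 v5 v0 v6 v2 v4))) (Leaf (Row v0 v6 v2 v3 v1 v5 v4)))
    (Leaf (Row v0 v5 v1 v3 v2 v6 v4)))))),
    Split v4 v5 (Split v1 v6 (Split v2 v6 (Split v1 v5 (Split v0 v5 (Split v5 v6
    (Leaf (Row v1 v2 v4 v0 v6 v3 v5)) (Leaf (Row v3 v0 v5 v6 v2 v4 v1))) (Split v5 v6
    (Leaf (Row v0 v5 v3 v6 v1 v4 v2)) (Leaf (Row v0 v1 v2 v5 v3 v6 v4)))) (Split v0 v5 (Split v0 v6
    (Split v2 v5 (Split v3 v6 (Leaf (Row v4 v2 v6 v5 v3 v1 v0)) (Leaf (Row v4 v3 v0 v1 v2 v5 v6)))
    (Split v3 v6 (Leaf (Row v0 v5 v1 v2 v3 v4 v6)) (Leaf (Row v4 v3 v0 v1 v2 v5 v6)))) (Split v5 v6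
    (Leaf (Row v3 v0 v5 v1 v2 v4 v6)) (Leaf (Row v2 v4 v1 v5 v3 v6 v0)))) (Split v5 v6
    (Leaf (Row v0 v3 v5 v1 v2 v4 v6)) (Leaf (Row v2 v4 v1 v5 v3 v6 v0))))) (Split v1 v5 (Split v3 v6
    (Leaf (Row v0 v6 v4 v3 v1 v5 v2)) (Leaf (Row v4 v1 v2 v6 v5 v3 v0))) (Split v4 v6 (Split v3 v5
    (Leaf (Row v0 v6 v3 v1 v4 v5 v2)) (Leaf (Row v0 v2 v4 v1 v3 v5 v6)))
    (Leaf (Row v5 v2 v1 v3 v4 v0 v6))))) (Split v3 v5 (Split v4 v6 (Split v2 v6
    (Leaf (Row v0 v6 v3 v2 v4 v5 v1)) (Leaf (Row v3 v4 v1 v6 v5 v2 v0))) (Split v2 v6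
    (Leaf (Row v5 v0 v6 v1 v4 v3 v2)) (Leaf (Row v0 v6 v4 v1 v3 v5 v2)))) (Split v3 v6 (Split v4 v6
    (Split v2 v5 (Leaf (Row v1 v2 v6 v5 v4 v3 v0)) (Leaf (Row v0 v1 v4 v3 v2 v5 v6)))
    (Leaf (Row v5 v1 v3 v2 v4 v0 v6))) (Split v4 v6 (Split v2 v5 (Leaf (Row v0 v4 v2 v1 v3 v6 v5))
    (Leaf (Row v0 v4 v2 v5 v6 v3 v1))) (Leaf (Row v0 v6 v4 v3 v2 v5 v1)))))) (Split v3 v6
    (Split v2 v6 (Split v2 v5 (Split v1 v5 (Leaf (Row v0 v5 v3 v1 v2 v6 v4))
    (Leaf (Row v3 v2 v1 v5 v6 v4 v0))) (Split v1 v5 (Leaf (Row v0 v1 v3 v2 v4 v5 v6))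
    (Leaf (Row v0 v5 v2 v1 v3 v6 v4)))) (Split v2 v5 (Split v3 v5 (Split v1 v6
    (Leaf (Row v0 v5 v1 v2 v3 v6 v4)) (Leaf (Row v4 v3 v5 v6 v1 v2 v0)))
    (Leaf (Row v6 v4 v2 v1 v3 v0 v5))) (Split v3 v5 (Split v1 v6 (Leaf (Row v5 v6 v4 v1 v3 v0 v2))
    (Leaf (Row v0 v4 v3 v1 v2 v6 v5))) (Leaf (Row v0 v5 v3 v2 v1 v6 v4))))) (Split v1 v5
    (Split v4 v6 (Split v1 v6 (Split v2 v5 (Leaf (Row v0 v6 v2 v4 v1 v5 v3))
    (Leaf (Row v0 v3 v1 v4 v2 v5 v6))) (Leaf (Row v5 v3 v4 v2 v1 v0 v6))) (Split v1 v6 (Split v2 v5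
    (Leaf (Row v0 v1 v2 v3 v4 v6 v5)) (Leaf (Row v0 v1 v2 v5 v6 v4 v3)))
    (Leaf (Row v0 v6 v1 v4 v2 v5 v3)))) (Split v1 v6 (Split v2 v5 (Leaf (Row v0 v5 v1 v3 v2 v6 v4))
    (Leaf (Row v6 v4 v3 v2 v1 v0 v5))) (Split v2 v5 (Leaf (Row v0 v4 v2 v3 v1 v6 v5))
    (Leaf (Row v0 v5 v2 v1 v3 v6 v4)))))),
    Split v4 v5 (Split v5 v6 (Split v3 v6 (Leaf (Row v3 v4 v5 v0 v1 v2 v6)) (Split v0 v5
    (Leaf (Row v1 v0 v5 v3 v4 v6 v2)) (Leaf (Row v0 v1 v5 v3 v4 v6 v2)))) (Split v4 v6 (Split v1 v6
    (Split v0 v6 (Leaf (Row v2 v5 v0 v1 v4 v3 v6)) (Leaf (Row v0 v5 v2 v1 v4 v3 v6))) (Split v0 v5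
    (Leaf (Row v3 v4 v5 v6 v2 v1 v0)) (Leaf (Row v0 v4 v2 v1 v5 v6 v3)))) (Split v1 v6 (Split v0 v6
    (Leaf (Row v2 v0 v4 v6 v3 v5 v1)) (Leaf (Row v0 v2 v4 v6 v3 v5 v1))) (Split v0 v6
    (Leaf (Row v1 v2 v4 v6 v3 v5 v0)) (Leaf (Row v6 v2 v0 v5 v4 v3 v1)))))) (Split v4 v6
    (Split v0 v5 (Split v5 v6 (Leaf (Row v3 v4 v6 v0 v1 v2 v5)) (Split v1 v5
    (Leaf (Row v2 v0 v4 v5 v3 v6 v1)) (Leaf (Row v1 v2 v4 v5 v3 v6 v0)))) (Split v1 v5 (Split v5 v6
    (Leaf (Row v3 v4 v6 v0 v1 v2 v5)) (Leaf (Row v0 v2 v4 v5 v3 v6 v1))) (Split v5 v6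
    (Leaf (Row v3 v4 v6 v0 v1 v2 v5)) (Leaf (Row v5 v2 v0 v6 v4 v3 v1))))) (Split v0 v5 (Split v5 v6
    (Leaf (Row v1 v0 v5 v4 v3 v6 v2)) (Split v1 v5 (Leaf (Row v1 v0 v3 v5 v4 v6 v2))
    (Leaf (Row v3 v0 v4 v5 v6 v1 v2)))) (Split v5 v6 (Leaf (Row v0 v1 v5 v4 v3 v6 v2)) (Split v1 v5
    (Leaf (Row v0 v6 v2 v1 v3 v4 v5)) (Leaf (Row v0 v1 v3 v4 v6 v5 v2)))))),
    Split v1 v6 (Split v2 v6 (Split v4 v5 (Split v0 v5 (Split v0 v6 (Split v3 v6 (Split v3 v5
    (Split v5 v6 (Leaf (Row v0 v4 v3 v1 v5 v2 v6)) (Leaf (Row v0 v1 v3 v6 v4 v5 v2))) (Split v1 v5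
    (Leaf (Row v2 v1 v3 v5 v0 v6 v4)) (Leaf (Row v1 v2 v3 v5 v0 v6 v4))))
    (Leaf (Row v4 v1 v3 v6 v0 v5 v2))) (Split v5 v6 (Leaf (Row v1 v2 v4 v0 v6 v3 v5))
    (Leaf (Row v4 v1 v0 v6 v3 v5 v2)))) (Split v0 v6 (Split v1 v5 (Split v5 v6
    (Leaf (Row v4 v1 v6 v0 v3 v5 v2)) (Leaf (Row v2 v1 v0 v5 v3 v6 v4))) (Split v5 v6
    (Leaf (Row v4 v1 v6 v0 v3 v5 v2)) (Leaf (Row v1 v2 v0 v5 v3 v6 v4)))) (Split v5 v6
    (Leaf (Row v4 v1 v6 v0 v3 v5 v2)) (Leaf (Row v4 v1 v0 v6 v3 v5 v2))))) (Split v1 v5 (Split v0 v6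
    (Split v5 v6 (Split v3 v5 (Leaf (Row v2 v1 v4 v5 v6 v0 v3)) (Split v0 v5
    (Leaf (Row v2 v1 v4 v5 v6 v3 v0)) (Leaf (Row v0 v2 v3 v5 v6 v4 v1))))
    (Leaf (Row v0 v1 v3 v5 v6 v4 v2))) (Split v3 v5 (Leaf (Row v2 v4 v1 v0 v3 v6 v5))
    (Leaf (Row v2 v1 v4 v5 v6 v3 v0)))) (Split v0 v5 (Split v3 v5 (Leaf (Row v6 v3 v4 v5 v2 v1 v0))
    (Leaf (Row v1 v2 v4 v5 v6 v3 v0))) (Split v5 v6 (Leaf (Row v0 v3 v1 v5 v2 v4 v6))
    (Leaf (Row v2 v0 v1 v4 v6 v5 v3)))))) (Split v5 v6 (Split v4 v5
    (Leaf (Row v5 v0 v1 v2 v4 v6 v3)) (Split v0 v5 (Split v1 v5 (Split v4 v6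
    (Leaf (Row v0 v5 v3 v6 v1 v2 v4)) (Split v0 v6 (Split v3 v5 (Leaf (Row v3 v0 v4 v6 v5 v2 v1))
    (Leaf (Row v0 v1 v3 v5 v6 v4 v2))) (Leaf (Row v2 v1 v0 v6 v3 v4 v5))))
    (Leaf (Row v3 v0 v5 v1 v4 v2 v6))) (Split v1 v5 (Split v4 v6 (Leaf (Row v0 v5 v3 v6 v1 v2 v4))
    (Leaf (Row v4 v0 v2 v6 v1 v3 v5))) (Leaf (Row v0 v3 v5 v1 v4 v2 v6))))) (Split v0 v5
    (Split v4 v6 (Split v4 v5 (Leaf (Row v0 v4 v3 v6 v5 v2 v1)) (Split v1 v5 (Split v3 v6
    (Leaf (Row v5 v4 v2 v6 v1 v0 v3)) (Leaf (Row v3 v0 v5 v6 v4 v2 v1)))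
    (Leaf (Row v0 v6 v3 v4 v1 v5 v2)))) (Split v4 v5 (Split v0 v6 (Leaf (Row v6 v1 v2 v5 v4 v3 v0))
    (Leaf (Row v4 v2 v0 v6 v3 v5 v1))) (Leaf (Row v0 v1 v3 v6 v4 v5 v2)))) (Split v2 v5 (Split v1 v5
    (Leaf (Row v5 v3 v0 v6 v4 v2 v1)) (Split v4 v6 (Split v4 v5 (Leaf (Row v0 v4 v3 v5 v6 v1 v2))
    (Leaf (Row v0 v3 v4 v1 v5 v2 v6))) (Leaf (Row v0 v3 v1 v5 v2 v4 v6)))) (Split v1 v5
    (Leaf (Row v0 v6 v3 v1 v4 v2 v5)) (Split v3 v6 (Leaf (Row v5 v0 v2 v6 v1 v4 v3))
    (Leaf (Row v3 v5 v0 v6 v4 v2 v1)))))))) (Split v4 v6 (Split v4 v5 (Split v3 v6 (Split v5 v6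
    (Leaf (Row v5 v1 v3 v0 v4 v6 v2)) (Leaf (Row v3 v4 v0 v5 v1 v6 v2))) (Split v0 v5 (Split v2 v6
    (Leaf (Row v3 v4 v0 v6 v5 v1 v2)) (Leaf (Row v6 v1 v0 v3 v4 v5 v2))) (Split v1 v5
    (Leaf (Row v0 v6 v3 v5 v4 v2 v1)) (Split v2 v5 (Leaf (Row v4 v1 v0 v3 v5 v6 v2))
    (Leaf (Row v4 v1 v3 v0 v6 v5 v2)))))) (Split v0 v5 (Split v0 v6 (Split v1 v5 (Split v3 v5
    (Split v5 v6 (Leaf (Row v0 v4 v3 v1 v6 v2 v5)) (Leaf (Row v3 v0 v1 v6 v2 v5 v4)))
    (Leaf (Row v4 v2 v3 v5 v0 v6 v1))) (Split v5 v6 (Leaf (Row v0 v5 v3 v6 v2 v1 v4))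
    (Leaf (Row v1 v2 v5 v6 v4 v3 v0)))) (Split v2 v5 (Split v3 v6 (Leaf (Row v5 v4 v1 v6 v2 v0 v3))
    (Leaf (Row v0 v5 v3 v6 v2 v1 v4))) (Leaf (Row v5 v4 v2 v6 v1 v0 v3)))) (Split v0 v6 (Split v1 v5
    (Split v5 v6 (Leaf (Row v0 v4 v3 v1 v6 v2 v5)) (Leaf (Row v4 v2 v0 v5 v3 v6 v1))) (Split v3 v6
    (Split v2 v5 (Leaf (Row v0 v4 v3 v1 v2 v6 v5)) (Leaf (Row v0 v4 v3 v1 v6 v2 v5)))
    (Leaf (Row v3 v5 v0 v6 v2 v1 v4)))) (Split v1 v5 (Split v5 v6 (Leaf (Row v0 v4 v3 v6 v2 v1 v5))
    (Leaf (Row v4 v2 v0 v5 v3 v6 v1))) (Split v2 v6 (Split v3 v5 (Leaf (Row v5 v4 v2 v1 v3 v6 v0))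
    (Leaf (Row v0 v4 v3 v6 v2 v1 v5))) (Leaf (Row v0 v4 v3 v6 v2 v1 v5))))))) (Split v4 v5
    (Split v0 v6 (Split v5 v6 (Leaf (Row v5 v0 v2 v6 v1 v4 v3)) (Leaf (Row v4 v3 v1 v6 v2 v5 v0)))
    (Split v2 v5 (Split v5 v6 (Leaf (Row v5 v1 v3 v0 v4 v6 v2)) (Leaf (Row v0 v5 v3 v2 v4 v1 v6)))
    (Leaf (Row v0 v3 v4 v1 v6 v2 v5)))) (Split v2 v5 (Split v2 v6 (Split v0 v5 (Split v0 v6
    (Split v3 v5 (Leaf (Row v3 v0 v4 v6 v5 v1 v2)) (Leaf (Row v0 v2 v3 v5 v6 v4 v1))) (Split v3 v5
    (Leaf (Row v0 v3 v4 v6 v5 v1 v2)) (Leaf (Row v1 v2 v0 v6 v3 v4 v5)))) (Split v5 v6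
    (Leaf (Row v4 v0 v1 v6 v2 v3 v5)) (Leaf (Row v0 v2 v3 v5 v6 v4 v1))))
    (Leaf (Row v5 v0 v4 v1 v2 v6 v3))) (Split v0 v5 (Split v2 v6 (Leaf (Row v3 v0 v2 v5 v1 v4 v6))
    (Leaf (Row v0 v6 v3 v5 v4 v2 v1))) (Split v2 v6 (Leaf (Row v0 v3 v2 v5 v1 v4 v6))
    (Leaf (Row v0 v6 v3 v5 v4 v2 v1))))))),
    Split v4 v6 (Split v2 v5 (Split v3 v5 (Split v0 v5 (Split v5 v6
    (Leaf (Row v5 v4 v2 v1 v6 v0 v3)) (Split v1 v6 (Split v2 v6 (Leaf (Row v0 v1 v3 v6 v4 v5 v2))
    (Leaf (Row v2 v0 v5 v6 v4 v3 v1))) (Leaf (Row v1 v3 v0 v6 v2 v5 v4)))) (Split v2 v6 (Split v1 v5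
    (Split v1 v6 (Leaf (Row v1 v2 v3 v0 v6 v5 v4)) (Split v3 v6 (Leaf (Row v6 v2 v0 v5 v3 v4 v1))
    (Leaf (Row v3 v5 v0 v6 v2 v1 v4)))) (Split v3 v6 (Split v0 v6 (Split v5 v6
    (Leaf (Row v1 v2 v0 v5 v3 v4 v6)) (Leaf (Row v5 v6 v0 v1 v3 v2 v4)))
    (Leaf (Row v0 v6 v1 v5 v2 v4 v3))) (Leaf (Row v0 v6 v1 v5 v2 v4 v3)))) (Split v1 v5 (Split v3 v6
    (Leaf (Row v1 v6 v3 v0 v4 v5 v2)) (Split v0 v6 (Leaf (Row v3 v2 v5 v0 v4 v1 v6))
    (Leaf (Row v0 v5 v3 v6 v1 v2 v4)))) (Leaf (Row v1 v6 v5 v0 v4 v3 v2))))) (Split v0 v6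
    (Split v4 v5 (Split v1 v6 (Leaf (Row v0 v5 v1 v2 v4 v6 v3)) (Leaf (Row v6 v5 v2 v1 v4 v0 v3)))
    (Leaf (Row v0 v2 v5 v3 v4 v6 v1))) (Split v4 v5 (Split v0 v5 (Split v5 v6
    (Leaf (Row v6 v1 v0 v3 v4 v5 v2)) (Leaf (Row v4 v2 v3 v5 v0 v6 v1))) (Split v1 v5
    (Leaf (Row v1 v4 v2 v0 v6 v3 v5)) (Leaf (Row v0 v4 v3 v5 v6 v1 v2))))
    (Leaf (Row v1 v4 v2 v0 v6 v3 v5))))) (Split v1 v6 (Split v5 v6 (Split v4 v5 (Split v0 v5
    (Split v0 v6 (Split v3 v6 (Leaf (Row v4 v6 v3 v0 v5 v1 v2)) (Leaf (Row v3 v2 v6 v0 v4 v1 v5)))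
    (Leaf (Row v6 v1 v0 v3 v4 v5 v2))) (Leaf (Row v5 v3 v1 v2 v4 v6 v0)))
    (Leaf (Row v5 v4 v3 v0 v6 v1 v2))) (Split v0 v6 (Split v1 v5 (Leaf (Row v3 v5 v0 v1 v4 v2 v6))
    (Leaf (Row v5 v2 v0 v3 v4 v6 v1))) (Split v1 v5 (Leaf (Row v0 v5 v3 v1 v4 v2 v6))
    (Leaf (Row v4 v0 v2 v5 v1 v6 v3))))) (Split v5 v6 (Split v1 v5 (Leaf (Row v0 v6 v3 v5 v4 v2 v1))
    (Split v2 v6 (Leaf (Row v5 v0 v2 v1 v4 v6 v3)) (Split v0 v5 (Split v3 v5
    (Leaf (Row v5 v4 v2 v1 v6 v0 v3)) (Leaf (Row v6 v2 v0 v3 v4 v5 v1))) (Split v3 v5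
    (Leaf (Row v1 v6 v5 v0 v4 v3 v2)) (Leaf (Row v0 v4 v3 v1 v5 v6 v2)))))) (Split v3 v5
    (Leaf (Row v1 v3 v0 v6 v2 v5 v4)) (Split v0 v6 (Leaf (Row v1 v5 v2 v0 v4 v3 v6))
    (Leaf (Row v6 v0 v2 v5 v4 v3 v1))))))) (Split v4 v5 (Split v2 v6 (Split v0 v5 (Split v3 v6
    (Split v1 v5 (Split v2 v5 (Leaf (Row v6 v4 v1 v0 v2 v3 v5)) (Leaf (Row v6 v4 v0 v1 v3 v2 v5)))
    (Split v3 v5 (Leaf (Row v0 v4 v3 v1 v2 v5 v6)) (Split v0 v6 (Leaf (Row v6 v4 v3 v5 v0 v2 v1))
    (Leaf (Row v3 v6 v0 v5 v2 v1 v4))))) (Leaf (Row v0 v2 v6 v3 v4 v5 v1))) (Split v0 v6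
    (Split v3 v5 (Split v1 v6 (Leaf (Row v3 v4 v1 v0 v2 v5 v6)) (Split v1 v5 (Split v2 v5
    (Split v3 v6 (Leaf (Row v1 v2 v4 v6 v3 v5 v0)) (Leaf (Row v3 v4 v1 v0 v2 v5 v6)))
    (Leaf (Row v2 v0 v6 v1 v4 v3 v5))) (Leaf (Row v3 v4 v1 v0 v2 v5 v6))))
    (Leaf (Row v1 v4 v2 v0 v5 v3 v6))) (Split v5 v6 (Leaf (Row v1 v4 v2 v0 v5 v3 v6))
    (Leaf (Row v5 v1 v0 v6 v3 v4 v2))))) (Split v3 v5 (Split v1 v6 (Leaf (Row v0 v6 v3 v1 v5 v2 v4))
    (Leaf (Row v6 v4 v3 v0 v5 v1 v2))) (Split v5 v6 (Leaf (Row v6 v4 v3 v0 v5 v1 v2)) (Split v0 v5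
    (Leaf (Row v6 v1 v2 v5 v4 v3 v0)) (Leaf (Row v6 v4 v3 v0 v5 v1 v2)))))) (Split v2 v6
    (Split v5 v6 (Split v1 v5 (Split v3 v6 (Split v1 v6 (Split v2 v5
    (Leaf (Row v3 v5 v1 v0 v2 v6 v4)) (Leaf (Row v2 v0 v4 v5 v6 v3 v1)))
    (Leaf (Row v0 v3 v1 v6 v2 v4 v5))) (Split v0 v5 (Leaf (Row v1 v2 v0 v6 v3 v4 v5)) (Split v2 v5
    (Leaf (Row v1 v2 v5 v0 v4 v3 v6)) (Leaf (Row v0 v6 v1 v5 v2 v4 v3))))) (Split v0 v6 (Split v0 v5
    (Split v3 v5 (Leaf (Row v0 v3 v2 v5 v1 v4 v6)) (Leaf (Row v3 v4 v1 v5 v0 v2 v6)))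
    (Leaf (Row v1 v2 v0 v5 v3 v4 v6))) (Split v3 v5 (Leaf (Row v0 v3 v2 v1 v4 v5 v6))
    (Leaf (Row v1 v2 v6 v0 v4 v3 v5))))) (Split v2 v5 (Split v0 v5 (Leaf (Row v6 v4 v1 v0 v2 v3 v5))
    (Leaf (Row v0 v2 v3 v5 v6 v4 v1))) (Leaf (Row v2 v0 v1 v5 v4 v6 v3)))) (Split v0 v5 (Split v3 v5
    (Split v0 v6 (Split v1 v6 (Leaf (Row v3 v0 v4 v6 v5 v2 v1)) (Leaf (Row v0 v4 v3 v1 v2 v6 v5)))
    (Split v1 v6 (Leaf (Row v0 v3 v4 v6 v5 v2 v1)) (Leaf (Row v3 v4 v0 v1 v2 v6 v5)))) (Split v1 v5
    (Leaf (Row v4 v3 v5 v6 v1 v2 v0)) (Leaf (Row v2 v0 v6 v5 v4 v3 v1)))) (Split v1 v6 (Split v3 v5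
    (Leaf (Row v6 v5 v4 v2 v3 v1 v0)) (Leaf (Row v0 v1 v3 v5 v6 v4 v2)))
    (Leaf (Row v1 v2 v3 v0 v4 v5 v6)))))),
    Split v4 v5 (Split v5 v6 (Split v3 v6 (Leaf (Row v2 v6 v1 v0 v5 v3 v4)) (Split v4 v6
    (Split v0 v5 (Split v1 v5 (Leaf (Row v0 v6 v1 v2 v4 v5 v3)) (Split v2 v5
    (Leaf (Row v0 v6 v2 v1 v4 v5 v3)) (Leaf (Row v3 v4 v6 v0 v5 v1 v2))))
    (Leaf (Row v0 v2 v5 v3 v4 v6 v1))) (Leaf (Row v2 v6 v1 v0 v5 v3 v4)))) (Split v2 v6 (Split v3 v5
    (Split v3 v6 (Split v0 v6 (Leaf (Row v1 v5 v0 v2 v3 v4 v6)) (Leaf (Row v0 v5 v1 v2 v3 v4 v6)))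
    (Leaf (Row v1 v2 v3 v6 v4 v5 v0))) (Split v1 v6 (Leaf (Row v1 v4 v2 v0 v5 v3 v6)) (Split v0 v5
    (Split v1 v5 (Leaf (Row v5 v0 v3 v6 v4 v1 v2)) (Leaf (Row v4 v0 v5 v6 v3 v1 v2)))
    (Leaf (Row v0 v5 v2 v1 v4 v6 v3))))) (Split v0 v6 (Split v3 v6 (Split v0 v5
    (Leaf (Row v1 v0 v6 v5 v4 v3 v2)) (Split v1 v6 (Leaf (Row v0 v1 v6 v5 v4 v3 v2))
    (Leaf (Row v6 v0 v2 v5 v4 v3 v1)))) (Leaf (Row v2 v5 v1 v0 v4 v3 v6))) (Split v4 v6
    (Leaf (Row v6 v1 v2 v0 v5 v3 v4)) (Leaf (Row v6 v1 v2 v5 v4 v3 v0)))))) (Split v3 v6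
    (Split v3 v5 (Split v2 v6 (Leaf (Row v0 v5 v2 v1 v3 v6 v4)) (Split v1 v5
    (Leaf (Row v0 v4 v3 v2 v1 v6 v5)) (Leaf (Row v0 v3 v4 v5 v6 v1 v2))))
    (Leaf (Row v4 v3 v6 v1 v2 v0 v5))) (Split v3 v5 (Split v1 v6 (Leaf (Row v6 v4 v3 v2 v1 v0 v5))
    (Leaf (Row v0 v5 v2 v1 v3 v6 v4))) (Leaf (Row v3 v4 v6 v0 v1 v2 v5)))),
    Split v4 v5 (Split v5 v6 (Split v3 v6 (Split v1 v5 (Leaf (Row v2 v1 v5 v0 v3 v4 v6))
    (Leaf (Row v0 v4 v3 v5 v2 v1 v6))) (Leaf (Row v5 v2 v0 v3 v4 v6 v1))) (Split v1 v6 (Split v3 v6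
    (Split v0 v6 (Split v1 v5 (Leaf (Row v2 v1 v6 v5 v4 v3 v0)) (Split v0 v5
    (Leaf (Row v3 v0 v1 v5 v2 v6 v4)) (Leaf (Row v0 v3 v1 v5 v2 v6 v4)))) (Split v2 v6
    (Leaf (Row v4 v2 v0 v6 v3 v5 v1)) (Leaf (Row v0 v4 v2 v6 v1 v5 v3))))
    (Leaf (Row v1 v4 v2 v5 v3 v6 v0))) (Split v3 v6 (Split v0 v6 (Leaf (Row v4 v3 v1 v6 v2 v5 v0))
    (Leaf (Row v0 v4 v1 v6 v2 v5 v3))) (Leaf (Row v3 v4 v0 v6 v5 v1 v2))))) (Split v3 v6
    (Split v5 v6 (Leaf (Row v6 v1 v0 v4 v3 v5 v2)) (Split v1 v5 (Leaf (Row v1 v3 v2 v6 v4 v5 v0))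
    (Leaf (Row v4 v3 v0 v5 v6 v1 v2)))) (Split v1 v5 (Split v5 v6 (Leaf (Row v2 v1 v5 v4 v3 v0 v6))
    (Split v0 v6 (Split v1 v6 (Leaf (Row v2 v1 v6 v5 v3 v4 v0)) (Leaf (Row v6 v2 v1 v5 v3 v4 v0)))
    (Leaf (Row v6 v1 v3 v0 v5 v4 v2)))) (Split v5 v6 (Leaf (Row v1 v2 v5 v4 v3 v0 v6)) (Split v0 v5
    (Leaf (Row v5 v2 v1 v6 v4 v3 v0)) (Leaf (Row v1 v2 v4 v5 v3 v0 v6)))))),
    Split v4 v5 (Split v3 v6 (Split v1 v6 (Split v5 v6 (Leaf (Row v4 v6 v3 v0 v5 v1 v2))
    (Split v1 v5 (Split v0 v5 (Leaf (Row v2 v1 v5 v6 v3 v4 v0)) (Leaf (Row v2 v1 v6 v5 v4 v3 v0)))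
    (Leaf (Row v3 v4 v1 v5 v2 v6 v0)))) (Split v5 v6 (Leaf (Row v1 v2 v6 v0 v4 v3 v5))
    (Leaf (Row v4 v3 v1 v6 v2 v5 v0)))) (Split v5 v6 (Split v0 v5 (Split v2 v6 (Split v0 v6
    (Split v1 v5 (Split v4 v6 (Leaf (Row v0 v4 v2 v1 v5 v6 v3)) (Leaf (Row v0 v2 v1 v4 v3 v6 v5)))
    (Leaf (Row v5 v2 v0 v3 v4 v6 v1))) (Leaf (Row v5 v2 v0 v3 v4 v6 v1))) (Split v0 v6 (Split v1 v6
    (Leaf (Row v4 v1 v3 v6 v5 v2 v0)) (Leaf (Row v1 v4 v2 v6 v5 v3 v0)))
    (Leaf (Row v5 v2 v0 v3 v4 v6 v1)))) (Leaf (Row v0 v2 v5 v3 v4 v6 v1))) (Split v1 v6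
    (Leaf (Row v1 v4 v2 v5 v3 v6 v0)) (Split v0 v5 (Leaf (Row v1 v5 v2 v0 v4 v3 v6))
    (Leaf (Row v3 v4 v5 v6 v2 v1 v0)))))) (Split v4 v6 (Split v1 v5 (Split v0 v6 (Split v5 v6
    (Split v3 v5 (Leaf (Row v4 v5 v3 v0 v6 v1 v2)) (Split v2 v5 (Leaf (Row v2 v0 v6 v5 v3 v4 v1))
    (Leaf (Row v4 v2 v3 v0 v6 v1 v5)))) (Leaf (Row v2 v0 v6 v5 v3 v4 v1))) (Split v3 v6 (Split v5 v6
    (Leaf (Row v6 v1 v3 v0 v5 v4 v2)) (Leaf (Row v1 v3 v2 v6 v4 v5 v0)))
    (Leaf (Row v6 v1 v3 v0 v5 v4 v2)))) (Split v5 v6 (Leaf (Row v6 v0 v2 v5 v1 v4 v3))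
    (Leaf (Row v4 v3 v1 v5 v2 v6 v0)))) (Split v0 v6 (Split v2 v5 (Split v5 v6 (Split v0 v5
    (Split v3 v5 (Split v1 v5 (Split v3 v6 (Leaf (Row v6 v4 v2 v1 v3 v0 v5))
    (Leaf (Row v3 v1 v4 v6 v5 v2 v0))) (Leaf (Row v3 v1 v4 v6 v5 v2 v0)))
    (Leaf (Row v2 v6 v1 v0 v5 v3 v4))) (Leaf (Row v1 v2 v0 v5 v3 v4 v6)))
    (Leaf (Row v0 v2 v3 v4 v5 v6 v1))) (Split v3 v6 (Split v1 v5 (Leaf (Row v3 v1 v4 v5 v6 v2 v0))
    (Split v0 v5 (Leaf (Row v0 v4 v3 v1 v2 v5 v6)) (Leaf (Row v3 v4 v1 v0 v2 v5 v6)))) (Split v1 v5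
    (Leaf (Row v0 v2 v1 v3 v4 v6 v5)) (Leaf (Row v4 v3 v6 v5 v1 v2 v0))))) (Split v5 v6
    (Leaf (Row v6 v1 v0 v4 v3 v5 v2)) (Split v1 v5 (Leaf (Row v6 v4 v2 v1 v3 v0 v5))
    (Leaf (Row v0 v1 v3 v4 v6 v5 v2)))))),
    Split v4 v6 (Split v2 v5 (Split v4 v5 (Split v3 v6 (Split v1 v5
    (Leaf (Row v1 v6 v0 v2 v4 v3 v5)) (Leaf (Row v0 v4 v3 v5 v6 v1 v2)))
    (Leaf (Row v0 v6 v2 v1 v4 v5 v3))) (Split v3 v6 (Split v1 v5 (Leaf (Row v6 v4 v2 v1 v3 v0 v5))
    (Leaf (Row v5 v0 v4 v1 v6 v2 v3))) (Leaf (Row v5 v3 v4 v1 v2 v0 v6)))) (Split v3 v5 (Split v0 v5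
    (Split v5 v6 (Leaf (Row v4 v2 v3 v0 v6 v1 v5)) (Leaf (Row v1 v0 v5 v6 v4 v3 v2))) (Split v5 v6
    (Leaf (Row v2 v1 v5 v4 v3 v0 v6)) (Leaf (Row v0 v4 v2 v5 v1 v6 v3)))) (Split v1 v5
    (Leaf (Row v4 v1 v3 v5 v6 v2 v0)) (Leaf (Row v1 v4 v2 v5 v6 v3 v0))))) (Split v4 v5 (Split v1 v6
    (Split v3 v5 (Split v2 v6 (Leaf (Row v1 v5 v0 v2 v3 v4 v6)) (Leaf (Row v3 v1 v4 v6 v5 v2 v0)))
    (Leaf (Row v6 v3 v4 v2 v1 v0 v5))) (Split v2 v5 (Split v3 v6 (Leaf (Row v5 v0 v6 v1 v4 v2 v3))
    (Leaf (Row v5 v3 v2 v1 v4 v0 v6))) (Leaf (Row v5 v0 v2 v6 v1 v4 v3)))) (Split v3 v5 (Split v1 v6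
    (Split v2 v6 (Leaf (Row v0 v1 v3 v4 v6 v5 v2)) (Leaf (Row v3 v1 v4 v6 v5 v2 v0))) (Split v2 v6
    (Leaf (Row v0 v5 v2 v1 v3 v6 v4)) (Leaf (Row v0 v4 v3 v2 v1 v6 v5)))) (Split v1 v5
    (Leaf (Row v2 v1 v3 v4 v5 v6 v0)) (Leaf (Row v1 v2 v3 v4 v5 v6 v0))))),
    Split v2 v6 (Split v0 v5 (Split v1 v6 (Split v3 v5 (Split v5 v6
    (Leaf (Row v6 v4 v0 v3 v2 v1 v5)) (Leaf (Row v0 v1 v3 v6 v4 v5 v2))) (Split v3 v6 (Split v5 v6
    (Leaf (Row v6 v0 v4 v5 v1 v3 v2)) (Leaf (Row v3 v2 v1 v5 v4 v6 v0))) (Split v5 v6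
    (Leaf (Row v1 v0 v5 v3 v4 v6 v2)) (Leaf (Row v3 v4 v6 v5 v0 v1 v2))))) (Split v3 v5 (Split v1 v5
    (Split v5 v6 (Leaf (Row v0 v5 v2 v3 v6 v1 v4)) (Leaf (Row v1 v0 v3 v6 v4 v5 v2))) (Split v5 v6
    (Leaf (Row v3 v2 v6 v1 v4 v5 v0)) (Leaf (Row v5 v4 v1 v6 v2 v3 v0)))) (Split v0 v6 (Split v1 v5
    (Split v2 v5 (Split v4 v5 (Leaf (Row v2 v3 v0 v1 v4 v6 v5)) (Leaf (Row v0 v5 v1 v3 v2 v6 v4)))
    (Split v4 v5 (Leaf (Row v2 v3 v0 v1 v4 v6 v5)) (Leaf (Row v6 v4 v3 v2 v1 v0 v5)))) (Split v4 v5
    (Leaf (Row v0 v4 v2 v3 v1 v5 v6)) (Leaf (Row v3 v2 v1 v5 v6 v4 v0)))) (Split v2 v5 (Split v1 v5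
    (Split v4 v6 (Leaf (Row v0 v5 v3 v6 v2 v1 v4)) (Leaf (Row v2 v3 v0 v1 v4 v6 v5))) (Split v4 v5
    (Leaf (Row v3 v5 v2 v0 v4 v6 v1)) (Leaf (Row v1 v0 v2 v3 v6 v5 v4))))
    (Leaf (Row v0 v4 v6 v3 v2 v1 v5)))))) (Split v0 v6 (Split v3 v5 (Split v5 v6
    (Leaf (Row v0 v4 v5 v2 v3 v1 v6)) (Leaf (Row v0 v1 v2 v5 v4 v6 v3))) (Split v3 v6 (Split v5 v6
    (Leaf (Row v2 v6 v1 v0 v5 v3 v4)) (Split v1 v5 (Leaf (Row v3 v2 v0 v5 v4 v6 v1))
    (Leaf (Row v5 v6 v3 v1 v0 v2 v4)))) (Split v5 v6 (Leaf (Row v0 v1 v5 v3 v4 v6 v2))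
    (Leaf (Row v3 v4 v6 v5 v1 v0 v2))))) (Split v3 v5 (Split v1 v5 (Split v5 v6
    (Leaf (Row v2 v3 v5 v0 v4 v6 v1)) (Leaf (Row v0 v4 v5 v6 v2 v3 v1))) (Split v5 v6
    (Leaf (Row v2 v3 v5 v0 v4 v6 v1)) (Leaf (Row v0 v4 v6 v5 v3 v2 v1)))) (Split v1 v6 (Split v1 v5
    (Split v4 v5 (Leaf (Row v0 v6 v5 v3 v2 v1 v4)) (Leaf (Row v3 v2 v0 v5 v6 v4 v1))) (Split v4 v5
    (Leaf (Row v0 v6 v5 v3 v2 v1 v4)) (Leaf (Row v4 v1 v0 v6 v2 v3 v5)))) (Split v5 v6
    (Leaf (Row v4 v0 v1 v6 v2 v3 v5)) (Leaf (Row v0 v1 v2 v3 v6 v5 v4))))))) (Split v1 v6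
    (Split v3 v5 (Split v4 v5 (Split v0 v5 (Split v5 v6 (Leaf (Row v0 v1 v6 v2 v4 v5 v3))
    (Split v2 v5 (Leaf (Row v2 v3 v0 v6 v4 v5 v1)) (Leaf (Row v5 v4 v2 v6 v1 v0 v3)))) (Split v3 v6
    (Leaf (Row v0 v1 v3 v2 v5 v6 v4)) (Split v1 v5 (Split v4 v6 (Leaf (Row v0 v4 v5 v2 v3 v6 v1))
    (Leaf (Row v6 v4 v5 v0 v1 v2 v3))) (Leaf (Row v3 v4 v6 v0 v1 v2 v5))))) (Split v0 v5
    (Leaf (Row v4 v1 v5 v6 v0 v2 v3)) (Split v0 v6 (Leaf (Row v3 v2 v1 v0 v4 v5 v6))
    (Leaf (Row v4 v1 v5 v6 v0 v2 v3))))) (Split v0 v5 (Split v2 v5 (Split v5 v6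
    (Leaf (Row v0 v6 v2 v3 v1 v5 v4)) (Leaf (Row v2 v3 v0 v6 v4 v5 v1))) (Split v5 v6
    (Leaf (Row v0 v1 v6 v2 v4 v5 v3)) (Leaf (Row v2 v4 v6 v5 v0 v1 v3)))) (Split v1 v5 (Split v5 v6
    (Leaf (Row v4 v3 v2 v6 v1 v0 v5)) (Leaf (Row v0 v5 v1 v2 v4 v6 v3)))
    (Leaf (Row v4 v3 v2 v6 v1 v0 v5))))) (Split v0 v5 (Split v3 v5 (Split v0 v6 (Split v4 v6
    (Leaf (Row v0 v4 v3 v2 v1 v6 v5)) (Leaf (Row v2 v3 v1 v6 v5 v4 v0))) (Split v3 v6 (Split v4 v6
    (Leaf (Row v5 v4 v2 v6 v1 v0 v3)) (Leaf (Row v1 v0 v2 v6 v5 v4 v3)))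
    (Leaf (Row v0 v4 v3 v2 v1 v6 v5)))) (Split v0 v6 (Split v5 v6 (Leaf (Row v4 v3 v2 v6 v0 v1 v5))
    (Leaf (Row v1 v6 v0 v3 v4 v5 v2))) (Leaf (Row v4 v3 v2 v6 v0 v1 v5)))) (Split v2 v5 (Split v3 v6
    (Split v4 v5 (Leaf (Row v2 v5 v6 v1 v4 v3 v0)) (Leaf (Row v6 v4 v1 v0 v2 v3 v5)))
    (Leaf (Row v4 v0 v1 v6 v2 v3 v5))) (Split v4 v5 (Split v3 v6 (Leaf (Row v2 v5 v6 v1 v4 v3 v0))
    (Leaf (Row v4 v0 v1 v6 v3 v2 v5))) (Leaf (Row v3 v5 v0 v1 v6 v2 v4)))))),
    Split v3 v6 (Split v2 v5 (Split v5 v6 (Leaf (Row v6 v4 v1 v0 v2 v3 v5))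
    (Leaf (Row v1 v3 v2 v6 v4 v5 v0))) (Split v5 v6 (Leaf (Row v0 v6 v1 v2 v3 v5 v4)) (Split v0 v6
    (Leaf (Row v4 v0 v6 v5 v1 v2 v3)) (Leaf (Row v6 v4 v5 v0 v1 v2 v3))))) (Split v3 v5 (Split v4 v5
    (Split v5 v6 (Leaf (Row v3 v4 v6 v0 v1 v2 v5)) (Split v0 v5 (Leaf (Row v3 v2 v0 v6 v4 v5 v1))
    (Split v1 v5 (Leaf (Row v3 v2 v1 v6 v4 v5 v0)) (Leaf (Row v0 v1 v4 v6 v3 v5 v2)))))
    (Leaf (Row v6 v4 v3 v2 v1 v0 v5))) (Split v0 v5 (Split v5 v6 (Leaf (Row v1 v0 v5 v3 v4 v6 v2))
    (Split v1 v5 (Leaf (Row v0 v1 v4 v5 v6 v3 v2)) (Leaf (Row v4 v0 v5 v6 v1 v3 v2)))) (Split v5 v6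
    (Leaf (Row v0 v1 v5 v3 v4 v6 v2)) (Split v1 v5 (Leaf (Row v5 v4 v6 v0 v3 v2 v1))
    (Leaf (Row v0 v1 v4 v6 v3 v5 v2)))))),
    Split v2 v5 (Split v3 v6 (Split v5 v6 (Leaf (Row v5 v1 v4 v0 v6 v2 v3)) (Split v4 v6
    (Split v0 v6 (Split v3 v5 (Split v2 v6 (Leaf (Row v0 v5 v4 v2 v3 v1 v6)) (Split v1 v5
    (Leaf (Row v0 v4 v1 v2 v3 v6 v5)) (Leaf (Row v6 v0 v1 v5 v3 v4 v2))))
    (Leaf (Row v0 v4 v2 v1 v6 v3 v5))) (Leaf (Row v0 v1 v2 v6 v4 v5 v3)))
    (Leaf (Row v3 v2 v1 v5 v4 v6 v0)))) (Split v4 v6 (Split v5 v6 (Leaf (Row v5 v0 v3 v1 v6 v2 v4))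
    (Leaf (Row v4 v2 v0 v5 v3 v6 v1))) (Split v5 v6 (Split v0 v6 (Split v4 v5
    (Leaf (Row v0 v6 v4 v2 v5 v1 v3)) (Split v2 v6 (Split v1 v5 (Leaf (Row v4 v0 v5 v6 v1 v3 v2))
    (Leaf (Row v2 v0 v3 v1 v6 v5 v4))) (Leaf (Row v5 v0 v3 v1 v6 v2 v4))))
    (Leaf (Row v5 v0 v1 v3 v2 v6 v4))) (Leaf (Row v0 v2 v4 v5 v3 v6 v1))))) (Split v4 v6
    (Split v3 v6 (Split v5 v6 (Split v2 v6 (Leaf (Row v6 v0 v3 v1 v5 v2 v4))
    (Leaf (Row v6 v0 v1 v2 v3 v5 v4))) (Split v0 v6 (Split v3 v5 (Split v4 v5
    (Leaf (Row v0 v4 v5 v2 v6 v1 v3)) (Leaf (Row v5 v0 v4 v2 v6 v1 v3)))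
    (Leaf (Row v0 v4 v1 v2 v3 v6 v5))) (Leaf (Row v0 v3 v4 v6 v2 v5 v1)))) (Split v4 v5 (Split v5 v6
    (Leaf (Row v0 v4 v5 v2 v3 v1 v6)) (Leaf (Row v0 v4 v3 v6 v1 v5 v2))) (Split v5 v6
    (Leaf (Row v0 v3 v4 v2 v5 v1 v6)) (Leaf (Row v4 v2 v0 v5 v3 v6 v1))))) (Split v3 v6 (Split v5 v6
    (Leaf (Row v0 v6 v5 v2 v3 v1 v4)) (Split v3 v5 (Leaf (Row v1 v3 v4 v6 v0 v5 v2))
    (Leaf (Row v3 v2 v1 v5 v4 v6 v0)))) (Split v0 v6 (Split v5 v6 (Leaf (Row v0 v6 v4 v2 v5 v1 v3))
    (Split v1 v5 (Leaf (Row v1 v6 v0 v2 v4 v5 v3)) (Leaf (Row v0 v5 v4 v3 v6 v1 v2))))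
    (Leaf (Row v1 v6 v3 v2 v5 v0 v4))))),
    Split v4 v6 (Split v4 v5 (Split v1 v6 (Split v3 v5 (Split v0 v6 (Split v0 v5 (Split v1 v5
    (Split v3 v6 (Split v2 v5 (Leaf (Row v0 v4 v1 v2 v3 v6 v5)) (Leaf (Row v2 v5 v0 v1 v4 v3 v6)))
    (Leaf (Row v1 v6 v0 v2 v4 v5 v3))) (Split v5 v6 (Leaf (Row v1 v5 v0 v2 v4 v6 v3))
    (Leaf (Row v2 v5 v0 v1 v4 v3 v6)))) (Split v5 v6 (Leaf (Row v0 v5 v2 v1 v6 v3 v4))
    (Leaf (Row v2 v5 v0 v1 v4 v3 v6)))) (Split v5 v6 (Split v2 v6 (Leaf (Row v0 v4 v2 v1 v5 v3 v6))
    (Leaf (Row v6 v1 v0 v2 v4 v5 v3))) (Leaf (Row v0 v5 v2 v1 v4 v3 v6))))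
    (Leaf (Row v1 v5 v0 v2 v4 v6 v3))) (Split v5 v6 (Leaf (Row v1 v6 v0 v2 v4 v5 v3)) (Split v2 v5
    (Leaf (Row v0 v2 v4 v5 v3 v6 v1)) (Leaf (Row v5 v0 v2 v6 v3 v1 v4))))) (Split v1 v5 (Split v0 v5
    (Split v3 v6 (Split v5 v6 (Leaf (Row v0 v5 v2 v1 v6 v3 v4)) (Leaf (Row v2 v6 v1 v0 v3 v4 v5)))
    (Leaf (Row v2 v4 v0 v1 v6 v3 v5))) (Split v2 v5 (Split v3 v6 (Leaf (Row v5 v1 v4 v0 v6 v2 v3))
    (Leaf (Row v0 v4 v2 v1 v6 v3 v5))) (Leaf (Row v0 v4 v3 v1 v6 v2 v5)))) (Split v5 v6
    (Leaf (Row v0 v5 v2 v1 v6 v3 v4)) (Split v3 v6 (Split v0 v5 (Leaf (Row v3 v0 v5 v6 v4 v2 v1))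
    (Leaf (Row v5 v1 v4 v0 v6 v2 v3))) (Leaf (Row v0 v5 v4 v1 v2 v3 v6)))))) (Split v3 v5
    (Split v3 v6 (Split v0 v5 (Leaf (Row v0 v6 v1 v2 v3 v5 v4)) (Split v5 v6
    (Leaf (Row v0 v5 v1 v2 v3 v6 v4)) (Leaf (Row v0 v1 v2 v5 v4 v6 v3))))
    (Leaf (Row v1 v6 v2 v0 v5 v4 v3))) (Split v5 v6 (Leaf (Row v0 v6 v2 v1 v5 v3 v4)) (Split v2 v5
    (Leaf (Row v1 v2 v3 v5 v4 v6 v0)) (Split v0 v5 (Leaf (Row v0 v6 v1 v2 v3 v5 v4))
    (Leaf (Row v0 v3 v2 v5 v4 v6 v1)))))),
    Split v2 v6 (Split v5 v6 (Split v2 v5 (Split v0 v5 (Split v0 v6 (Split v1 v5 (Split v3 v5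
    (Split v1 v6 (Leaf (Row v3 v2 v1 v0 v6 v4 v5)) (Leaf (Row v3 v6 v2 v0 v5 v4 v1))) (Split v4 v5
    (Leaf (Row v2 v4 v3 v1 v5 v6 v0)) (Leaf (Row v1 v0 v2 v3 v6 v5 v4)))) (Split v3 v6 (Split v4 v5
    (Leaf (Row v5 v6 v3 v1 v0 v2 v4)) (Leaf (Row v3 v2 v1 v5 v6 v4 v0)))
    (Leaf (Row v6 v1 v0 v4 v2 v5 v3)))) (Leaf (Row v5 v0 v1 v3 v2 v6 v4)))
    (Leaf (Row v6 v0 v1 v3 v2 v5 v4))) (Split v0 v5 (Split v1 v5 (Split v1 v6
    (Leaf (Row v3 v2 v1 v0 v6 v4 v5)) (Split v3 v5 (Leaf (Row v3 v6 v2 v0 v5 v4 v1))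
    (Leaf (Row v6 v1 v4 v0 v5 v2 v3)))) (Leaf (Row v2 v1 v4 v0 v6 v3 v5)))
    (Leaf (Row v6 v1 v4 v0 v5 v2 v3)))) (Split v3 v5 (Split v4 v6 (Split v0 v5 (Split v0 v6
    (Split v2 v5 (Leaf (Row v0 v5 v4 v2 v3 v1 v6)) (Split v1 v6 (Leaf (Row v1 v5 v0 v3 v4 v6 v2))
    (Leaf (Row v3 v0 v6 v1 v5 v2 v4)))) (Leaf (Row v0 v1 v3 v6 v4 v5 v2)))
    (Leaf (Row v0 v1 v2 v5 v4 v6 v3))) (Leaf (Row v5 v1 v6 v0 v4 v3 v2))) (Split v0 v5
    (Leaf (Row v4 v2 v6 v3 v5 v1 v0)) (Split v1 v5 (Leaf (Row v1 v0 v2 v3 v6 v5 v4))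
    (Leaf (Row v4 v2 v6 v3 v5 v1 v0)))))) (Split v3 v5 (Split v5 v6 (Split v0 v5 (Split v0 v6
    (Split v3 v6 (Split v1 v5 (Split v4 v5 (Leaf (Row v1 v0 v2 v6 v5 v4 v3))
    (Leaf (Row v0 v4 v3 v2 v1 v6 v5))) (Leaf (Row v6 v1 v0 v4 v3 v5 v2)))
    (Leaf (Row v3 v4 v0 v6 v1 v2 v5))) (Leaf (Row v5 v0 v1 v2 v3 v6 v4))) (Split v2 v5
    (Leaf (Row v0 v4 v5 v3 v2 v1 v6)) (Leaf (Row v6 v1 v0 v2 v4 v5 v3)))) (Split v0 v6
    (Leaf (Row v4 v3 v5 v2 v6 v1 v0)) (Split v1 v5 (Leaf (Row v2 v3 v6 v0 v5 v4 v1))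
    (Leaf (Row v0 v5 v4 v3 v2 v1 v6))))) (Split v4 v6 (Split v5 v6 (Leaf (Row v0 v2 v4 v3 v5 v1 v6))
    (Leaf (Row v4 v2 v3 v5 v1 v6 v0))) (Split v5 v6 (Leaf (Row v0 v6 v4 v3 v5 v1 v2)) (Split v0 v5
    (Leaf (Row v4 v2 v6 v3 v5 v1 v0)) (Leaf (Row v0 v6 v4 v2 v3 v1 v5)))))),
    Split v2 v5 (Split v4 v6 (Split v3 v6 (Split v4 v5 (Split v1 v5
    (Leaf (Row v2 v6 v0 v1 v4 v3 v5)) (Leaf (Row v0 v5 v3 v2 v4 v6 v1)))
    (Leaf (Row v6 v4 v2 v1 v3 v0 v5))) (Split v4 v5 (Split v1 v6 (Split v0 v6
    (Leaf (Row v2 v3 v0 v1 v4 v5 v6)) (Leaf (Row v0 v3 v2 v1 v4 v5 v6)))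
    (Leaf (Row v1 v6 v0 v2 v4 v5 v3))) (Leaf (Row v0 v5 v1 v3 v2 v6 v4)))) (Split v2 v6
    (Leaf (Row v0 v6 v1 v3 v2 v5 v4)) (Leaf (Row v5 v4 v1 v3 v2 v0 v6)))) (Split v3 v6 (Split v5 v6
    (Split v4 v6 (Split v1 v6 (Leaf (Row v2 v3 v1 v5 v6 v4 v0)) (Split v3 v5
    (Leaf (Row v5 v0 v2 v6 v3 v1 v4)) (Leaf (Row v5 v0 v3 v2 v6 v1 v4))))
    (Leaf (Row v0 v6 v1 v2 v3 v5 v4))) (Leaf (Row v6 v4 v5 v1 v2 v3 v0))) (Split v0 v6 (Split v5 v6
    (Leaf (Row v4 v3 v2 v0 v5 v1 v6)) (Split v1 v5 (Leaf (Row v1 v6 v0 v2 v4 v5 v3))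
    (Leaf (Row v4 v3 v2 v0 v5 v1 v6)))) (Split v4 v6 (Split v1 v5 (Leaf (Row v1 v6 v0 v2 v4 v5 v3))
    (Leaf (Row v3 v0 v6 v1 v5 v2 v4))) (Leaf (Row v6 v4 v0 v3 v2 v1 v5))))),
    Split v4 v6 (Split v2 v5 (Split v1 v5 (Split v3 v6 (Split v3 v5 (Split v0 v6
    (Leaf (Row v0 v5 v4 v3 v2 v1 v6)) (Leaf (Row v2 v3 v6 v0 v5 v4 v1))) (Split v0 v6
    (Leaf (Row v0 v5 v3 v4 v2 v1 v6)) (Leaf (Row v5 v0 v1 v3 v4 v2 v6)))) (Split v0 v6
    (Leaf (Row v5 v0 v6 v1 v3 v2 v4)) (Leaf (Row v2 v4 v1 v0 v6 v3 v5)))) (Split v3 v6 (Split v3 v5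
    (Leaf (Row v6 v0 v1 v5 v3 v4 v2)) (Leaf (Row v6 v0 v1 v5 v4 v3 v2)))
    (Leaf (Row v4 v2 v5 v3 v1 v6 v0)))) (Split v0 v5 (Split v1 v6 (Split v5 v6 (Split v3 v5
    (Leaf (Row v6 v0 v5 v1 v2 v4 v3)) (Split v2 v6 (Leaf (Row v1 v0 v4 v2 v3 v5 v6))
    (Leaf (Row v1 v0 v4 v3 v2 v5 v6)))) (Leaf (Row v0 v1 v4 v2 v6 v5 v3))) (Split v4 v5 (Split v3 v5
    (Leaf (Row v5 v0 v1 v6 v4 v3 v2)) (Leaf (Row v1 v0 v4 v2 v6 v5 v3)))
    (Leaf (Row v5 v0 v1 v2 v4 v6 v3)))) (Split v4 v5 (Split v3 v6 (Leaf (Row v0 v6 v5 v2 v3 v4 v1))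
    (Leaf (Row v0 v6 v5 v2 v4 v1 v3))) (Leaf (Row v6 v1 v0 v5 v2 v4 v3))))) (Split v2 v5
    (Split v0 v6 (Split v2 v6 (Split v1 v5 (Split v3 v5 (Leaf (Row v5 v0 v6 v1 v4 v3 v2))
    (Leaf (Row v5 v0 v6 v1 v4 v2 v3))) (Split v3 v5 (Leaf (Row v1 v0 v2 v4 v5 v6 v3))
    (Leaf (Row v5 v6 v3 v1 v0 v2 v4)))) (Split v1 v5 (Split v0 v5 (Leaf (Row v2 v3 v0 v1 v6 v4 v5))
    (Leaf (Row v6 v1 v0 v4 v2 v5 v3))) (Leaf (Row v6 v0 v1 v4 v2 v5 v3)))) (Split v2 v6 (Split v3 v5
    (Leaf (Row v0 v5 v6 v4 v3 v2 v1)) (Leaf (Row v0 v5 v6 v4 v2 v1 v3)))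
    (Leaf (Row v5 v1 v0 v6 v4 v2 v3)))) (Split v0 v6 (Split v1 v5 (Split v3 v5
    (Leaf (Row v5 v0 v6 v1 v4 v3 v2)) (Split v1 v6 (Leaf (Row v2 v4 v1 v0 v5 v3 v6))
    (Leaf (Row v6 v3 v4 v2 v1 v0 v5)))) (Split v2 v6 (Leaf (Row v2 v3 v5 v4 v1 v6 v0))
    (Leaf (Row v6 v0 v1 v2 v4 v5 v3)))) (Split v4 v5 (Leaf (Row v4 v3 v6 v2 v0 v5 v1))
    (Leaf (Row v5 v1 v0 v4 v2 v6 v3))))),
    Split v2 v5 (Split v3 v5 (Split v2 v6 (Split v4 v6 (Leaf (Row v3 v6 v0 v1 v2 v4 v5))
    (Leaf (Row v0 v6 v1 v3 v2 v5 v4))) (Split v4 v6 (Leaf (Row v4 v5 v0 v1 v3 v2 v6))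
    (Leaf (Row v5 v0 v6 v4 v2 v3 v1)))) (Split v2 v6 (Leaf (Row v0 v5 v1 v4 v2 v6 v3))
    (Leaf (Row v6 v3 v2 v4 v0 v1 v5)))) (Split v3 v6 (Split v3 v5 (Leaf (Row v1 v5 v0 v4 v3 v6 v2))
    (Split v0 v6 (Leaf (Row v1 v0 v6 v5 v2 v3 v4)) (Leaf (Row v0 v1 v6 v5 v2 v3 v4)))) (Split v2 v6
    (Leaf (Row v5 v3 v2 v4 v0 v1 v6)) (Split v3 v5 (Leaf (Row v6 v2 v3 v4 v0 v1 v5))
    (Leaf (Row v4 v6 v0 v1 v5 v2 v3))))),
    Split v0 v5 (Split v5 v6 (Leaf (Row v6 v4 v0 v3 v2 v1 v5)) (Split v1 v6
    (Leaf (Row v2 v0 v1 v5 v4 v6 v3)) (Leaf (Row v1 v2 v0 v6 v4 v5 v3)))) (Split v4 v6 (Split v5 v6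
    (Leaf (Row v6 v4 v0 v3 v2 v1 v5)) (Split v3 v6 (Leaf (Row v0 v1 v3 v5 v4 v6 v2)) (Split v1 v5
    (Leaf (Row v3 v2 v1 v6 v4 v5 v0)) (Leaf (Row v0 v1 v4 v6 v5 v3 v2)))))
    (Leaf (Row v6 v4 v0 v3 v2 v1 v5))),
    Split v0 v6 (Split v5 v6 (Leaf (Row v4 v0 v6 v1 v2 v3 v5)) (Split v2 v5 (Split v1 v5
    (Leaf (Row v4 v5 v0 v1 v2 v3 v6)) (Leaf (Row v2 v0 v3 v1 v6 v5 v4))) (Split v1 v5
    (Leaf (Row v4 v5 v0 v1 v3 v2 v6)) (Leaf (Row v3 v0 v1 v2 v6 v5 v4))))) (Split v5 v6
    (Leaf (Row v0 v4 v6 v3 v2 v1 v5)) (Split v2 v6 (Split v1 v6 (Leaf (Row v3 v2 v0 v6 v4 v5 v1))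
    (Leaf (Row v0 v2 v4 v6 v5 v1 v3))) (Split v1 v5 (Leaf (Row v2 v1 v4 v0 v5 v6 v3))
    (Leaf (Row v0 v1 v4 v6 v5 v2 v3))))),
    Split v1 v6 (Split v5 v6 (Leaf (Row v6 v2 v4 v0 v5 v1 v3)) (Split v0 v5 (Split v2 v6
    (Leaf (Row v4 v6 v0 v1 v2 v3 v5)) (Leaf (Row v0 v1 v4 v6 v5 v2 v3))) (Split v2 v5
    (Leaf (Row v3 v2 v0 v5 v4 v6 v1)) (Leaf (Row v2 v3 v0 v5 v4 v6 v1))))) (Split v5 v6
    (Leaf (Row v5 v0 v3 v2 v6 v1 v4)) (Split v0 v6 (Split v2 v5 (Leaf (Row v5 v4 v6 v3 v1 v2 v0))
    (Leaf (Row v0 v1 v4 v5 v6 v2 v3))) (Split v2 v5 (Leaf (Row v1 v2 v4 v0 v5 v6 v3))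
    (Leaf (Row v2 v0 v3 v1 v5 v6 v4))))),
    Split v5 v6 (Split v0 v5 (Split v1 v6 (Split v2 v5 (Split v2 v6 (Split v1 v5 (Split v3 v6
    (Leaf (Row v2 v3 v1 v0 v6 v4 v5)) (Split v4 v5 (Leaf (Row v0 v1 v4 v6 v5 v3 v2))
    (Leaf (Row v1 v2 v4 v0 v5 v6 v3)))) (Leaf (Row v6 v1 v4 v0 v5 v2 v3)))
    (Leaf (Row v3 v5 v2 v1 v6 v0 v4))) (Leaf (Row v6 v2 v4 v0 v5 v1 v3)))
    (Leaf (Row v3 v5 v1 v2 v6 v0 v4))) (Leaf (Row v0 v4 v5 v1 v2 v3 v6))) (Split v3 v6 (Split v0 v6
    (Split v2 v5 (Split v1 v5 (Leaf (Row v5 v4 v6 v3 v1 v2 v0)) (Leaf (Row v2 v0 v3 v1 v6 v5 v4)))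
    (Split v0 v5 (Leaf (Row v6 v4 v5 v1 v2 v3 v0)) (Leaf (Row v2 v3 v0 v5 v4 v6 v1))))
    (Leaf (Row v2 v3 v0 v6 v4 v5 v1))) (Split v1 v5 (Leaf (Row v4 v1 v5 v6 v2 v3 v0))
    (Leaf (Row v3 v0 v2 v1 v6 v5 v4)))),
    Split v4 v6 (Split v5 v6 (Split v3 v5 (Split v0 v5 (Leaf (Row v1 v3 v5 v4 v6 v0 v2))
    (Leaf (Row v0 v4 v5 v1 v2 v3 v6))) (Leaf (Row v2 v5 v1 v0 v6 v4 v3))) (Split v1 v6 (Split v2 v6
    (Leaf (Row v4 v6 v0 v1 v2 v3 v5)) (Leaf (Row v0 v1 v4 v6 v5 v2 v3))) (Split v2 v5
    (Leaf (Row v5 v4 v6 v3 v1 v2 v0)) (Leaf (Row v2 v0 v3 v1 v5 v6 v4)))))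
    (Leaf (Row v5 v4 v1 v3 v2 v0 v6)),
    Split v5 v6 (Split v0 v5 (Split v2 v6 (Split v1 v6 (Split v3 v6 (Split v4 v5
    (Leaf (Row v0 v2 v4 v1 v6 v5 v3)) (Leaf (Row v3 v6 v2 v0 v5 v1 v4)))
    (Leaf (Row v4 v1 v3 v0 v6 v2 v5))) (Leaf (Row v3 v2 v1 v0 v6 v4 v5)))
    (Leaf (Row v5 v1 v2 v3 v6 v0 v4))) (Leaf (Row v6 v1 v2 v3 v5 v0 v4))) (Split v3 v6 (Split v1 v5
    (Leaf (Row v4 v6 v1 v0 v3 v2 v5)) (Leaf (Row v0 v3 v4 v1 v6 v5 v2))) (Split v1 v5
    (Leaf (Row v0 v1 v2 v3 v5 v6 v4)) (Leaf (Row v1 v6 v4 v0 v2 v3 v5)))),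
    Split v0 v6 (Split v4 v5 (Split v2 v5 (Split v2 v6 (Split v0 v5 (Split v1 v5 (Split v1 v6
    (Split v3 v6 (Leaf (Row v6 v5 v4 v1 v0 v2 v3)) (Leaf (Row v0 v1 v6 v3 v5 v2 v4))) (Split v5 v6
    (Leaf (Row v3 v1 v2 v0 v5 v4 v6)) (Leaf (Row v6 v5 v4 v1 v0 v2 v3)))) (Split v3 v6
    (Leaf (Row v2 v0 v5 v1 v6 v4 v3)) (Leaf (Row v3 v4 v0 v6 v2 v5 v1)))) (Split v3 v5 (Split v5 v6
    (Leaf (Row v5 v3 v4 v1 v6 v2 v0)) (Split v3 v6 (Split v4 v6 (Leaf (Row v6 v0 v1 v2 v4 v3 v5))
    (Leaf (Row v3 v2 v0 v5 v4 v6 v1))) (Leaf (Row v0 v1 v4 v5 v3 v6 v2))))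
    (Leaf (Row v3 v1 v5 v0 v6 v4 v2)))) (Split v5 v6 (Leaf (Row v6 v3 v1 v4 v5 v0 v2)) (Split v1 v5
    (Leaf (Row v1 v0 v6 v2 v5 v3 v4)) (Leaf (Row v1 v0 v4 v5 v2 v6 v3))))) (Split v5 v6 (Split v2 v6
    (Leaf (Row v5 v1 v3 v0 v6 v4 v2)) (Split v0 v5 (Split v3 v6 (Leaf (Row v2 v0 v5 v1 v6 v4 v3))
    (Leaf (Row v2 v5 v4 v1 v0 v6 v3))) (Leaf (Row v6 v3 v1 v4 v5 v0 v2)))) (Split v3 v6
    (Leaf (Row v3 v4 v5 v2 v6 v1 v0)) (Leaf (Row v3 v4 v0 v6 v2 v5 v1))))) (Split v0 v5 (Split v2 v6
    (Split v2 v5 (Split v1 v6 (Split v5 v6 (Leaf (Row v5 v0 v4 v1 v6 v2 v3))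
    (Leaf (Row v5 v6 v4 v1 v0 v2 v3))) (Leaf (Row v3 v1 v2 v0 v5 v4 v6))) (Split v1 v6 (Split v3 v5
    (Leaf (Row v1 v3 v5 v4 v6 v0 v2)) (Leaf (Row v5 v1 v2 v3 v6 v0 v4))) (Split v5 v6
    (Leaf (Row v5 v3 v1 v4 v6 v0 v2)) (Leaf (Row v1 v3 v2 v6 v4 v5 v0))))) (Split v5 v6
    (Leaf (Row v2 v0 v6 v1 v5 v4 v3)) (Leaf (Row v4 v3 v0 v5 v1 v6 v2)))) (Split v3 v6 (Split v1 v5
    (Leaf (Row v0 v2 v5 v4 v6 v1 v3)) (Leaf (Row v5 v4 v3 v2 v6 v1 v0)))
    (Leaf (Row v3 v1 v6 v0 v5 v4 v2))))) (Split v2 v5 (Split v3 v6 (Split v1 v5 (Split v0 v5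
    (Split v1 v6 (Split v3 v5 (Split v4 v6 (Leaf (Row v3 v1 v6 v0 v5 v4 v2))
    (Leaf (Row v0 v2 v6 v4 v5 v1 v3))) (Split v5 v6 (Leaf (Row v5 v2 v0 v4 v6 v1 v3))
    (Leaf (Row v1 v2 v4 v0 v5 v6 v3)))) (Split v5 v6 (Leaf (Row v6 v2 v4 v0 v5 v3 v1)) (Split v4 v5
    (Leaf (Row v4 v3 v6 v1 v5 v2 v0)) (Leaf (Row v4 v3 v0 v5 v1 v6 v2))))) (Split v5 v6
    (Leaf (Row v0 v2 v5 v4 v6 v1 v3)) (Leaf (Row v3 v1 v2 v0 v5 v6 v4)))) (Split v0 v5 (Split v1 v6
    (Split v2 v6 (Split v4 v5 (Leaf (Row v2 v0 v5 v1 v6 v4 v3)) (Leaf (Row v0 v2 v6 v4 v5 v1 v3)))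
    (Split v5 v6 (Leaf (Row v0 v2 v6 v4 v5 v1 v3)) (Leaf (Row v1 v0 v4 v5 v2 v6 v3)))) (Split v5 v6
    (Leaf (Row v0 v2 v6 v4 v5 v1 v3)) (Leaf (Row v2 v0 v5 v1 v6 v4 v3)))) (Split v5 v6
    (Leaf (Row v0 v2 v6 v4 v5 v1 v3)) (Split v1 v6 (Leaf (Row v3 v1 v6 v0 v5 v4 v2))
    (Leaf (Row v3 v1 v2 v0 v5 v6 v4)))))) (Split v2 v6 (Split v4 v5
    (Leaf (Row v0 v1 v6 v3 v5 v2 v4)) (Leaf (Row v3 v1 v6 v0 v5 v4 v2)))
    (Leaf (Row v6 v3 v1 v4 v5 v0 v2)))) (Split v1 v6 (Split v5 v6 (Leaf (Row v0 v1 v6 v3 v5 v2 v4))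
    (Leaf (Row v2 v4 v1 v5 v3 v6 v0))) (Split v5 v6 (Leaf (Row v0 v1 v6 v3 v5 v2 v4))
    (Leaf (Row v1 v0 v4 v6 v2 v5 v3))))),
    Split v2 v5 (Split v5 v6 (Split v2 v6 (Split v0 v5 (Split v1 v5 (Split v1 v6 (Split v3 v5
    (Split v4 v5 (Leaf (Row v0 v4 v2 v3 v5 v6 v1)) (Leaf (Row v1 v3 v4 v0 v5 v6 v2)))
    (Leaf (Row v3 v4 v5 v2 v6 v1 v0))) (Leaf (Row v5 v3 v1 v4 v6 v0 v2)))
    (Leaf (Row v3 v1 v2 v0 v6 v4 v5))) (Leaf (Row v5 v3 v4 v1 v6 v2 v0)))
    (Leaf (Row v1 v6 v4 v0 v5 v3 v2))) (Split v1 v6 (Split v0 v6 (Leaf (Row v4 v5 v1 v0 v2 v3 v6))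
    (Split v3 v5 (Leaf (Row v1 v3 v4 v0 v5 v6 v2)) (Leaf (Row v1 v2 v4 v0 v5 v6 v3)))) (Split v0 v6
    (Leaf (Row v0 v2 v4 v1 v5 v6 v3)) (Split v2 v6 (Leaf (Row v1 v3 v0 v6 v4 v5 v2))
    (Leaf (Row v1 v5 v4 v0 v2 v3 v6)))))) (Split v5 v6 (Leaf (Row v1 v5 v4 v0 v6 v3 v2))
    (Split v4 v5 (Split v2 v6 (Leaf (Row v1 v6 v4 v0 v2 v3 v5)) (Leaf (Row v3 v4 v5 v2 v6 v1 v0)))
    (Leaf (Row v2 v0 v3 v5 v6 v4 v1)))),
    Split v4 v5 (Split v5 v6 (Split v1 v6 (Split v2 v6 (Split v3 v6
    (Leaf (Row v0 v2 v4 v1 v6 v5 v3)) (Leaf (Row v0 v1 v6 v3 v5 v2 v4))) (Split v0 v5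
    (Leaf (Row v5 v4 v2 v3 v6 v0 v1)) (Leaf (Row v1 v6 v4 v0 v5 v3 v2))))
    (Leaf (Row v3 v5 v2 v0 v6 v4 v1))) (Split v2 v6 (Leaf (Row v1 v6 v4 v0 v2 v3 v5)) (Split v1 v5
    (Leaf (Row v4 v6 v1 v0 v3 v2 v5)) (Leaf (Row v0 v4 v3 v2 v5 v6 v1))))) (Split v1 v6 (Split v3 v5
    (Leaf (Row v6 v4 v3 v2 v1 v0 v5)) (Leaf (Row v4 v2 v1 v5 v6 v3 v0))) (Split v0 v6
    (Leaf (Row v6 v2 v4 v1 v5 v0 v3)) (Leaf (Row v3 v0 v5 v1 v4 v6 v2)))),
    Split v0 v6 (Split v4 v5 (Split v2 v6 (Split v1 v5 (Split v3 v6
    (Leaf (Row v4 v6 v1 v0 v3 v2 v5)) (Leaf (Row v0 v1 v2 v3 v5 v6 v4))) (Split v3 v6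
    (Leaf (Row v3 v2 v4 v1 v6 v5 v0)) (Leaf (Row v1 v0 v2 v3 v5 v6 v4)))) (Split v3 v6 (Split v1 v5
    (Leaf (Row v0 v1 v3 v2 v5 v6 v4)) (Leaf (Row v1 v0 v3 v2 v5 v6 v4))) (Split v1 v5
    (Leaf (Row v5 v4 v3 v2 v6 v1 v0)) (Leaf (Row v0 v1 v4 v2 v3 v6 v5))))) (Split v1 v5
    (Leaf (Row v6 v4 v3 v2 v1 v0 v5)) (Leaf (Row v3 v5 v2 v0 v6 v4 v1)))) (Split v5 v6
    (Leaf (Row v3 v6 v2 v1 v5 v4 v0)) (Split v2 v5 (Leaf (Row v5 v4 v6 v3 v2 v0 v1))
    (Leaf (Row v0 v1 v3 v2 v6 v5 v4)))),
    Split v4 v6 (Split v2 v5 (Split v3 v5 (Leaf (Row v4 v5 v1 v0 v2 v3 v6))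
    (Leaf (Row v1 v2 v4 v5 v6 v3 v0))) (Split v4 v5 (Leaf (Row v1 v5 v0 v3 v4 v6 v2))
    (Leaf (Row v6 v4 v3 v2 v1 v0 v5)))) (Leaf (Row v5 v4 v2 v3 v0 v1 v6)),
    Split v1 v6 (Split v4 v6 (Split v3 v5 (Split v2 v5 (Leaf (Row v4 v5 v1 v0 v2 v3 v6))
    (Leaf (Row v0 v4 v3 v2 v6 v5 v1))) (Split v2 v5 (Leaf (Row v6 v3 v4 v2 v1 v0 v5))
    (Leaf (Row v6 v0 v5 v2 v1 v3 v4)))) (Split v2 v5 (Leaf (Row v5 v4 v3 v0 v1 v2 v6)) (Split v0 v5
    (Leaf (Row v4 v3 v0 v2 v6 v5 v1)) (Leaf (Row v6 v0 v5 v2 v1 v3 v4))))) (Split v4 v5 (Split v3 v6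
    (Leaf (Row v5 v1 v2 v0 v3 v4 v6)) (Leaf (Row v5 v0 v6 v3 v4 v1 v2))) (Split v0 v5
    (Leaf (Row v5 v2 v1 v4 v6 v0 v3)) (Leaf (Row v0 v2 v5 v1 v4 v6 v3)))),
    Split v3 v6 (Split v4 v5 (Leaf (Row v4 v6 v1 v0 v3 v2 v5)) (Leaf (Row v6 v4 v3 v2 v1 v0 v5)))
    (Leaf (Row v5 v3 v4 v1 v2 v0 v6)),
    Split v0 v5 (Leaf (Row v0 v6 v4 v2 v3 v1 v5)) (Leaf (Row v6 v0 v1 v2 v4 v3 v5))]"]) code_simp

text \<open>Below each type on four vertices all sixteen ways of joining \<open>v4\<close> to the
  rest are enumerated, and each is carried to its representative on five vertices. The relabellings
  fix \<open>v5\<close> and \<open>v6\<close>, about which nothing is known yet.\<close>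

lemma settled_graphs4: "settled_all graphs4"
  by (rule settled_all_if_check[OF settled_graphs5, of _ "[
    Split v0 v4 (Split v1 v4 (Split v2 v4 (Split v3 v4 (Ref (Row v0 v1 v2 v3 v4 v5 v6))
    (Ref (Row v4 v3 v0 v1 v2 v5 v6))) (Split v3 v4 (Ref (Row v2 v4 v0 v1 v3 v5 v6))
    (Ref (Row v4 v3 v2 v0 v1 v5 v6)))) (Split v2 v4 (Split v3 v4 (Ref (Row v4 v1 v0 v2 v3 v5 v6))
    (Ref (Row v4 v1 v3 v0 v2 v5 v6))) (Split v3 v4 (Ref (Row v4 v1 v2 v0 v3 v5 v6))
    (Ref (Row v4 v1 v2 v3 v0 v5 v6))))) (Split v1 v4 (Split v2 v4 (Split v3 v4
    (Ref (Row v0 v4 v1 v2 v3 v5 v6)) (Ref (Row v4 v0 v3 v1 v2 v5 v6))) (Split v3 v4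
    (Ref (Row v4 v0 v2 v1 v3 v5 v6)) (Ref (Row v4 v0 v2 v3 v1 v5 v6)))) (Split v2 v4 (Split v3 v4
    (Ref (Row v4 v0 v1 v2 v3 v5 v6)) (Ref (Row v4 v0 v1 v3 v2 v5 v6))) (Split v3 v4
    (Ref (Row v4 v0 v1 v2 v3 v5 v6)) (Ref (Row v4 v0 v1 v2 v3 v5 v6))))),
    Split v0 v4 (Split v1 v4 (Split v2 v4 (Split v3 v4 (Ref (Row v0 v1 v2 v3 v4 v5 v6))
    (Ref (Row v0 v3 v4 v1 v2 v5 v6))) (Split v3 v4 (Ref (Row v0 v4 v2 v1 v3 v5 v6))
    (Ref (Row v4 v0 v1 v2 v3 v5 v6)))) (Split v2 v4 (Split v3 v4 (Ref (Row v1 v0 v4 v2 v3 v5 v6))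
    (Ref (Row v4 v1 v0 v3 v2 v5 v6))) (Split v3 v4 (Ref (Row v4 v1 v0 v2 v3 v5 v6))
    (Ref (Row v4 v1 v0 v2 v3 v5 v6))))) (Split v1 v4 (Split v2 v4 (Split v3 v4
    (Ref (Row v0 v1 v4 v2 v3 v5 v6)) (Ref (Row v0 v4 v3 v1 v2 v5 v6))) (Split v3 v4
    (Ref (Row v0 v4 v2 v1 v3 v5 v6)) (Ref (Row v4 v0 v1 v2 v3 v5 v6)))) (Split v2 v4 (Split v3 v4
    (Ref (Row v0 v1 v4 v2 v3 v5 v6)) (Ref (Row v4 v0 v1 v3 v2 v5 v6))) (Split v3 v4
    (Ref (Row v4 v0 v1 v2 v3 v5 v6)) (Ref (Row v4 v0 v1 v2 v3 v5 v6))))),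
    Split v0 v4 (Split v1 v4 (Split v2 v4 (Split v3 v4 (Ref (Row v0 v1 v2 v3 v4 v5 v6))
    (Ref (Row v0 v3 v4 v1 v2 v5 v6))) (Split v3 v4 (Ref (Row v0 v2 v4 v1 v3 v5 v6))
    (Ref (Row v0 v4 v2 v3 v1 v5 v6)))) (Split v2 v4 (Split v3 v4 (Ref (Row v0 v1 v4 v2 v3 v5 v6))
    (Ref (Row v0 v4 v1 v3 v2 v5 v6))) (Split v3 v4 (Ref (Row v0 v4 v1 v2 v3 v5 v6))
    (Ref (Row v4 v0 v1 v2 v3 v5 v6))))) (Split v1 v4 (Split v2 v4 (Split v3 v4
    (Ref (Row v0 v1 v2 v4 v3 v5 v6)) (Ref (Row v0 v4 v3 v1 v2 v5 v6))) (Split v3 v4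
    (Ref (Row v0 v4 v2 v1 v3 v5 v6)) (Ref (Row v0 v4 v2 v3 v1 v5 v6)))) (Split v2 v4 (Split v3 v4
    (Ref (Row v0 v1 v4 v2 v3 v5 v6)) (Ref (Row v0 v4 v1 v3 v2 v5 v6))) (Split v3 v4
    (Ref (Row v0 v4 v1 v2 v3 v5 v6)) (Ref (Row v4 v0 v1 v2 v3 v5 v6))))),
    Split v0 v4 (Split v1 v4 (Split v2 v4 (Split v3 v4 (Ref (Row v0 v1 v2 v3 v4 v5 v6))
    (Ref (Row v0 v3 v4 v1 v2 v5 v6))) (Split v3 v4 (Ref (Row v0 v2 v4 v1 v3 v5 v6))
    (Ref (Row v0 v4 v2 v3 v1 v5 v6)))) (Split v2 v4 (Split v3 v4 (Ref (Row v0 v1 v4 v2 v3 v5 v6))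
    (Ref (Row v0 v4 v1 v3 v2 v5 v6))) (Split v3 v4 (Ref (Row v0 v4 v1 v2 v3 v5 v6))
    (Ref (Row v0 v4 v1 v2 v3 v5 v6))))) (Split v1 v4 (Split v2 v4 (Split v3 v4
    (Ref (Row v0 v1 v2 v3 v4 v5 v6)) (Ref (Row v0 v3 v4 v1 v2 v5 v6))) (Split v3 v4
    (Ref (Row v0 v4 v2 v1 v3 v5 v6)) (Ref (Row v0 v4 v2 v3 v1 v5 v6)))) (Split v2 v4 (Split v3 v4
    (Ref (Row v0 v1 v4 v2 v3 v5 v6)) (Ref (Row v0 v4 v1 v3 v2 v5 v6))) (Split v3 v4
    (Ref (Row v0 v4 v1 v2 v3 v5 v6)) (Ref (Row v0 v4 v1 v2 v3 v5 v6))))),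
    Split v0 v4 (Split v1 v4 (Split v2 v4 (Split v3 v4 (Ref (Row v0 v1 v2 v3 v4 v5 v6))
    (Ref (Row v3 v0 v1 v2 v4 v5 v6))) (Split v3 v4 (Ref (Row v2 v0 v1 v4 v3 v5 v6))
    (Ref (Row v4 v2 v0 v1 v3 v5 v6)))) (Split v2 v4 (Split v3 v4 (Ref (Row v1 v0 v2 v4 v3 v5 v6))
    (Ref (Row v4 v1 v0 v2 v3 v5 v6))) (Split v3 v4 (Ref (Row v2 v1 v0 v4 v3 v5 v6))
    (Ref (Row v4 v1 v2 v0 v3 v5 v6))))) (Split v1 v4 (Split v2 v4 (Split v3 v4
    (Ref (Row v0 v1 v2 v4 v3 v5 v6)) (Ref (Row v4 v0 v1 v2 v3 v5 v6))) (Split v3 v4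
    (Ref (Row v0 v2 v1 v4 v3 v5 v6)) (Ref (Row v4 v0 v2 v1 v3 v5 v6)))) (Split v2 v4 (Split v3 v4
    (Ref (Row v0 v1 v2 v4 v3 v5 v6)) (Ref (Row v4 v0 v1 v2 v3 v5 v6))) (Split v3 v4
    (Ref (Row v0 v1 v2 v4 v3 v5 v6)) (Ref (Row v4 v0 v1 v2 v3 v5 v6))))),
    Split v0 v4 (Split v1 v4 (Split v2 v4 (Split v3 v4 (Ref (Row v0 v1 v2 v3 v4 v5 v6))
    (Ref (Row v3 v1 v2 v0 v4 v5 v6))) (Split v3 v4 (Ref (Row v2 v0 v3 v1 v4 v5 v6))
    (Ref (Row v2 v3 v4 v0 v1 v5 v6)))) (Split v2 v4 (Split v3 v4 (Ref (Row v1 v0 v3 v2 v4 v5 v6))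
    (Ref (Row v1 v3 v4 v0 v2 v5 v6))) (Split v3 v4 (Ref (Row v0 v1 v2 v4 v3 v5 v6))
    (Ref (Row v3 v4 v1 v2 v0 v5 v6))))) (Split v1 v4 (Split v2 v4 (Split v3 v4
    (Ref (Row v0 v1 v2 v3 v4 v5 v6)) (Ref (Row v1 v0 v4 v3 v2 v5 v6))) (Split v3 v4
    (Ref (Row v0 v2 v4 v1 v3 v5 v6)) (Ref (Row v2 v4 v0 v3 v1 v5 v6)))) (Split v2 v4 (Split v3 v4
    (Ref (Row v0 v1 v4 v2 v3 v5 v6)) (Ref (Row v1 v4 v0 v3 v2 v5 v6))) (Split v3 v4
    (Ref (Row v0 v4 v1 v2 v3 v5 v6)) (Ref (Row v4 v0 v1 v2 v3 v5 v6))))),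
    Split v0 v4 (Split v1 v4 (Split v2 v4 (Split v3 v4 (Ref (Row v0 v1 v2 v3 v4 v5 v6))
    (Ref (Row v3 v1 v0 v2 v4 v5 v6))) (Split v3 v4 (Ref (Row v0 v2 v1 v4 v3 v5 v6))
    (Ref (Row v0 v4 v2 v1 v3 v5 v6)))) (Split v2 v4 (Split v3 v4 (Ref (Row v1 v0 v3 v2 v4 v5 v6))
    (Ref (Row v1 v3 v0 v4 v2 v5 v6))) (Split v3 v4 (Ref (Row v0 v1 v2 v4 v3 v5 v6))
    (Ref (Row v4 v1 v0 v3 v2 v5 v6))))) (Split v1 v4 (Split v2 v4 (Split v3 v4
    (Ref (Row v0 v1 v2 v3 v4 v5 v6)) (Ref (Row v1 v0 v4 v3 v2 v5 v6))) (Split v3 v4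
    (Ref (Row v0 v2 v1 v4 v3 v5 v6)) (Ref (Row v0 v4 v2 v1 v3 v5 v6)))) (Split v2 v4 (Split v3 v4
    (Ref (Row v0 v1 v4 v2 v3 v5 v6)) (Ref (Row v1 v0 v4 v3 v2 v5 v6))) (Split v3 v4
    (Ref (Row v0 v1 v4 v2 v3 v5 v6)) (Ref (Row v4 v0 v1 v2 v3 v5 v6))))),
    Split v0 v4 (Split v1 v4 (Split v2 v4 (Split v3 v4 (Ref (Row v0 v1 v2 v3 v4 v5 v6))
    (Ref (Row v3 v0 v1 v2 v4 v5 v6))) (Split v3 v4 (Ref (Row v0 v2 v1 v4 v3 v5 v6))
    (Ref (Row v0 v2 v4 v3 v1 v5 v6)))) (Split v2 v4 (Split v3 v4 (Ref (Row v0 v1 v2 v4 v3 v5 v6))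
    (Ref (Row v0 v1 v4 v3 v2 v5 v6))) (Split v3 v4 (Ref (Row v0 v1 v2 v4 v3 v5 v6))
    (Ref (Row v0 v4 v1 v2 v3 v5 v6))))) (Split v1 v4 (Split v2 v4 (Split v3 v4
    (Ref (Row v0 v1 v2 v3 v4 v5 v6)) (Ref (Row v0 v1 v4 v3 v2 v5 v6))) (Split v3 v4
    (Ref (Row v0 v2 v1 v4 v3 v5 v6)) (Ref (Row v0 v4 v2 v1 v3 v5 v6)))) (Split v2 v4 (Split v3 v4
    (Ref (Row v0 v1 v2 v4 v3 v5 v6)) (Ref (Row v0 v1 v4 v3 v2 v5 v6))) (Split v3 v4
    (Ref (Row v0 v1 v2 v4 v3 v5 v6)) (Ref (Row v0 v4 v1 v2 v3 v5 v6))))),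
    Split v0 v4 (Split v1 v4 (Split v2 v4 (Split v3 v4 (Ref (Row v0 v1 v2 v3 v4 v5 v6))
    (Ref (Row v3 v2 v0 v1 v4 v5 v6))) (Split v3 v4 (Ref (Row v2 v3 v0 v1 v4 v5 v6))
    (Ref (Row v2 v3 v0 v1 v4 v5 v6)))) (Split v2 v4 (Split v3 v4 (Ref (Row v1 v0 v2 v3 v4 v5 v6))
    (Ref (Row v1 v3 v0 v2 v4 v5 v6))) (Split v3 v4 (Ref (Row v1 v2 v0 v3 v4 v5 v6))
    (Ref (Row v3 v2 v1 v4 v0 v5 v6))))) (Split v1 v4 (Split v2 v4 (Split v3 v4
    (Ref (Row v0 v1 v2 v3 v4 v5 v6)) (Ref (Row v0 v3 v1 v2 v4 v5 v6))) (Split v3 v4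
    (Ref (Row v0 v2 v1 v3 v4 v5 v6)) (Ref (Row v2 v3 v0 v4 v1 v5 v6)))) (Split v2 v4 (Split v3 v4
    (Ref (Row v0 v1 v2 v3 v4 v5 v6)) (Ref (Row v0 v1 v4 v3 v2 v5 v6))) (Split v3 v4
    (Ref (Row v0 v1 v2 v4 v3 v5 v6)) (Ref (Row v4 v0 v1 v2 v3 v5 v6))))),
    Split v0 v4 (Split v1 v4 (Split v2 v4 (Split v3 v4 (Ref (Row v0 v1 v2 v3 v4 v5 v6))
    (Ref (Row v3 v0 v1 v2 v4 v5 v6))) (Split v3 v4 (Ref (Row v2 v0 v1 v3 v4 v5 v6))
    (Ref (Row v2 v3 v0 v1 v4 v5 v6)))) (Split v2 v4 (Split v3 v4 (Ref (Row v1 v0 v2 v3 v4 v5 v6))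
    (Ref (Row v1 v0 v3 v4 v2 v5 v6))) (Split v3 v4 (Ref (Row v1 v0 v2 v4 v3 v5 v6))
    (Ref (Row v1 v0 v4 v2 v3 v5 v6))))) (Split v1 v4 (Split v2 v4 (Split v3 v4
    (Ref (Row v0 v1 v2 v3 v4 v5 v6)) (Ref (Row v0 v1 v3 v4 v2 v5 v6))) (Split v3 v4
    (Ref (Row v0 v1 v2 v4 v3 v5 v6)) (Ref (Row v0 v1 v4 v2 v3 v5 v6)))) (Split v2 v4 (Split v3 v4
    (Ref (Row v0 v1 v2 v3 v4 v5 v6)) (Ref (Row v0 v1 v4 v3 v2 v5 v6))) (Split v3 v4
    (Ref (Row v0 v1 v2 v4 v3 v5 v6)) (Ref (Row v0 v1 v4 v2 v3 v5 v6))))),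
    Split v0 v4 (Split v1 v4 (Split v2 v4 (Split v3 v4 (Ref (Row v0 v1 v2 v3 v4 v5 v6))
    (Ref (Row v3 v0 v1 v2 v4 v5 v6))) (Split v3 v4 (Ref (Row v2 v0 v1 v3 v4 v5 v6))
    (Ref (Row v2 v3 v0 v1 v4 v5 v6)))) (Split v2 v4 (Split v3 v4 (Ref (Row v1 v0 v2 v3 v4 v5 v6))
    (Ref (Row v3 v1 v0 v2 v4 v5 v6))) (Split v3 v4 (Ref (Row v2 v1 v0 v3 v4 v5 v6))
    (Ref (Row v3 v1 v2 v0 v4 v5 v6))))) (Split v1 v4 (Split v2 v4 (Split v3 v4
    (Ref (Row v0 v1 v2 v3 v4 v5 v6)) (Ref (Row v0 v3 v1 v2 v4 v5 v6))) (Split v3 v4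
    (Ref (Row v0 v2 v1 v3 v4 v5 v6)) (Ref (Row v0 v3 v2 v1 v4 v5 v6)))) (Split v2 v4 (Split v3 v4
    (Ref (Row v0 v1 v2 v3 v4 v5 v6)) (Ref (Row v0 v1 v3 v2 v4 v5 v6))) (Split v3 v4
    (Ref (Row v0 v1 v2 v3 v4 v5 v6)) (Ref (Row v0 v1 v2 v3 v4 v5 v6)))))]"]) code_simp

text \<open>The same step one vertex lower, with the eight ways of attaching
  \<open>v3\<close>.\<close>

lemma settled_graphs3: "settled_all graphs3"
  by (rule settled_all_if_check[OF settled_graphs4, of _ "[
    Split v0 v3 (Split v1 v3 (Split v2 v3 (Ref (Row v0 v1 v2 v3 v4 v5 v6))
    (Ref (Row v2 v3 v0 v1 v4 v5 v6))) (Split v2 v3 (Ref (Row v3 v1 v0 v2 v4 v5 v6))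
    (Ref (Row v3 v1 v2 v0 v4 v5 v6)))) (Split v1 v3 (Split v2 v3 (Ref (Row v0 v3 v1 v2 v4 v5 v6))
    (Ref (Row v3 v0 v2 v1 v4 v5 v6))) (Split v2 v3 (Ref (Row v3 v0 v1 v2 v4 v5 v6))
    (Ref (Row v3 v0 v1 v2 v4 v5 v6)))),
    Split v0 v3 (Split v1 v3 (Split v2 v3 (Ref (Row v0 v1 v2 v3 v4 v5 v6))
    (Ref (Row v0 v3 v2 v1 v4 v5 v6))) (Split v2 v3 (Ref (Row v1 v0 v3 v2 v4 v5 v6))
    (Ref (Row v3 v1 v0 v2 v4 v5 v6)))) (Split v1 v3 (Split v2 v3 (Ref (Row v0 v1 v3 v2 v4 v5 v6))
    (Ref (Row v0 v3 v2 v1 v4 v5 v6))) (Split v2 v3 (Ref (Row v0 v1 v3 v2 v4 v5 v6))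
    (Ref (Row v3 v0 v1 v2 v4 v5 v6)))),
    Split v0 v3 (Split v1 v3 (Split v2 v3 (Ref (Row v0 v1 v2 v3 v4 v5 v6))
    (Ref (Row v0 v2 v3 v1 v4 v5 v6))) (Split v2 v3 (Ref (Row v0 v1 v3 v2 v4 v5 v6))
    (Ref (Row v0 v3 v1 v2 v4 v5 v6)))) (Split v1 v3 (Split v2 v3 (Ref (Row v0 v1 v2 v3 v4 v5 v6))
    (Ref (Row v0 v3 v2 v1 v4 v5 v6))) (Split v2 v3 (Ref (Row v0 v1 v3 v2 v4 v5 v6))
    (Ref (Row v0 v3 v1 v2 v4 v5 v6)))),
    Split v0 v3 (Split v1 v3 (Split v2 v3 (Ref (Row v0 v1 v2 v3 v4 v5 v6))
    (Ref (Row v2 v0 v1 v3 v4 v5 v6))) (Split v2 v3 (Ref (Row v1 v0 v2 v3 v4 v5 v6))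
    (Ref (Row v2 v1 v0 v3 v4 v5 v6)))) (Split v1 v3 (Split v2 v3 (Ref (Row v0 v1 v2 v3 v4 v5 v6))
    (Ref (Row v0 v2 v1 v3 v4 v5 v6))) (Split v2 v3 (Ref (Row v0 v1 v2 v3 v4 v5 v6))
    (Ref (Row v0 v1 v2 v3 v4 v5 v6))))]"]) code_simp

text \<open>The eight labelled graphs on the first three vertices fall into four isomorphism types;
  this is the root of the case analysis.\<close>

lemma settled_empty: "settled (partial_graph pairs [])"
proof -
  have "settled_all [[]]"
    by (rule settled_all_if_check[OF settled_graphs3, of _ "[
    Split v0 v1 (Split v0 v2 (Split v1 v2 (Ref (Row v0 v1 v2 v3 v4 v5 v6))
    (Ref (Row v2 v1 v0 v3 v4 v5 v6))) (Split v1 v2 (Ref (Row v0 v2 v1 v3 v4 v5 v6))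
    (Ref (Row v2 v0 v1 v3 v4 v5 v6)))) (Split v0 v2 (Split v1 v2 (Ref (Row v0 v1 v2 v3 v4 v5 v6))
    (Ref (Row v1 v0 v2 v3 v4 v5 v6))) (Split v1 v2 (Ref (Row v0 v1 v2 v3 v4 v5 v6))
    (Ref (Row v0 v1 v2 v3 v4 v5 v6))))]"]) code_simp
  then show ?thesis by (simp add: settled_all_def)
qed

subsection \<open>The configuration\<close>

text \<open>The points of \<open>xc\<close> and \<open>yc\<close> are numbered from left to right.
  The convex hull is the hexagon \<open>v0 v1 v6 v5 v3 v2\<close>, whose six sides are the pairs
  with an empty list in \<open>blockers\<close>; \<open>v4\<close> lies just inside the side
  \<open>v3 v5\<close>. Even abscissas leave the odd lines to the spikes. Many of these lines pass
  right beside a point, where the segments leaving it are ordered by slope.\<close>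

fun xc :: "vert \<Rightarrow> int" where
  "xc v0 = 20" | "xc v1 = 40" | "xc v2 = 180" | "xc v3 = 200" | "xc v4 = 220" | "xc v5 = 260" | "xc v6 = 380"

fun yc :: "vert \<Rightarrow> int" where
  "yc v0 = 4" | "yc v1 = 8" | "yc v2 = -14" | "yc v3 = -16" | "yc v4 = -14" | "yc v5 = -12" | "yc v6 = 8"

definition loc :: "vert \<Rightarrow> point" where
  "loc v = pt (of_int (xc v)) (of_int (yc v))"

lemma xc_inject: "xc u = xc v \<longleftrightarrow> u = v"
  by (cases u; cases v; simp)

lemma xc_even: "even (xc v)" and xc_bounds: "0 < xc v" "xc v < 400" and yc_bounds: "-16 \<le> yc v" "yc v \<le> 16"
  by (cases v; simp)+

lemma inj_loc: "inj loc"
  by (auto intro!: injI simp: loc_def pt_eq_iff xc_inject)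

section \<open>General position\<close>

lemma cross_if_collinear:
  fixes p q r :: point
  assumes "collinear {p, q, r}"
  shows "(p $ 1 - q $ 1) * (r $ 2 - q $ 2) = (p $ 2 - q $ 2) * (r $ 1 - q $ 1)"
proof -
  have "collinear {0, p - q, r - q}" using assms by (simp add: collinear_3)
  then consider "p - q = 0" | "r - q = 0" | c where "r - q = c *\<^sub>R (p - q)"
    unfolding collinear_lemma by blast
  then show ?thesis
    by cases (auto simp: point_eq_iff)
qed

text \<open>The nonvanishing of the integer determinants that detect collinearity, verified for all
  triples of distinct vertices.\<close>

lemma cross_neq:
  "u \<noteq> v \<Longrightarrow> v \<noteq> w \<Longrightarrow> u \<noteq> w \<Longrightarrow>
    (xc u - xc v) * (yc w - yc v) \<noteq> (yc u - yc v) * (xc w - xc v)"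
  by (cases u; cases v; cases w; simp)

lemma general_position_loc: "general_position (loc ` S)"
  unfolding general_position_def
proof (intro ballI impI notI)
  fix p q r
  assume "p \<in> loc ` S" "q \<in> loc ` S" "r \<in> loc ` S" and neq: "p \<noteq> q \<and> q \<noteq> r \<and> p \<noteq> r"
    and coll: "collinear {p, q, r}"
  then obtain u v w where loc: "p = loc u" "q = loc v" "r = loc w" by blast
  have "real_of_int ((xc u - xc v) * (yc w - yc v)) = of_int ((yc u - yc v) * (xc w - xc v))"
    using cross_if_collinear[OF coll] unfolding loc by (simp add: loc_def)
  then have "(xc u - xc v) * (yc w - yc v) = (yc u - yc v) * (xc w - xc v)"
    by (simp only: of_int_eq_iff)
  moreover have "u \<noteq> v" "v \<noteq> w" "u \<noteq> w" using neq unfolding loc by auto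
  ultimately show False using cross_neq by blast
qed

section \<open>Heights of segments over vertical lines\<close>

definition height :: "vert \<Rightarrow> vert \<Rightarrow> real \<Rightarrow> real" where
  "height u v x = of_int (yc u) + (x - of_int (xc u)) * of_int (yc v - yc u) / of_int (xc v - xc u)"

text \<open>The numerator of \<open>height u v i\<close> over the denominator
  \<open>xc v - xc u\<close>. It is an integer, so heights at integer abscissas can be compared by
  cross multiplication.\<close>

definition rise :: "vert \<Rightarrow> vert \<Rightarrow> int \<Rightarrow> int" where
  "rise u v i = yc u * (xc v - xc u) + (i - xc u) * (yc v - yc u)"

definition spans :: "vert \<Rightarrow> vert \<Rightarrow> int \<Rightarrow> bool" where
  "spans u v i \<longleftrightarrow> min (xc u) (xc v) < i \<and> i < max (xc u) (xc v)"

lemma height_rise: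
  assumes "u \<noteq> v"
  shows "height u v (of_int i) = of_int (rise u v i) / of_int (xc v - xc u)"
proof -
  have *: "a + b * c / d = (a * d + b * c) / d" if "d \<noteq> 0" for a b c d :: real
    using that by (simp add: add_divide_distrib)
  have "real_of_int (xc v - xc u) \<noteq> 0" using assms xc_inject[of v u] by simp
  from *[OF this] show ?thesis
    unfolding height_def rise_def of_int_add of_int_mult of_int_diff[of i] by simp
qed

lemma spans_commute: "spans u v i = spans v u i"
  by (simp add: spans_def min.commute max.commute)

lemma spans_neq: "spans u v i \<Longrightarrow> u \<noteq> v"
  by (auto simp: spans_def)

lemma height_commute: "u \<noteq> v \<Longrightarrow> height u v x = height v u x"
proof -
  have *: "y + (x - a) * (w - y) / (b - a) = w + (x - b) * (y - w) / (a - b)"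
    if "a \<noteq> b" for a b x y w :: real
  proof -
    have "(x - b) * (y - w) / (a - b) = (x - b) * (w - y) / (b - a)"
      using minus_divide_divide[of "(x - b) * (y - w)" "a - b"] by (simp add: algebra_simps)
    moreover have "(x - a) * (w - y) = (x - b) * (w - y) + (b - a) * (w - y)"
      by (simp add: algebra_simps)
    then have "(x - a) * (w - y) / (b - a) = (x - b) * (w - y) / (b - a) + (w - y)"
      by (simp only: add_divide_distrib) (use that in simp)
    ultimately show ?thesis by simp
  qed
  assume "u \<noteq> v"
  then have "real_of_int (xc u) \<noteq> of_int (xc v)" using xc_inject[of u v] by simp
  from *[OF this] show ?thesis unfolding height_def of_int_diff by simp
qed

text \<open>Brought into the form of \<open>interp_segment\<close>, so that a segment and the
  boundary can be compared on a unit interval through its two ends.\<close>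

lemma height_affine: "height u v (x + t) = (1 - t) * height u v x + t * height u v (x + 1)"
proof -
  have "y + (x + t - a) * s / d = (1 - t) * (y + (x - a) * s / d) + t * (y + (x + 1 - a) * s / d)"
    for a y s d :: real
    by (simp add: add_divide_distrib diff_divide_distrib algebra_simps)
  then show ?thesis unfolding height_def .
qed

lemma closed_segment_loc:
  assumes "xc u < xc v"
  shows "closed_segment (loc u) (loc v) =
    {p. of_int (xc u) \<le> p $ 1 \<and> p $ 1 \<le> of_int (xc v) \<and> p $ 2 = height u v (p $ 1)}" (is "_ = ?R")
proof (intro equalityI subsetI)
  have pos: "0 < real_of_int (xc v) - of_int (xc u)" using assms by simp
  {
    fix p assume "p \<in> closed_segment (loc u) (loc v)"
    then obtain t where t: "0 \<le> t" "t \<le> 1" "p = (1 - t) *\<^sub>R loc u + t *\<^sub>R loc v"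
      by (auto simp: in_segment)
    then have p: "p $ 1 = of_int (xc u) + t * (of_int (xc v) - of_int (xc u))"
        "p $ 2 = of_int (yc u) + t * (of_int (yc v) - of_int (yc u))"
      unfolding t(3) loc_def by (simp_all add: algebra_simps)
    have "p $ 2 = height u v (p $ 1)" using pos unfolding p height_def by simp
    moreover have "0 \<le> t * (real_of_int (xc v) - of_int (xc u))"
      "t * (real_of_int (xc v) - of_int (xc u)) \<le> 1 * (real_of_int (xc v) - of_int (xc u))"
      using pos t by (auto intro: mult_right_mono)
    ultimately show "p \<in> ?R" using p(1) by simp
  next
    fix p assume p: "p \<in> ?R"
    define t where "t = (p $ 1 - of_int (xc u)) / (of_int (xc v) - of_int (xc u))"
    have t: "0 \<le> t" "t \<le> 1" "t * (of_int (xc v) - of_int (xc u)) = p $ 1 - of_int (xc u)"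
      using p pos by (auto simp: t_def divide_simps)
    have "p $ 2 = of_int (yc u) + t * (of_int (yc v) - of_int (yc u))"
      using p by (simp add: t_def height_def)
    then have "p = (1 - t) *\<^sub>R loc u + t *\<^sub>R loc v"
      using t(3) by (simp add: point_eq_iff loc_def algebra_simps)
    then show "p \<in> closed_segment (loc u) (loc v)" using t by (auto simp: in_segment)
  }
qed

text \<open>The link between the table and the points. The bound 1 is the least depth of a spike
  tip, so a segment beyond it can be reached; the last conclusion says that only the segments of
  \<open>m\<close> can lie as far out as \<open>uv\<close> on the chosen side.\<close>

lemma blockers_correct:
  assumes "((u, v), ws) \<in> set blockers" "(i, s, m) \<in> set ws"
  shows "0 < i" "i < 400" "odd i" "xc u < i" "i < xc v" "s = 1 \<or> s = - 1"
    "1 < of_int s * height u v (of_int i)"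
    "\<lbrakk>spans u' v' i; {u', v'} \<noteq> {u, v}; (u', v') \<notin> set m; (v', u') \<notin> set m\<rbrakk> \<Longrightarrow>
      of_int s * height u' v' (of_int i) < of_int s * height u v (of_int i)"
proof -
  \<comment> \<open>All claims as integer inequalities with denominators cleared. These are positive
    because the pairs are listed from left to right.\<close>
  have "\<forall>((u, v), ws) \<in> set blockers. \<forall>(i, s, m) \<in> set ws.
      0 < i \<and> i < 400 \<and> i mod 2 = 1 \<and> xc u < i \<and> i < xc v \<and> (s = 1 \<or> s = - 1) \<and> xc v - xc u < s * rise u v i \<and>
      (\<forall>(u', v') \<in> set pairs. xc u' < i \<longrightarrow> i < xc v' \<longrightarrow> (u', v') \<noteq> (u, v) \<longrightarrow> (u', v') \<notin> set m \<longrightarrow>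
        s * rise u' v' i * (xc v - xc u) < s * rise u v i * (xc v' - xc u'))"
    by code_simp
  then have *: "0 < i \<and> i < 400 \<and> i mod 2 = 1 \<and> xc u < i \<and> i < xc v \<and> (s = 1 \<or> s = - 1) \<and>
      xc v - xc u < s * rise u v i"
    and **: "\<And>u' v'. (u', v') \<in> set pairs \<Longrightarrow> xc u' < i \<Longrightarrow> i < xc v' \<Longrightarrow> (u', v') \<noteq> (u, v) \<Longrightarrow>
      (u', v') \<notin> set m \<Longrightarrow> s * rise u' v' i * (xc v - xc u) < s * rise u v i * (xc v' - xc u')"
    using assms by fast+
  show "0 < i" "i < 400" "odd i" "xc u < i" "i < xc v" "s = 1 \<or> s = - 1"
    using * by (auto simp: odd_iff_mod_2_eq_one)
  have uv: "u \<noteq> v" using * by auto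
  have den: "0 < real_of_int (xc v - xc u)" using * by simp
  have "real_of_int (xc v - xc u) < of_int (s * rise u v i)" using * by (simp only: of_int_less_iff)
  then show "1 < of_int s * height u v (of_int i)"
    using den by (simp add: height_rise[OF uv] divide_simps)
  have ordered: "of_int s * height u' v' (of_int i) < of_int s * height u v (of_int i)"
    if "spans u' v' i" "(u', v') \<noteq> (u, v)" "(u', v') \<notin> set m" "(u', v') \<in> set pairs" for u' v'
  proof -
    have "\<forall>(u, v) \<in> set pairs. xc u < xc v" by code_simp
    then have lt: "xc u' < xc v'" using that by blast
    then have "xc u' < i" "i < xc v'" "u' \<noteq> v'" using that by (auto simp: spans_def)
    have "real_of_int (s * rise u' v' i * (xc v - xc u)) < of_int (s * rise u v i * (xc v' - xc u'))"
      unfolding of_int_less_iff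
      using ** \<open>xc u' < i\<close> \<open>i < xc v'\<close> that by blast
    moreover have "0 < real_of_int (xc v' - xc u')" using lt by simp
    ultimately show ?thesis
      using den by (simp add: height_rise[OF uv] height_rise[OF \<open>u' \<noteq> v'\<close>] divide_simps ac_simps)
  qed
  show "of_int s * height u' v' (of_int i) < of_int s * height u v (of_int i)"
    if "spans u' v' i" "{u', v'} \<noteq> {u, v}" "(u', v') \<notin> set m" "(v', u') \<notin> set m"
  proof -
    have "u' \<noteq> v'" using that spans_neq by blast
    \<comment> \<open>Only one orientation of each pair was evaluated; the other follows as
      \<open>height\<close> and \<open>spans\<close> are symmetric.\<close>
    then have "(u', v') \<in> set pairs \<or> (v', u') \<in> set pairs"
      by (cases u'; cases v'; simp add: pairs_def)
    then show ?thesis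
      using ordered[of u' v'] ordered[of v' u'] that height_commute[OF \<open>u' \<noteq> v'\<close>]
      by (auto simp: spans_commute[of v' u'])
  qed
qed

lemma blockers_complete:
  assumes "u \<noteq> v"
  obtains ws where "((u, v), ws) \<in> set blockers" | ws where "((v, u), ws) \<in> set blockers"
proof -
  have "\<forall>u \<in> set verts. \<forall>v \<in> set verts. u = v \<or> (u, v) \<in> set (map fst blockers) \<or> (v, u) \<in> set (map fst blockers)"
    by code_simp
  then have "(u, v) \<in> set (map fst blockers) \<or> (v, u) \<in> set (map fst blockers)"
    using assms unfolding set_verts by blast
  then show ?thesis using that by auto
qed

text \<open>The points have even abscissas, so between consecutive integers every segment is either absent
  or affine, and it suffices to compare it with the boundary at integers: at even ones the boundary
  lies beyond all points, at odd ones it is the tip of a spike.\<close>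

definition depth :: "(vert \<Rightarrow> vert \<Rightarrow> bool) \<Rightarrow> int \<Rightarrow> nat \<Rightarrow> real" where
  "depth N s i = (if i = 0 then 0 else if even i then 17 else
     Max (insert 1 ((\<lambda>(u, v). of_int s * height u v (real i)) ` {(u, v). \<not> N u v \<and> spans u v (int i)})))"

lemma finite_vert: "finite (A :: vert set)"
proof (rule finite_subset)
  show "A \<subseteq> set verts" by simp
qed (rule finite_set)

lemma finite_depth: "finite ((\<lambda>(u, v). of_int s * height u v (real i)) ` {(u, v). \<not> N u v \<and> spans u v (int i)})"
proof (intro finite_imageI)
  have "finite (UNIV \<times> UNIV :: (vert \<times> vert) set)"
    by (intro finite_cartesian_product finite_vert)
  then show "finite {(u, v). \<not> N u v \<and> spans u v (int i)}"
    using finite_subset[OF subset_UNIV] by simp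
qed

text \<open>The 1 inserted into the maximum keeps the spikes on their own side of the x axis even
  where no edge passes, and also makes the maximum well defined. Without a positive depth the upper
  and lower curves could touch.\<close>

lemma depth_pos: "0 < i \<Longrightarrow> 0 < depth N s i"
  by (auto simp: depth_def less_le_trans[OF zero_less_one] finite_depth)

lemma height_between:
  assumes "xc u \<le> i" "i \<le> xc v" "xc u < xc v"
  shows "-16 \<le> height u v (of_int i)" "height u v (of_int i) \<le> 16"
proof -
  define t where "t = real_of_int (i - xc u) / of_int (xc v - xc u)"
  have t: "0 \<le> t" "t \<le> 1" using assms by (auto simp: t_def)
  have "height u v (of_int i) = of_int (yc u) + t * of_int (yc v - yc u)"
    by (simp add: height_def t_def)
  then have h: "height u v (of_int i) = (1 - t) * of_int (yc u) + t * of_int (yc v)"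
    by (simp add: algebra_simps)
  have y: "-16 \<le> real_of_int (yc w)" "real_of_int (yc w) \<le> 16" for w
    using yc_bounds[of w] by linarith+
  have "(1 - t) * -16 + t * -16 \<le> (1 - t) * of_int (yc u) + t * of_int (yc v)"
    using t y by (intro add_mono mult_left_mono) auto
  then show "-16 \<le> height u v (of_int i)" unfolding h by simp
  have "(1 - t) * of_int (yc u) + t * of_int (yc v) \<le> (1 - t) * 16 + t * 16"
    using t y by (intro add_mono mult_left_mono) auto
  then show "height u v (of_int i) \<le> 16" unfolding h by simp
qed

text \<open>At an even abscissa the boundary is at distance 17, while no segment gets beyond 16. An
  odd abscissa belongs to no point, so the segment passes strictly over it and takes part in the
  maximum.\<close>

lemma edge_below_depth:
  assumes "\<not> N u v" "xc u < xc v" "xc u \<le> int i" "int i \<le> xc v" "s = 1 \<or> s = - 1"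
  shows "of_int s * height u v (real i) \<le> depth N s i"
proof (cases "even i")
  case True
  have "0 < i" using assms xc_bounds[of u] by linarith
  then show ?thesis
    using True assms height_between[of u "int i" v] by (auto simp: depth_def)
next
  case False
  have ne: "int i \<noteq> xc w" for w
    using False xc_even[of w] by (metis even_of_nat)
  have "spans u v (int i)"
    using assms(2-4) ne[of u] ne[of v] unfolding spans_def by linarith
  then have "of_int s * height u v (real i) \<le> Max (insert 1 ((\<lambda>(u, v). of_int s * height u v (real i)) `
      {(u, v). \<not> N u v \<and> spans u v (int i)}))"
    using assms(1)
    by (intro Max_ge finite.insertI finite_depth insertI2 image_eqI[of _ _ "(u, v)"]) simp_all
  moreover have "i \<noteq> 0" using False by (metis even_zero)
  ultimately show ?thesis using False unfolding depth_def by (simp only: if_False)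
qed

text \<open>Between consecutive integers both sides are affine, so the comparison at integers
  extends by convex combination.\<close>

lemma edge_below_interp:
  assumes "\<not> N u v" "xc u < xc v" "of_int (xc u) \<le> x" "x \<le> of_int (xc v)" "s = 1 \<or> s = - 1"
  shows "of_int s * height u v x \<le> interp 400 (depth N s) x"
proof -
  define k t where "k = nat \<lfloor>x\<rfloor>" and "t = x - of_int \<lfloor>x\<rfloor>"
  have floor: "xc u \<le> \<lfloor>x\<rfloor>" "\<lfloor>x\<rfloor> \<le> xc v"
    using assms(3,4) by (simp_all add: le_floor_iff floor_le_iff)
  then have "0 \<le> \<lfloor>x\<rfloor>" using xc_bounds(1)[of u] by linarith
  then have int_k: "int k = \<lfloor>x\<rfloor>" by (simp only: k_def nat_0_le)
  then have real_k: "real k = of_int \<lfloor>x\<rfloor>" by (metis of_int_of_nat_eq)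
  have k: "x = real k + t" "xc u \<le> int k" "int k \<le> xc v" "0 \<le> t" "t < 1"
    using floor unfolding int_k real_k t_def by linarith+
  have k400: "k < 400" using k(3) xc_bounds(2)[of v] by linarith
  have 1: "of_int s * height u v (real k) \<le> depth N s k"
    using k(2,3) assms(1,2,5) by (intro edge_below_depth)
  \<comment> \<open>At the right end of the segment \<open>k + 1\<close> may lie beyond
    \<open>xc v\<close>, where the segment has stopped; but then \<open>t = 0\<close> and this term
    carries no weight.\<close>
  have 2: "of_int s * height u v (real k + 1) \<le> depth N s (Suc k)" if "t \<noteq> 0"
  proof -
    have "real k < real_of_int (xc v)" using k(1,4) assms(4) that by linarith
    then have "int (Suc k) \<le> xc v" by linarith
    then show ?thesis
      using k(2) assms(1,2,5) edge_below_depth[of N u v "Suc k" s] by (simp add: add.commute)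
  qed
  have "t * (of_int s * height u v (real k + 1)) \<le> t * depth N s (Suc k)"
    using 2 k(4) by (cases "t = 0") (simp_all add: mult_left_mono)
  moreover have "(1 - t) * (of_int s * height u v (real k)) \<le> (1 - t) * depth N s k"
    using 1 k(5) by (intro mult_left_mono) simp_all
  moreover have "of_int s * height u v x = (1 - t) * (of_int s * height u v (real k)) + t * (of_int s * height u v (real k + 1))"
  proof -
    have "height u v x = (1 - t) * height u v (real k) + t * height u v (real k + 1)"
      using height_affine[of u v "real k" t] by (simp only: k(1))
    then show ?thesis by (simp add: distrib_left)
  qed
  moreover have "interp 400 (depth N s) x = (1 - t) * depth N s k + t * depth N s (Suc k)"
    unfolding k(1) using k400 k(4,5) by (intro interp_segment) (simp_all add: depth_def)
  ultimately show ?thesis by linarith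
qed

text \<open>If all segments of \<open>m\<close> are non-edges, every edge over \<open>x = i\<close>
  is strictly nearer than \<open>uv\<close>, and so is the tip of the spike, whose depth is the
  largest of these heights and 1.\<close>

lemma exposed:
  assumes "((u, v), ws) \<in> set blockers" "(i, s, m) \<in> set ws"
    and m: "\<And>u' v'. (u', v') \<in> set m \<Longrightarrow> N u' v'" and N: "symp N" "N u v"
  shows "interp 400 (depth N s) (of_int i) < of_int s * height u v (of_int i)"
proof -
  note b = blockers_correct[OF assms(1,2)]
  define k where "k = nat i"
  have k: "i = int k" "odd k" "k < 400" using b(1-3) by (auto simp: k_def even_nat_iff)
  have above: "of_int s * height u' v' (real k) < of_int s * height u v (real k)"
    if "\<not> N u' v'" "spans u' v' (int k)" for u' v'
  proof -
    \<comment> \<open>By symmetry of \<open>N\<close> an edge can be neither orientation of the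
      non-edge \<open>uv\<close>, nor of a member of \<open>m\<close>.\<close>
    have "{u', v'} \<noteq> {u, v}"
      using that(1) N(2) sympD[OF N] unfolding doubleton_eq_iff by blast
    moreover have "(u', v') \<notin> set m" "(v', u') \<notin> set m"
      using that(1) m[of u' v'] m[of v' u'] sympD[OF N(1), of v' u'] by blast+
    ultimately show ?thesis
      using b(8)[of u' v'] that(2) unfolding k(1) by simp
  qed
  let ?H = "(\<lambda>(u, v). of_int s * height u v (real k)) ` {(u, v). \<not> N u v \<and> spans u v (int k)}"
  have "k \<noteq> 0" using k(2) by (metis even_zero)
  then have "depth N s k = Max (insert 1 ?H)"
    using k(2) unfolding depth_def by (simp only: if_False)
  \<comment> \<open>The inserted 1 is handled by \<open>b(7)\<close> and the edges by
    \<open>above\<close>.\<close>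
  also have "\<dots> < of_int s * height u v (real k)"
  proof (rule Max_less_iff[THEN iffD2], intro finite.insertI finite_depth)
    show "\<forall>a \<in> insert 1 ?H. a < of_int s * height u v (real k)"
      using above b(7) unfolding k(1) by auto
  qed simp
  finally show ?thesis
    using interp_at[of k 400 "depth N s"] k(3) unfolding k(1) by (simp add: depth_def[of _ _ 0])
qed

section \<open>The drawing against the obstacle\<close>

text \<open>The length 400 exceeds all abscissas, so every segment lies over the part where the
  boundary really interpolates the depths.\<close>

lemma strip_depth: "strip 400 (depth N 1) (depth N (- 1))"
  by unfold_locales (simp_all add: depth_pos depth_def[of _ _ 0])

text \<open>Stated for any two of the seven positions: whether a segment meets the obstacle does not
  depend on which of the remaining points are used.\<close>

lemma segment_outer_iff:
  assumes N: "symp N" "admissible N" and uv: "u \<noteq> v"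
  shows "closed_segment (loc u) (loc v) \<inter> strip.outer 400 (depth N 1) (depth N (- 1)) = {} \<longleftrightarrow> \<not> N u v"
    (is "?S u v \<inter> ?C = {} \<longleftrightarrow> _")
proof -
  interpret strip 400 "depth N 1" "depth N (- 1)" by (rule strip_depth)
  have clear: "?S u v \<inter> ?C = {}" if "\<not> N u v" "xc u < xc v" for u v
  proof (rule equals0I)
    fix p assume p: "p \<in> ?S u v \<inter> ?C"
    then have seg: "of_int (xc u) \<le> p $ 1" "p $ 1 \<le> of_int (xc v)" "p $ 2 = height u v (p $ 1)"
      unfolding closed_segment_loc[OF that(2)] by auto
    have "0 < real_of_int (xc u)" using xc_bounds(1) by simp
    then have "0 < p $ 1" using seg(1) by linarith
    moreover have "p $ 2 \<le> f (p $ 1)"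
      using edge_below_interp[of N u v "p $ 1" 1] that seg by simp
    moreover have "- (p $ 2) \<le> g (p $ 1)"
      using edge_below_interp[of N u v "p $ 1" "- 1"] that seg by simp
    moreover have "p $ 1 < 0 \<or> f (p $ 1) < p $ 2 \<or> p $ 2 < - g (p $ 1)"
      using p unfolding outer_def by blast
    ultimately show False by linarith
  qed
  have blocked: "?S u v \<inter> ?C \<noteq> {}" if "N u v" "((u, v), ws) \<in> set blockers" for u v ws
  proof -
    have "\<exists>(i, s, m) \<in> set ws. \<forall>(u', v') \<in> set m. N u' v'"
      using bspec[OF N(2)[unfolded admissible_def] that(2)] that(1) by simp
    then obtain i s m where w: "(i, s, m) \<in> set ws" and m: "\<forall>(u', v') \<in> set m. N u' v'"
      by auto
    note b = blockers_correct[OF that(2) w]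
    have m': "N u' v'" if "(u', v') \<in> set m" for u' v' using bspec[OF m that] by simp
    \<comment> \<open>The point of the segment on the line of the chosen spike lies beyond the tip
      of that spike.\<close>
    let ?p = "pt (of_int i) (height u v (of_int i))"
    have "interp 400 (depth N s) (of_int i) < of_int s * height u v (of_int i)"
      using m' by (rule exposed[OF that(2) w _ N(1) that(1)])
    \<comment> \<open>The sign \<open>s\<close> decides between the spike from above and the spike
      from below.\<close>
    then have "f (of_int i) < height u v (of_int i) \<or> height u v (of_int i) < - g (of_int i)"
      using b(6) by (elim disjE) simp_all
    then have "?p \<in> ?C" unfolding outer_def mem_Collect_eq pt_nth by blast
    moreover have "xc u < xc v" using b(4,5) by linarith
    then have "?p \<in> ?S u v"
      using b(4,5) unfolding closed_segment_loc[OF \<open>xc u < xc v\<close>] mem_Collect_eq pt_nth by simp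
    ultimately show ?thesis by blast
  qed
  have "?S u v \<inter> ?C = {}" if "\<not> N u v"
  proof (cases "xc u < xc v")
    case True then show ?thesis using clear that by blast
  next
    case False
    then have "xc v < xc u" using xc_inject[of u v] uv by simp
    moreover have "\<not> N v u" using N that by (auto dest: sympD)
    ultimately show ?thesis using clear[of v u] by (simp add: closed_segment_commute)
  qed
  moreover have "?S u v \<inter> ?C \<noteq> {}" if "N u v"
    using uv
  proof (cases rule: blockers_complete)
    case 1 then show ?thesis using blocked that by blast
  next
    case 2
    moreover have "N v u" using N that by (auto dest: sympD)
    ultimately show ?thesis using blocked[of v u] by (simp add: closed_segment_commute)
  qed
  ultimately show ?thesis by blast
qed

text \<open>Every point has an even abscissa, where both curves are at distance 17 from the axis and
  no spike comes near.\<close>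

lemma loc_not_outer: "loc v \<notin> strip.outer 400 (depth N 1) (depth N (- 1))"
proof -
  interpret strip 400 "depth N 1" "depth N (- 1)" by (rule strip_depth)
  define k where "k = nat (xc v)"
  have k: "xc v = int k" "even k" "0 < k" "k < 400"
    using xc_bounds[of v] xc_even[of v] by (auto simp: k_def even_nat_iff)
  have "interp 400 (depth N s) (real k) = depth N s k" for s
    using k(4) by (intro interp_at) (simp_all add: depth_def)
  moreover have "depth N s k = 17" for s using k(2,3) by (simp add: depth_def)
  moreover have "real_of_int (xc v) = real k" using k(1) by simp
  ultimately have "f (real_of_int (xc v)) = 17" "g (real_of_int (xc v)) = 17" by simp_all
  moreover have "0 < real_of_int (xc v)" "-16 \<le> real_of_int (yc v)" "real_of_int (yc v) \<le> 16"
    using xc_bounds(1)[of v] yc_bounds[of v] by linarith+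
  ultimately show ?thesis
    unfolding outer_def loc_def mem_Collect_eq pt_nth by linarith
qed

text \<open>The injection \<open>j\<close> selects the positions that are occupied. The obstacle is
  built from \<open>N\<close> on all seven, and unoccupied points are simply absent from the
  drawing.\<close>

lemma outside_obstacle_rep_admissible:
  assumes "finite V" "inj_on j V" "symp N" "admissible N"
    and E: "\<And>a b. a \<in> V \<Longrightarrow> b \<in> V \<Longrightarrow> E a b \<longleftrightarrow> a \<noteq> b \<and> \<not> N (j a) (j b)"
  shows "outside_obstacle_rep V E (loc ` j ` V) (strip.outer 400 (depth N 1) (depth N (- 1)))"
    (is "outside_obstacle_rep V E ?P ?C")
proof -
  interpret strip 400 "depth N 1" "depth N (- 1)" by (rule strip_depth)
  have inj: "inj_on (loc \<circ> j) V"
    using assms(2) inj_loc by (intro comp_inj_on) (auto intro: inj_on_subset)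
  have vis: "E a b \<longleftrightarrow> visible ?C ?P (loc (j a)) (loc (j b))" if "a \<in> V" "b \<in> V" for a b
  proof (cases "a = b")
    case True then show ?thesis using E that by (auto simp: visible_def)
  next
    case False
    then have "j a \<noteq> j b" "loc (j a) \<noteq> loc (j b)"
      using that assms(2) inj_loc by (auto dest: inj_onD injD)
    then show ?thesis
      using E that False segment_outer_iff[OF assms(3,4)] by (auto simp: visible_def)
  qed
  have "visibility_drawing ?C ?P \<inter> ?C = {}"
    unfolding visibility_drawing_def
  proof (rule equals0I, elim IntE UnE)
    fix p assume "p \<in> ?P" "p \<in> ?C"
    then show False using loc_not_outer by blast
  next
    fix p assume "p \<in> \<Union> {closed_segment p q |p q. visible ?C ?P p q}" "p \<in> ?C"
    then show False unfolding visible_def by blast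
  qed
  then have "?C \<subseteq> - visibility_drawing ?C ?P" by blast
  \<comment> \<open>Being connected and nonempty, the obstacle lies in one component of the
    complement of the drawing, which inherits its unboundedness.\<close>
  moreover have "?C \<noteq> {}" using unbounded_outer by auto
  ultimately obtain K where K: "K \<in> components (- visibility_drawing ?C ?P)" "?C \<subseteq> K"
    using exists_component_superset[of ?C "- visibility_drawing ?C ?P"] connected_outer
    by (metis compl_le_swap1 empty_subsetI subset_antisym)
  show ?thesis
    unfolding outside_obstacle_rep_def
  proof (intro conjI)
    show "obstacle ?C" by (rule obstacle_outer)
    show "finite ?P" using assms(1) by simp
    show "general_position ?P" by (rule general_position_loc)
    show "?P \<inter> ?C = {}" using loc_not_outer by blast
    show "\<exists>h. bij_betw h V ?P \<and> (\<forall>u\<in>V. \<forall>v\<in>V. E u v \<longleftrightarrow> visible ?C ?P (h u) (h v))"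
      using inj vis by (intro exI[of _ "loc \<circ> j"]) (simp add: bij_betw_def image_comp)
    show "\<exists>K \<in> components (- visibility_drawing ?C ?P). \<not> bounded K \<and> ?C \<subseteq> K"
      using K unbounded_outer bounded_subset by blast
  qed
qed

section \<open>From arbitrary graphs to the seven positions\<close>

lemma card_vert: "card (UNIV :: vert set) = 7"
proof -
  have "card (set verts) = length verts"
    by (rule distinct_card) (simp add: verts_def)
  moreover have "length verts = 7" by (simp add: verts_def)
  ultimately show ?thesis by (simp only: set_verts)
qed

theorem theorem2:
  fixes V :: "'a set" and E :: "'a \<Rightarrow> 'a \<Rightarrow> bool"
  assumes "finite V" and "card V \<le> 7"
    and "\<And>u v. E u v \<Longrightarrow> u \<in> V \<and> v \<in> V"
    and "\<And>u v. E u v \<Longrightarrow> E v u"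
    and "\<And>u. \<not> E u u"
  shows "\<exists>P C. outside_obstacle_rep V E P C"
proof -
  obtain j :: "'a \<Rightarrow> vert" where j: "inj_on j V"
    using card_le_inj[of V "UNIV :: vert set"] assms(1,2) finite_vert card_vert by auto
  \<comment> \<open>A label outside the image of \<open>j\<close> is non-adjacent to everything,
    which pads the graph with isolated vertices up to seven.\<close>
  define N where "N u v \<longleftrightarrow> \<not> (\<exists>a \<in> V. \<exists>b \<in> V. j a = u \<and> j b = v \<and> E a b)" for u v
  have N: "N (j a) (j b) \<longleftrightarrow> \<not> E a b" if "a \<in> V" "b \<in> V" for a b
    using that j unfolding N_def by (metis inj_onD)
  have "symp N"
    using assms(4) unfolding symp_def N_def by blast
  then obtain p where p: "inj p" "admissible (\<lambda>u v. N (p u) (p v))"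
    using settled_empty consistent_empty unfolding settled_def by blast
  have "surj p" using p(1) finite_vert by (rule finite_UNIV_inj_surj[rotated])
  then have inv: "p (inv p u) = u" for u by (rule surj_f_inv_f)
  \<comment> \<open>\<open>p\<close> sends positions to labels, so the vertex labelled
    \<open>j a\<close> has to be placed at position \<open>inv p (j a)\<close>.\<close>
  have "inj_on (inv p \<circ> j) V"
    using j \<open>surj p\<close> by (intro comp_inj_on) (auto intro: inj_on_subset surj_imp_inj_inv)
  moreover have "symp (\<lambda>u v. N (p u) (p v))"
    using \<open>symp N\<close> by (simp add: symp_def)
  moreover have "E a b \<longleftrightarrow> a \<noteq> b \<and> \<not> N (p ((inv p \<circ> j) a)) (p ((inv p \<circ> j) b))"
    if "a \<in> V" "b \<in> V" for a b
    using N[OF that] assms(5) by (auto simp: inv)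
  ultimately show ?thesis
    using outside_obstacle_rep_admissible[OF assms(1) _ _ p(2)] by blast
qed

end
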